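(* Let $s\ge3$, $\alpha\in\mathbb{R}\setminus\mathbb{Q}$ and $A\in C^\omega(\mathbb{T},\mathrm{SO}(s,\mathbb{R}))$. Then the acceleration vector of $(\alpha,A)$ is equal to the vector of dynamical degree of $(\alpha,A)$, i.e. $(\omega_1,\dots,\omega_s)=(d_1,\dots,d_s)$.
   Context: $\mathbb{T}=\mathbb{R}/\mathbb{Z}$; $C^\omega(\mathbb{T},\mathrm{SO}(s,\mathbb{R}))$ is the set of real-analytic maps $\mathbb{T}\to\mathrm{SO}(s,\mathbb{R})$, which extend holomorphically to some strip $\{|\Im x|\le\delta\}$, $\delta>0$. The cocycle $(\alpha,A)$ is the map $(x,v)\mapsto(x+\alpha,A(x)v)$; its iterates are $(n\alpha,A_n)$ with $A_n(x)=A(x+(n-1)\alpha)\cdots A(x)$ for $n\ge1$. Acceleration vector. With $\sigma_1(M)\ge\dots\ge\sigma_s(M)$ the singular values of $M$, set $L_k(\alpha,A)=\lim_{n\to\infty}\frac1n\int_{\mathbb{T}}\ln\sigma_k(A_n(x))\,dx$ and $L^k(\alpha,A)=\sum_{j=1}^kL_j(\alpha,A)$ (also for $\mathrm{GL}(s,\mathbb{C})$-valued maps). Put $A_\epsilon(x)=A(x+i\epsilon)$ for small $|\epsilon|$ and $$\omega^k=\lim_{\epsilon\to0^+}\frac{1}{2\pi\epsilon}\big(L^k(\alpha,A_\epsilon)-L^k(\alpha,A)\big),\qquad \omega_k=\omega^k-\omega^{k-1}\quad(\omega^0=0).$$ The acceleration vector is $(\omega_1,\dots,\omega_s)$. Vector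 of dynamical degree. As $n\to\infty$, $\frac1nA_n(\cdot)^{-1}\partial A_n(\cdot)$ ($\partial=d/dx$) converges in $L^2(\mathbb{T},\mathfrak{so}(s,\mathbb{R}))$ to some $D(\cdot)$, by von Neumann's ergodic theorem, and $A(x)^{-1}D(x+\alpha)A(x)=D(x)$ for a.e. $x$. Hence (by ergodicity) the conjugacy class of $D(x)$ is the same for a.e. $x$; any matrix $D$ in this class is called the dynamical degree of $(\alpha,A)$. Since $D\in\mathfrak{so}(s,\mathbb{R})$, there are $Q\in\mathrm{SU}(s)$ and real numbers $d_1\ge\dots\ge d_s$ with $D=Q\cdot2\pi i\,\mathrm{diag}(d_1,\dots,d_s)\cdot Q^{-1}$; the vector of dynamical degree is $(d_1,\dots,d_s)$. *)

theory Defs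
  imports "HOL-Analysis.Analysis" "HOL-Computational_Algebra.Computational_Algebra"
begin

text \<open>
  A square matrix of size \<open>s\<close> is a matrix over an index type \<open>'s\<close> with \<open>CARD('s) = s\<close>.
  Functions on the circle \<open>\<real>/\<int>\<close> are 1-periodic functions on the line, and integrals over the
  circle are Lebesgue integrals over the fundamental domain \<open>{0..1}\<close>.
\<close>

abbreviation circle_measure :: "real measure" where
  "circle_measure \<equiv> lebesgue_on {0..1}"

abbreviation of_real_matrix :: "real^'s^'s \<Rightarrow> complex^'s^'s" where
  "of_real_matrix \<equiv> map_matrix complex_of_real"

definition adjoint_matrix :: "complex^'s^'s \<Rightarrow> complex^'s^'s" where
  "adjoint_matrix M = transpose (map_matrix cnj M)"

definition special_unitary :: "complex^'s^'s \<Rightarrow> bool" where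
  "special_unitary Q \<longleftrightarrow>
     adjoint_matrix Q ** Q = mat 1 \<and> Q ** adjoint_matrix Q = mat 1 \<and> det Q = 1"

subsection \<open>Singular values\<close>

definition charpoly :: "complex^'s^'s \<Rightarrow> complex poly" where
  "charpoly M = det (mat [:0, 1:] - map_matrix (\<lambda>c. [:c:]) M)"

text \<open>
  Square roots of the eigenvalues of \<open>M\<^sup>* M\<close>, with multiplicity, in non-increasing order.
  These eigenvalues are real and non-negative, so taking real parts loses nothing.
\<close>

definition singular_values :: "complex^'s^'s \<Rightarrow> real list" where
  "singular_values M =
     rev (sorted_list_of_multiset
       (image_mset (\<lambda>z. sqrt (Re z)) (proots (charpoly (adjoint_matrix M ** M)))))"

definition singular_value :: "nat \<Rightarrow> complex^'s^'s \<Rightarrow> real" where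
  "singular_value k M = singular_values M ! (k - 1)"  \<comment> \<open>for \<open>1 \<le> k \<le> CARD('s)\<close>\<close>

subsection \<open>Cocycles and Lyapunov exponents\<close>

primrec cocycle_iterate ::
    "real \<Rightarrow> (real \<Rightarrow> 'a::semiring_1^'s^'s) \<Rightarrow> nat \<Rightarrow> real \<Rightarrow> 'a^'s^'s" where
  "cocycle_iterate \<alpha> A 0 x = mat 1"
| "cocycle_iterate \<alpha> A (Suc n) x = A (x + real n * \<alpha>) ** cocycle_iterate \<alpha> A n x"

definition lyapunov_exponent :: "real \<Rightarrow> (real \<Rightarrow> complex^'s^'s) \<Rightarrow> nat \<Rightarrow> real" where
  "lyapunov_exponent \<alpha> B k =
     lim (\<lambda>n. 1 / real n *
       (LINT x|circle_measure. ln (singular_value k (cocycle_iterate \<alpha> B n x))))"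

definition lyapunov_sum :: "real \<Rightarrow> (real \<Rightarrow> complex^'s^'s) \<Rightarrow> nat \<Rightarrow> real" where
  "lyapunov_sum \<alpha> B k = (\<Sum>j = 1..k. lyapunov_exponent \<alpha> B j)"

subsection \<open>Analytic cocycles and the acceleration vector\<close>

definition real_analytic :: "(real \<Rightarrow> 'b::real_normed_vector) \<Rightarrow> bool" where
  "real_analytic f \<longleftrightarrow>
     (\<forall>x0. \<exists>r>0. \<exists>a. \<forall>x. \<bar>x - x0\<bar> < r \<longrightarrow> (\<lambda>n. (x - x0) ^ n *\<^sub>R a n) sums f x)"

definition analytic_circle_SO :: "(real \<Rightarrow> real^'s^'s) set" where
  "analytic_circle_SO =
     {A. real_analytic A \<and> (\<forall>x. A (x + 1) = A x) \<and> (\<forall>x. rotation_matrix (A x))}"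

definition strip_extension ::
    "(real \<Rightarrow> real^'s^'s) \<Rightarrow> real \<Rightarrow> (complex \<Rightarrow> complex^'s^'s) \<Rightarrow> bool" where
  "strip_extension A \<delta> F \<longleftrightarrow>
     (\<forall>i j. (\<lambda>z. F z $ i $ j) holomorphic_on {z. \<bar>Im z\<bar> < \<delta>}) \<and>
     (\<forall>x. F (complex_of_real x) = of_real_matrix (A x))"

text \<open>
  Any two strip extensions agree on the smaller of their strips, so the choice below does not
  affect the values close to the real line, which are the only ones used.
\<close>

definition complexification :: "(real \<Rightarrow> real^'s^'s) \<Rightarrow> complex \<Rightarrow> complex^'s^'s" where
  "complexification A = (SOME F. \<exists>\<delta>>0. strip_extension A \<delta> F)"

definition shifted :: "(real \<Rightarrow> real^'s^'s) \<Rightarrow> real \<Rightarrow> real \<Rightarrow> complex^'s^'s" where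
  "shifted A \<epsilon> x = complexification A (Complex x \<epsilon>)"

definition acceleration_sum :: "real \<Rightarrow> (real \<Rightarrow> real^'s^'s) \<Rightarrow> nat \<Rightarrow> real" where
  "acceleration_sum \<alpha> A k =
     Lim (at_right 0) (\<lambda>\<epsilon>. 1 / (2 * pi * \<epsilon>) *
       (lyapunov_sum \<alpha> (shifted A \<epsilon>) k - lyapunov_sum \<alpha> (\<lambda>x. of_real_matrix (A x)) k))"

text \<open>The value at \<open>k = 0\<close> of \<^const>\<open>acceleration_sum\<close> is the limit of an empty sum, that is, zero.\<close>

definition acceleration :: "real \<Rightarrow> (real \<Rightarrow> real^'s^'s) \<Rightarrow> nat \<Rightarrow> real" where
  "acceleration \<alpha> A k = acceleration_sum \<alpha> A k - acceleration_sum \<alpha> A (k - 1)"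

subsection \<open>Dynamical degree\<close>

text \<open>\<open>D\<close> is the limit of \<open>A\<^sub>n\<^sup>-\<^sup>1 \<partial>A\<^sub>n / n\<close> in \<open>L\<^sup>2\<close> of the circle with skew-symmetric values.\<close>

definition degree_field ::
    "real \<Rightarrow> (real \<Rightarrow> real^'s^'s) \<Rightarrow> (real \<Rightarrow> real^'s^'s) \<Rightarrow> bool" where
  "degree_field \<alpha> A D \<longleftrightarrow>
     D \<in> borel_measurable circle_measure \<and>
     integrable circle_measure (\<lambda>x. (norm (D x))\<^sup>2) \<and>
     (AE x in circle_measure. transpose (D x) = - D x) \<and>
     (\<lambda>n. LINT x|circle_measure.
        (norm ((1 / real n) *\<^sub>R
           (matrix_inv (cocycle_iterate \<alpha> A n x) **
            vector_derivative (cocycle_iterate \<alpha> A n) (at x)) - D x))\<^sup>2) \<longlonglongrightarrow> 0"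

definition dynamical_degree ::
    "real \<Rightarrow> (real \<Rightarrow> real^'s^'s) \<Rightarrow> real^'s^'s \<Rightarrow> bool" where
  "dynamical_degree \<alpha> A D0 \<longleftrightarrow>
     (\<exists>D. degree_field \<alpha> A D \<and>
        (AE x in circle_measure. \<exists>P. rotation_matrix P \<and> D x = P ** D0 ** matrix_inv P))"

text \<open>
  A fixed numbering \<open>1, \<dots>, s\<close> of the coordinates, needed only to write down a diagonal matrix
  with entries \<open>d\<^sub>1, \<dots>, d\<^sub>s\<close>.  Changing it conjugates the matrix by an element of \<open>SU(s)\<close>.
\<close>

definition coord_number :: "'s::finite \<Rightarrow> nat" where
  "coord_number = (SOME e. bij_betw e UNIV {1..CARD('s)})"

definition diag_matrix :: "(nat \<Rightarrow> complex) \<Rightarrow> complex^'s^'s" where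
  "diag_matrix c = (\<chi> i j. if i = j then c (coord_number i) else 0)"

definition dynamical_degree_vector ::
    "real \<Rightarrow> (real \<Rightarrow> real^'s^'s) \<Rightarrow> (nat \<Rightarrow> real) \<Rightarrow> bool" where
  "dynamical_degree_vector \<alpha> A d \<longleftrightarrow>
     (\<forall>j k. 1 \<le> j \<and> j \<le> k \<and> k \<le> CARD('s) \<longrightarrow> d k \<le> d j) \<and>
     (\<exists>D0 Q. dynamical_degree \<alpha> A D0 \<and> special_unitary Q \<and>
        of_real_matrix D0 =
          Q ** diag_matrix (\<lambda>k. 2 * complex_of_real pi * \<i> * complex_of_real (d k)) **
          matrix_inv Q)"

end

theory Submission
  imports Defs "HOL-Complex_Analysis.Complex_Analysis"
begin

text \<open>
  Let \<open>u\<^sub>n(z)\<close> be the logarithm of the product of the \<open>k\<close> largest singular values of the iterate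
  \<open>A\<^sub>n(z)\<close>, and let \<open>f\<^sub>n(\<epsilon>)\<close> be its average over the circle at height \<open>\<epsilon>\<close>. Since \<open>u\<^sub>n\<close> is a supremum
  of functions \<open>ln \<bar>h\<bar>\<close> with \<open>h\<close> holomorphic, \<open>f\<^sub>n\<close> is convex, and \<open>f\<^sub>n(0) = 0\<close> because \<open>A\<close> is orthogonal
  on the real axis. The right derivative of \<open>f\<^sub>n\<close> at \<open>0\<close> is the average of the sum of the \<open>k\<close> largest
  eigenvalues of the Hermitian matrix \<open>i A\<^sub>n\<^sup>-\<^sup>1 \<partial>A\<^sub>n\<close>. Divided by \<open>n\<close> it tends to
  \<open>2 \<pi> (d\<^sub>1 + \<dots> + d\<^sub>k)\<close>, as that sum is a Lipschitz function of the matrix.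

  By convexity \<open>f\<^sub>n(\<epsilon>) \<ge> \<epsilon> f\<^sub>n'(0+)\<close>, which bounds \<open>L\<^sup>k(A\<^sub>\<epsilon>) = lim f\<^sub>n(\<epsilon>) / n\<close> from below by
  \<open>2 \<pi> \<epsilon> (d\<^sub>1 + \<dots> + d\<^sub>k)\<close>. By subadditivity \<open>L\<^sup>k(A\<^sub>\<epsilon>) \<le> f\<^sub>n(\<epsilon>) / n\<close> for every fixed \<open>n\<close>, which bounds the
  right derivative of \<open>L\<^sup>k(A\<^sub>\<epsilon>)\<close> at \<open>0\<close> from above by \<open>f\<^sub>n'(0+) / n\<close>. Letting \<open>n \<rightarrow> \<infinity>\<close> gives the claim.
\<close>

text \<open>\<^theory>\<open>HOL-Computational_Algebra.Formal_Laurent_Series\<close> leaves this notation active, and it clashes with vector components.\<close>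

no_notation fps_nth (infixl \<open>$\<close> 75)

text \<open>Exterior powers are avoided: the product of the k largest singular values is the largest
  modulus of a k-by-k principal minor of \<open>P ** M ** Q\<close> over unitary \<open>P\<close>
  and \<open>Q\<close>. A fixed pair gives a holomorphic function on the strip, and the maximum is
  attained, so at each point a holomorphic minor touches the supremum from below. Subharmonicity is
  used only through the four points of a small cross, with an error O(r^3). After averaging over the
  circle the two horizontal points cancel against the centre, and second differences bounded below
  by -C r^3 already force convexity. The constants of the first-order expansion depend on n, so it
  cannot be passed to the limit. Convexity therefore supplies a lower bound without error term, and
  the infimum in Fekete's lemma supplies the upper bound from one fixed n at a time. The derivative
  is one-sided because 1 + e H takes its k largest eigenvalues from the k largest of H only for e
  \<ge> 0.\<close>

lemma sum_delta_mult [simp]: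
  fixes f :: "'i::finite \<Rightarrow> 'a::comm_semiring_1"
  shows "(\<Sum>j\<in>UNIV. (if i = j then 1 else 0) * f j) = f i"
    and "(\<Sum>j\<in>UNIV. (if j = i then 1 else 0) * f j) = f i"
    and "(\<Sum>j\<in>UNIV. f j * (if i = j then 1 else 0)) = f i"
    and "(\<Sum>j\<in>UNIV. f j * (if j = i then 1 else 0)) = f i"
  by (simp_all add: if_distrib if_distribR cong: if_cong)

lemma matrix_mult_nth: "(A ** B) $ i $ j = (\<Sum>l\<in>UNIV. A $ i $ l * B $ l $ j)"
  by (simp add: matrix_matrix_mult_def)

section \<open>Adjoints, unitary matrices and the Frobenius norm\<close>

abbreviation adj :: "complex^'s^'s \<Rightarrow> complex^'s^'s" where
  "adj \<equiv> adjoint_matrix"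

definition unitary :: "complex^'s^'s \<Rightarrow> bool" where
  "unitary P \<longleftrightarrow> adj P ** P = mat 1"

lemma adj_nth [simp]: "adj M $ i $ j = cnj (M $ j $ i)"
  by (simp add: adjoint_matrix_def transpose_def)

lemma adj_mult: "adj (A ** B) = adj B ** adj A"
  by (simp add: vec_eq_iff matrix_matrix_mult_def mult.commute)

lemma adj_adjoint [simp]: "adj (adj A) = A"
  by (simp add: vec_eq_iff)

lemma adj_1 [simp]: "adj (mat 1) = mat 1"
  by (simp add: vec_eq_iff mat_def)

lemma unitary_left: "unitary P \<Longrightarrow> adj P ** P = mat 1"
  by (simp add: unitary_def)

lemma unitary_right: "unitary P \<Longrightarrow> P ** adj P = mat 1"
  using unitary_def matrix_left_right_inverse by blast

lemma unitary_1 [simp]: "unitary (mat 1)"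
  by (simp add: unitary_def)

lemma unitary_adjoint [simp]: "unitary (adj P) \<longleftrightarrow> unitary P"
  using matrix_left_right_inverse by (auto simp: unitary_def)

lemma unitary_mult: "unitary P \<Longrightarrow> unitary Q \<Longrightarrow> unitary (P ** Q)"
  unfolding unitary_def adj_mult
  by (metis matrix_mul_assoc matrix_mul_lid)

lemma unitary_cancel:
  assumes "unitary P"
  shows "adj P ** (P ** M) = M" "P ** (adj P ** M) = M"
  using unitary_left[OF assms] unitary_right[OF assms]
  by (metis matrix_mul_assoc matrix_mul_lid)+

lemma norm_vec_power2: "(norm (v :: complex^'s))\<^sup>2 = (\<Sum>i\<in>UNIV. (norm (v $ i))\<^sup>2)"
  unfolding norm_vec_def L2_set_def by (simp add: sum_nonneg)

lemma norm_vec_power2_complex: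
  "complex_of_real ((norm (v :: complex^'s))\<^sup>2) = (\<Sum>i\<in>UNIV. cnj (v $ i) * v $ i)"
  unfolding norm_vec_power2 of_real_sum
  by (intro sum.cong refl) (metis complex_norm_square mult.commute)

lemma norm_unitary_mult_vec:
  assumes "unitary P"
  shows "norm (P *v v) = norm v"
proof -
  have "complex_of_real ((norm (P *v v))\<^sup>2)
      = (\<Sum>i\<in>UNIV. \<Sum>a\<in>UNIV. \<Sum>b\<in>UNIV. cnj (v $ a) * (cnj (P $ i $ a) * P $ i $ b) * v $ b)"
    unfolding norm_vec_power2_complex
    unfolding matrix_vector_mult_def vec_lambda_beta cnj_sum sum_product
    by (intro sum.cong refl) (simp add: mult_ac)
  also have "\<dots> = (\<Sum>a\<in>UNIV. \<Sum>b\<in>UNIV. \<Sum>i\<in>UNIV. cnj (v $ a) * (cnj (P $ i $ a) * P $ i $ b) * v $ b)"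
    by (subst sum.swap, rule sum.cong[OF refl], rule sum.swap)
  also have "\<dots> = (\<Sum>a\<in>UNIV. \<Sum>b\<in>UNIV. cnj (v $ a) * (adj P ** P) $ a $ b * v $ b)"
    by (simp add: matrix_matrix_mult_def sum_distrib_left sum_distrib_right)
  also have "\<dots> = complex_of_real ((norm v)\<^sup>2)"
    unfolding norm_vec_power2_complex
    by (simp add: unitary_left[OF assms] mat_def if_distrib if_distribR sum.If_cases cong: if_cong)
  finally have "(norm (P *v v))\<^sup>2 = (norm v)\<^sup>2"
    by (metis of_real_eq_iff)
  then show ?thesis
    by simp
qed

text \<open>The \<open>norm\<close> of a matrix is the Frobenius norm; Cauchy-Schwarz in each row
  shows that it dominates the operator norm.\<close>

lemma norm_matrix_mult_vec_le: "norm ((M :: complex^'s^'s) *v v) \<le> norm M * norm v"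
proof -
  have row: "norm ((M *v v) $ i) \<le> norm (M $ i) * norm v" for i
  proof -
    have "norm ((M *v v) $ i) \<le> (\<Sum>j\<in>UNIV. norm (M $ i $ j) * norm (v $ j))"
      unfolding matrix_vector_mult_def by (simp add: order.trans[OF norm_sum] norm_mult)
    also have "\<dots> \<le> L2_set (\<lambda>j. norm (M $ i $ j)) UNIV * L2_set (\<lambda>j. norm (v $ j)) UNIV"
      using L2_set_mult_ineq[of "\<lambda>j. norm (M $ i $ j)" "\<lambda>j. norm (v $ j)" UNIV] by simp
    finally show ?thesis
      by (simp add: norm_vec_def)
  qed
  have "norm (M *v v) \<le> L2_set (\<lambda>i. norm (M $ i) * norm v) UNIV"
    unfolding norm_vec_def[of "M *v v"] by (rule L2_set_mono) (use row in auto)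
  also have "\<dots> = norm M * norm v"
    by (simp add: L2_set_left_distrib norm_vec_def[of M])
  finally show ?thesis .
qed

subsection \<open>Contractions\<close>

text \<open>A bound on the operator norm. The Frobenius norm cannot express contractions: a unitary
  matrix of size s has Frobenius norm sqrt s.\<close>

definition norm_bounded :: "real \<Rightarrow> complex^'s^'s \<Rightarrow> bool" where
  "norm_bounded c M \<longleftrightarrow> (\<forall>v. norm (M *v v) \<le> c * norm v)"

lemma norm_bounded_mult:
  assumes "norm_bounded c M" "norm_bounded d N" "0 \<le> c"
  shows "norm_bounded (c * d) (M ** N)"
  unfolding norm_bounded_def
proof
  fix v
  have "norm (M *v (N *v v)) \<le> c * norm (N *v v)"
    using assms by (simp add: norm_bounded_def)
  also have "\<dots> \<le> c * (d * norm v)"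
    using assms by (simp add: norm_bounded_def mult_left_mono)
  finally show "norm ((M ** N) *v v) \<le> c * d * norm v"
    by (simp add: matrix_vector_mul_assoc mult.assoc)
qed

lemma norm_bounded_unitary: "unitary P \<Longrightarrow> norm_bounded 1 P"
  by (simp add: norm_bounded_def norm_unitary_mult_vec)

lemma norm_bounded_norm: "norm_bounded (norm M) M"
  by (simp add: norm_bounded_def norm_matrix_mult_vec_le)

lemma norm_bounded_mono: "norm_bounded c M \<Longrightarrow> c \<le> d \<Longrightarrow> norm_bounded d M"
  unfolding norm_bounded_def by (meson mult_right_mono norm_ge_zero order.trans)

lemma norm_bounded_entry:
  fixes M :: "complex^'s^'s"
  assumes "norm_bounded c M"
  shows "norm (M $ i $ j) \<le> c"
proof -
  have "norm ((M *v axis j 1) $ i) \<le> norm (M *v axis j 1)"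
    by (simp add: Finite_Cartesian_Product.norm_nth_le)
  also have "\<dots> \<le> c * norm (axis j 1 :: complex^'s)"
    using assms unfolding norm_bounded_def by blast
  also have "norm (axis j 1 :: complex^'s) = 1"
    by simp
  finally show ?thesis
    by (simp add: matrix_vector_mult_def axis_def)
qed

text \<open>Powers of a contraction are contractions, so their entries have modulus at most 1 and
  the Leibniz sum bounds |det M|^n by the number of permutations for every n. A base above 1 would
  make these powers unbounded.\<close>

lemma norm_det_contraction_le:
  fixes M :: "complex^'s^'s"
  assumes "norm_bounded 1 M"
  shows "norm (det M) \<le> 1"
proof (rule ccontr)
  assume "\<not> norm (det M) \<le> 1"
  then have gt: "norm (det M) > 1" by simp
  define P where "P n = (((**) M) ^^ n) (mat 1)" for n
  have P: "norm_bounded 1 (P n)" for n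
  proof (induction n)
    case 0
    show ?case by (simp add: P_def norm_bounded_def)
  next
    case (Suc n)
    then show ?case using norm_bounded_mult[OF assms Suc] by (simp add: P_def)
  qed
  have detP: "det (P n) = det M ^ n" for n
    by (induction n) (simp_all add: P_def det_mul)
  let ?S = "{p. p permutes (UNIV :: 's set)}"
  have "norm (det (P n)) \<le> real (card ?S)" for n
  proof -
    have "norm (det (P n)) \<le> (\<Sum>p\<in>?S. norm (of_int (sign p) * (\<Prod>i\<in>UNIV. P n $ i $ p i)))"
      unfolding det_def by (rule norm_sum)
    also have "\<dots> \<le> (\<Sum>p\<in>?S. 1)"
    proof (rule sum_mono)
      fix p assume "p \<in> ?S"
      have "norm (\<Prod>i\<in>UNIV. P n $ i $ p i) \<le> 1"
        unfolding prod_norm[symmetric]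
        by (rule prod_le_1) (use norm_bounded_entry[OF P] in auto)
      then show "norm (of_int (sign p) * (\<Prod>i\<in>UNIV. P n $ i $ p i)) \<le> 1"
        by (simp add: norm_mult sign_def)
    qed
    finally show ?thesis by simp
  qed
  then have "norm (det M) ^ n \<le> real (card ?S)" for n
    by (metis detP norm_power)
  moreover obtain n where "real (card ?S) < norm (det M) ^ n"
    using real_arch_pow[OF gt] by blast
  ultimately show False
    by (meson not_le)
qed

subsection \<open>Principal minors\<close>

text \<open>The block is padded with the identity to full size, so that minors are determinants over
  the same index type and \<open>det_mul\<close> applies.\<close>

definition corner :: "'s set \<Rightarrow> complex^'s^'s \<Rightarrow> complex^'s^'s" where
  "corner K N = (\<chi> i j. if i \<in> K \<and> j \<in> K then N $ i $ j else if i = j then 1 else 0)"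

definition minor :: "'s set \<Rightarrow> complex^'s^'s \<Rightarrow> complex" where
  "minor K N = det (corner K N)"

lemma corner_nth: "corner K N $ i $ j = (if i \<in> K \<and> j \<in> K then N $ i $ j else if i = j then 1 else 0)"
  by (simp add: corner_def)

lemma corner_1 [simp]: "corner K (mat 1) = mat 1"
  by (simp add: vec_eq_iff corner_def mat_def)

lemma minor_1 [simp]: "minor K (mat 1) = 1"
  by (simp add: minor_def)

lemma minor_empty [simp]: "minor {} N = 1"
proof -
  have "corner {} N = mat 1" by (simp add: vec_eq_iff corner_def mat_def)
  then show ?thesis by (simp add: minor_def)
qed

text \<open>The zero block removes every term that passes through an index outside \<open>K\<close>,
  so the block of the product is the product of the blocks, whatever \<open>S\<close> is.\<close>

lemma corner_mult_right:
  assumes "\<And>i j. i \<notin> K \<Longrightarrow> j \<in> K \<Longrightarrow> R $ i $ j = 0"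
  shows "corner K (S ** R) = corner K S ** corner K R"
proof -
  have "corner K (S ** R) $ i $ j = (corner K S ** corner K R) $ i $ j" for i j
  proof (cases "i \<in> K")
    case True
    show ?thesis
    proof (cases "j \<in> K")
      case j: True
      have "S $ i $ l * R $ l $ j = corner K S $ i $ l * corner K R $ l $ j" for l
        using True j assms[of l j] by (auto simp: corner_nth)
      then show ?thesis
        using True j by (simp only: corner_nth[of K "S ** R"]) (simp add: matrix_mult_nth)
    next
      case False
      have "corner K S $ i $ l * corner K R $ l $ j = 0" for l
        using True False by (auto simp: corner_nth)
      then show ?thesis
        using True False unfolding matrix_mult_nth by (simp only: corner_nth[of K "S ** R"]) auto
    qed
  next
    case False
    have "(corner K S ** corner K R) $ i $ j = (\<Sum>l\<in>UNIV. (if l = i then corner K R $ l $ j else 0))"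
      unfolding matrix_matrix_mult_def using False by (auto simp: corner_nth[of K S] intro!: sum.cong)
    then show ?thesis
      using False by (auto simp: corner_nth)
  qed
  then show ?thesis
    by (simp add: vec_eq_iff)
qed

lemma minor_mult_right:
  assumes "\<And>i j. i \<notin> K \<Longrightarrow> j \<in> K \<Longrightarrow> R $ i $ j = 0"
  shows "minor K (S ** R) = minor K S * minor K R"
  using corner_mult_right[of K R S] assms by (simp add: minor_def det_mul)

lemma minor_adjoint: "minor K (adj M) = cnj (minor K M)"
proof -
  have "corner K (adj M) = transpose (map_matrix cnj (corner K M))"
    by (auto simp: vec_eq_iff corner_def transpose_def)
  moreover have "det (map_matrix cnj N) = cnj (det N)" for N :: "complex^'a^'a"
    by (simp add: det_def)
  ultimately show ?thesis
    by (simp add: minor_def)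
qed

lemma minor_mult_left:
  assumes "\<And>i j. i \<in> K \<Longrightarrow> j \<notin> K \<Longrightarrow> R $ i $ j = 0"
  shows "minor K (R ** S) = minor K R * minor K S"
proof -
  have "minor K (adj S ** adj R) = minor K (adj S) * minor K (adj R)"
    by (rule minor_mult_right) (use assms in auto)
  then have "cnj (minor K (R ** S)) = cnj (minor K R * minor K S)"
    by (simp add: minor_adjoint adj_mult[symmetric])
  then show ?thesis
    by (metis complex_cnj_cancel_iff)
qed

text \<open>Only the identity permutation contributes. A contributing \<open>p\<close> fixes every
  index outside \<open>K\<close>; an index of \<open>K\<close> sent outside \<open>K\<close> would
  share its image with that image itself, against injectivity.\<close>

lemma det_unipotent_block:
  fixes T :: "complex^'s^'s"
  assumes "\<And>i j. i \<notin> K \<Longrightarrow> T $ i $ j = (if i = j then 1 else 0)"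
    and "\<And>i j. i \<in> K \<Longrightarrow> j \<in> K \<Longrightarrow> T $ i $ j = (if i = j then 1 else 0)"
  shows "det T = 1"
proof -
  let ?S = "{p. p permutes (UNIV :: 's set)}"
  have id: "id \<in> ?S" by (simp add: permutes_id)
  have zero: "of_int (sign p) * (\<Prod>i\<in>UNIV. T $ i $ p i) = 0" if p: "p \<in> ?S - {id}" for p
  proof (rule ccontr)
    assume "\<not> ?thesis"
    then have nz: "T $ i $ p i \<noteq> 0" for i
      by auto
    have inj: "inj p" using p permutes_inj by auto
    have 1: "p i = i" if "i \<notin> K" for i
      using nz[of i] assms(1)[OF that, of "p i"] by (auto split: if_splits)
    have 2: "p i = i" if "i \<in> K" for i
    proof (cases "p i \<in> K")
      case True
      then show ?thesis using nz[of i] assms(2)[OF that, of "p i"] by (auto split: if_splits)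
    next
      case False
      then have "p (p i) = p i" using 1 by blast
      then show ?thesis using inj by (auto dest: injD)
    qed
    from 1 2 have "p = id" by (metis eq_id_iff)
    with p show False by simp
  qed
  have diag: "T $ i $ i = 1" for i
    using assms by (cases "i \<in> K") auto
  have "det T = of_int (sign (id :: 's \<Rightarrow> 's)) * (\<Prod>i\<in>UNIV. T $ i $ id i)
      + (\<Sum>p\<in>?S - {id}. of_int (sign p) * (\<Prod>i\<in>UNIV. T $ i $ p i))"
    unfolding det_def by (rule sum.remove[OF _ id]) (simp add: finite_permutations)
  also have "(\<Sum>p\<in>?S - {id}. of_int (sign p) * (\<Prod>i\<in>UNIV. T $ i $ p i)) = 0"
    by (intro sum.neutral ballI zero)
  finally show ?thesis
    by (simp add: diag sign_id)
qed

text \<open>Factorisation \<open>R = corner (- K) R ** T ** corner K R\<close>, where the unipotent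
  \<open>T\<close> carries the off-diagonal block.\<close>

lemma det_block_triangular:
  assumes "\<And>i j. i \<notin> K \<Longrightarrow> j \<in> K \<Longrightarrow> R $ i $ j = 0"
  shows "det R = minor K R * minor (- K) R"
proof -
  define T :: "complex^'a^'a" where
    "T = (\<chi> i j. if i \<in> K \<and> j \<notin> K then R $ i $ j else if i = j then 1 else 0)"
  define T' where "T' = corner (- K) R ** T"
  have T': "T' $ i $ j = (if j \<in> K then (if i = j then 1 else 0) else R $ i $ j)" for i j
  proof (cases "i \<in> K")
    case True
    then have "T' $ i $ j = T $ i $ j"
      unfolding T'_def matrix_matrix_mult_def by (simp add: corner_nth)
    then show ?thesis using True by (auto simp: T_def)
  next
    case False
    have "T' $ i $ j = (\<Sum>l\<in>UNIV. if l = j then corner (-K) R $ i $ l else 0)"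
      unfolding T'_def matrix_mult_nth using False
      by (intro sum.cong refl) (auto simp: corner_nth T_def)
    then show ?thesis using False by (auto simp: corner_nth)
  qed
  have "(T' ** corner K R) $ i $ j = R $ i $ j" for i j
  proof (cases "j \<in> K")
    case True
    have "(T' ** corner K R) $ i $ j = (\<Sum>l\<in>UNIV. if l = i then corner K R $ l $ j else 0)"
      unfolding matrix_mult_nth using True
      by (intro sum.cong refl) (auto simp: corner_nth T')
    then show ?thesis using True assms[of i j] by (auto simp: corner_nth)
  next
    case False
    have "(T' ** corner K R) $ i $ j = (\<Sum>l\<in>UNIV. if l = j then T' $ i $ l else 0)"
      unfolding matrix_mult_nth using False
      by (intro sum.cong refl) (auto simp: corner_nth)
    then show ?thesis using False by (auto simp: T')
  qed
  then have "R = T' ** corner K R"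
    by (simp add: vec_eq_iff)
  moreover have "det T = 1"
    by (rule det_unipotent_block[of K]) (auto simp: T_def)
  ultimately show ?thesis
    unfolding T'_def minor_def by (metis det_mul mult.commute mult.right_neutral)
qed

text \<open>\<open>corner K M\<close> is the compression of \<open>M\<close> to the coordinates in
  \<open>K\<close> together with the identity on the others, hence again a contraction.\<close>

lemma norm_minor_contraction_le:
  assumes "norm_bounded 1 M"
  shows "norm (minor K M) \<le> 1"
  unfolding minor_def
proof (rule norm_det_contraction_le)
  show "norm_bounded 1 (corner K M)"
    unfolding norm_bounded_def
  proof
    fix v :: "complex^'a"
    define w where "w = (\<chi> i. if i \<in> K then v $ i else 0)"
    have c: "(corner K M *v v) $ i = (if i \<in> K then (M *v w) $ i else v $ i)" for i
    proof (cases "i \<in> K")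
      case True
      then show ?thesis
        by (auto simp: matrix_vector_mult_def corner_nth w_def intro!: sum.cong)
    next
      case False
      then show ?thesis by (simp add: matrix_vector_mult_def corner_nth)
    qed
    have "(norm (corner K M *v v))\<^sup>2 = (\<Sum>i\<in>K. (norm ((M *v w) $ i))\<^sup>2) + (\<Sum>i\<in>-K. (norm (v $ i))\<^sup>2)"
      unfolding norm_vec_power2 c
      by (subst sum.Int_Diff[where B = K]) (auto intro!: arg_cong2[where f = "(+)"] sum.cong)
    also have "(\<Sum>i\<in>K. (norm ((M *v w) $ i))\<^sup>2) \<le> (norm (M *v w))\<^sup>2"
      unfolding norm_vec_power2 by (rule sum_mono2) auto
    also have "(norm (M *v w))\<^sup>2 \<le> (norm w)\<^sup>2"
      using assms by (simp add: norm_bounded_def power_mono)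
    also have "(norm w)\<^sup>2 = (\<Sum>i\<in>K. (norm (v $ i))\<^sup>2)"
      unfolding norm_vec_power2 w_def
      by (rule sum.mono_neutral_cong_right) auto
    also have "\<dots> + (\<Sum>i\<in>-K. (norm (v $ i))\<^sup>2) = (norm v)\<^sup>2"
      unfolding norm_vec_power2
      by (subst sum.Int_Diff[of UNIV _ K]) (auto intro!: arg_cong2[where f = "(+)"] sum.cong)
    finally have "(norm (corner K M *v v))\<^sup>2 \<le> (norm v)\<^sup>2" by simp
    then show "norm (corner K M *v v) \<le> 1 * norm v"
      by (simp add: power2_le_iff_abs_le)
  qed
qed

subsection \<open>Triangularisation by Householder reflections\<close>

text \<open>\<open>T\<close> subtracts from a vector its component along
  \<open>w = v + |v| u e_q\<close>, where \<open>u\<close> is the phase of \<open>v $ q\<close>, or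
  1 if that entry is 0. Matching the phase gives <w, v> = m > 0 and <w, w> = 2 m; the first yields
  \<open>T v = v - w\<close>, supported at \<open>q\<close>, the second unitarity. As
  \<open>w\<close> vanishes on \<open>K\<close>, those coordinates are left alone.\<close>

lemma householder_reflection:
  fixes v :: "complex^'s"
  assumes v: "\<And>i. i \<in> K \<Longrightarrow> v $ i = 0" and q: "q \<notin> K"
  shows "\<exists>T. unitary T \<and> (\<forall>i j. i \<in> K \<or> j \<in> K \<longrightarrow> T $ i $ j = (if i = j then 1 else 0)) \<and>
    (\<forall>i. i \<noteq> q \<longrightarrow> (T *v v) $ i = 0)"
proof (cases "v = 0")
  case True
  then show ?thesis
    by (intro exI[of _ "mat 1"]) (simp add: mat_def[of "1 :: complex"] unitary_1[unfolded mat_def])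
next
  case False
  define u where "u = (if v $ q = 0 then 1 else sgn (v $ q))"
  have "norm u = 1"
    by (simp add: u_def norm_sgn)
  then have u: "cnj u * u = 1"
    by (metis complex_norm_square mult.commute of_real_1 one_power2)
  have uv: "cnj u * v $ q = of_real (norm (v $ q))"
  proof (cases "v $ q = 0")
    case False
    then have "v $ q = of_real (norm (v $ q)) * u"
      by (simp add: u_def sgn_eq)
    then show ?thesis
      by (metis u mult.left_commute mult.right_neutral)
  qed simp
  define w where "w = (\<chi> i. v $ i + (if i = q then of_real (norm v) * u else 0))"
  define m where "m = (norm v)\<^sup>2 + norm v * norm (v $ q)"
  have m0: "m > 0" using False by (simp add: m_def add_pos_nonneg)
  have uv': "u * cnj (v $ q) = of_real (norm (v $ q))"
    using arg_cong[OF uv, of cnj] by simp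
  have wv: "(\<Sum>i\<in>UNIV. cnj (w $ i) * v $ i) = of_real m"
  proof -
    have "(\<Sum>i\<in>UNIV. cnj (w $ i) * v $ i) = (\<Sum>i\<in>UNIV. cnj (v $ i) * v $ i) +
       (\<Sum>i\<in>UNIV. if i = q then of_real (norm v) * (cnj u * v $ i) else 0)"
      unfolding sum.distrib[symmetric] by (intro sum.cong) (auto simp: w_def algebra_simps)
    then show ?thesis
      by (simp add: norm_vec_power2_complex[symmetric] uv m_def)
  qed
  have ww: "(\<Sum>i\<in>UNIV. cnj (w $ i) * w $ i) = 2 * of_real m"
  proof -
    have "(\<Sum>i\<in>UNIV. cnj (w $ i) * w $ i) = (\<Sum>i\<in>UNIV. cnj (w $ i) * v $ i) +
       (\<Sum>i\<in>UNIV. if i = q then cnj (w $ i) * (of_real (norm v) * u) else 0)"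
      unfolding sum.distrib[symmetric] by (intro sum.cong) (auto simp: w_def algebra_simps)
    also have "(\<Sum>i\<in>UNIV. if i = q then cnj (w $ i) * (of_real (norm v) * u) else 0)
        = of_real (norm v) * (u * cnj (v $ q)) + of_real ((norm v)\<^sup>2) * (cnj u * u)"
      by (simp add: w_def algebra_simps power2_eq_square)
    also have "\<dots> = of_real m"
      by (simp add: u uv' m_def)
    finally show ?thesis by (simp add: wv)
  qed
  define T :: "complex^'s^'s" where
    "T = (\<chi> i j. (if i = j then 1 else 0) - w $ i * cnj (w $ j) / of_real m)"
  have w0: "w $ i = 0" if "i \<in> K" for i
    using that v q by (auto simp: w_def)
  have "(adj T ** T) $ i $ j = mat 1 $ i $ j" for i j
  proof -
    have "(adj T ** T) $ i $ j
      = (\<Sum>l\<in>UNIV. (if l = i then (if l = j then 1 else 0) else 0)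
          - (if l = i then w $ i * cnj (w $ j) / of_real m else 0)
          - (if l = j then w $ i * cnj (w $ j) / of_real m else 0)
          + w $ i * cnj (w $ j) / (of_real m)\<^sup>2 * (cnj (w $ l) * w $ l))"
      unfolding matrix_matrix_mult_def
      by (auto simp: T_def algebra_simps power2_eq_square intro!: sum.cong)
    also have "\<dots> = (if i = j then 1 else 0) - w $ i * cnj (w $ j) / of_real m
       - w $ i * cnj (w $ j) / of_real m + w $ i * cnj (w $ j) / (of_real m)\<^sup>2 * (\<Sum>l\<in>UNIV. cnj (w $ l) * w $ l)"
      by (simp add: sum.distrib sum_subtractf sum_distrib_left)
    also have "\<dots> = (if i = j then 1 else 0)"
      unfolding ww using m0 by (simp add: field_simps power2_eq_square)
    finally show ?thesis by (simp add: mat_def)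
  qed
  then have "unitary T"
    by (simp add: unitary_def vec_eq_iff)
  moreover have "T $ i $ j = (if i = j then 1 else 0)" if "i \<in> K \<or> j \<in> K" for i j
    using that w0 by (auto simp: T_def)
  moreover have "(T *v v) $ i = 0" if "i \<noteq> q" for i
  proof -
    have "(T *v v) $ i = (\<Sum>l\<in>UNIV. (if l = i then v $ l else 0) - w $ i / of_real m * (cnj (w $ l) * v $ l))"
      unfolding matrix_vector_mult_def by (auto simp: T_def algebra_simps intro!: sum.cong)
    also have "\<dots> = v $ i - w $ i / of_real m * (\<Sum>l\<in>UNIV. cnj (w $ l) * v $ l)"
      by (simp add: sum_subtractf sum_distrib_left)
    also have "\<dots> = 0"
      unfolding wv using m0 that by (simp add: w_def)
    finally show ?thesis .
  qed
  ultimately show ?thesis by blast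
qed

text \<open>Column \<open>q\<close> is reflected into the rows of \<open>insert q K\<close>, with
  pivot row \<open>q\<close>. The reflection mixes only rows outside \<open>K\<close>, which already
  vanish in the earlier columns, so the zeros obtained before survive.\<close>

lemma exists_unitary_block_triangular:
  fixes B :: "complex^'s^'s"
  shows "\<exists>S. unitary S \<and> (\<forall>i j. i \<notin> K \<longrightarrow> j \<in> K \<longrightarrow> (S ** B) $ i $ j = 0)"
proof (induction K rule: finite_induct[OF finite])
  case 1
  show ?case by (intro exI[of _ "mat 1"]) auto
next
  case (2 q K)
  then obtain S where S: "unitary S" "\<And>i j. i \<notin> K \<Longrightarrow> j \<in> K \<Longrightarrow> (S ** B) $ i $ j = 0" by blast
  define C where "C = S ** B"
  define v where "v = (\<chi> i. if i \<in> K then 0 else C $ i $ q)"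
  obtain T where T: "unitary T" "\<And>i j. i \<in> K \<or> j \<in> K \<Longrightarrow> T $ i $ j = (if i = j then 1 else 0)"
     "\<And>i. i \<noteq> q \<Longrightarrow> (T *v v) $ i = 0"
    using householder_reflection[of K v q] 2(2) by (auto simp: v_def)
  have "((T ** S) ** B) $ i $ j = 0" if i: "i \<notin> insert q K" and j: "j \<in> insert q K" for i j
  proof (cases "j \<in> K")
    case True
    have "T $ i $ l * C $ l $ j = 0" for l
      using T(2)[of i l] S(2)[of l j] True i by (cases "l \<in> K") (auto simp: C_def)
    then have "(T ** C) $ i $ j = 0"
      unfolding matrix_mult_nth by (intro sum.neutral ballI)
    then show ?thesis
      by (simp add: matrix_mul_assoc[symmetric] C_def[symmetric])
  next
    case False
    then have [simp]: "j = q" using j by auto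
    have "T $ i $ l * C $ l $ q = T $ i $ l * v $ l" for l
      using T(2)[of i l] i by (auto simp: v_def)
    then have "(T ** C) $ i $ q = (T *v v) $ i"
      unfolding matrix_mult_nth matrix_vector_mult_def vec_lambda_beta by (intro sum.cong refl)
    then show ?thesis
      using T(3)[of i] i by (simp add: matrix_mul_assoc[symmetric] C_def[symmetric])
  qed
  then show ?case
    using unitary_mult[OF T(1) S(1)] by blast
qed

subsection \<open>Products of the largest singular values as a supremum of minors\<close>

lemma continuous_on_matrixI:
  assumes "\<And>i j. continuous_on S (\<lambda>x. f x $ i $ j)"
  shows "continuous_on S f"
proof -
  have "continuous_on S (\<lambda>x. \<chi> i. \<chi> j. f x $ i $ j)"
    by (intro continuous_on_vec_lambda assms)
  then show ?thesis by simp
qed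

lemma continuous_on_matrix_mult:
  fixes f g :: "'b::topological_space \<Rightarrow> complex^'s^'s"
  assumes "continuous_on S f" "continuous_on S g"
  shows "continuous_on S (\<lambda>x. f x ** g x)"
  by (intro continuous_on_matrixI) (unfold matrix_mult_nth, intro continuous_intros assms)

lemma continuous_on_adjoint:
  fixes f :: "'b::topological_space \<Rightarrow> complex^'s^'s"
  assumes "continuous_on S f"
  shows "continuous_on S (\<lambda>x. adj (f x))"
  by (intro continuous_on_matrixI) (unfold adj_nth, intro continuous_intros assms)

lemma continuous_on_minor:
  fixes f :: "'b::topological_space \<Rightarrow> complex^'s^'s"
  assumes "continuous_on S f"
  shows "continuous_on S (\<lambda>x. minor K (f x))"
proof -
  have "continuous_on S (\<lambda>x. corner K (f x) $ i $ j)" for i j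
    unfolding corner_nth by (cases "i \<in> K \<and> j \<in> K") (auto intro!: continuous_intros assms)
  then show ?thesis
    unfolding minor_def det_def by (intro continuous_on_sum continuous_on_mult continuous_on_prod continuous_on_const)
qed

lemma norm_matrix_le_sum: "norm (M :: complex^'s^'s) \<le> (\<Sum>i\<in>UNIV. \<Sum>j\<in>UNIV. norm (M $ i $ j))"
proof -
  have "norm M \<le> (\<Sum>i\<in>UNIV. norm (M $ i))"
    unfolding norm_vec_def[of M] by (rule L2_set_le_sum) simp
  also have "\<dots> \<le> (\<Sum>i\<in>UNIV. \<Sum>j\<in>UNIV. norm (M $ i $ j))"
    unfolding norm_vec_def[of "M $ _"] by (intro sum_mono L2_set_le_sum) simp
  finally show ?thesis .
qed

lemma compact_unitary: "compact {P :: complex^'s^'s. unitary P}"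
  unfolding compact_eq_bounded_closed
proof
  have "norm P \<le> (\<Sum>i\<in>(UNIV :: 's set). \<Sum>j\<in>(UNIV :: 's set). 1)" if "unitary P" for P :: "complex^'s^'s"
    by (rule order.trans[OF norm_matrix_le_sum])
       (intro sum_mono norm_bounded_entry norm_bounded_unitary that)
  then show "bounded {P :: complex^'s^'s. unitary P}"
    unfolding bounded_iff by blast
  have "continuous_on UNIV (\<lambda>P :: complex^'s^'s. adj P ** P)"
    by (intro continuous_on_matrix_mult continuous_on_adjoint continuous_on_id)
  then show "closed {P :: complex^'s^'s. unitary P}"
    unfolding unitary_def by (intro closed_Collect_eq continuous_intros)
qed

text \<open>The operator norm of the exterior power of degree \<open>card K\<close>, that is, the
  product of the \<open>card K\<close> largest singular values. Written with minors it is a supremum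
  of moduli of polynomials in the entries of \<open>M\<close>.\<close>

definition ext_norm :: "'s set \<Rightarrow> complex^'s^'s \<Rightarrow> real" where
  "ext_norm K M = (SUP PQ \<in> {P. unitary P} \<times> {Q. unitary Q}. norm (minor K (fst PQ ** M ** snd PQ)))"

text \<open>Compactness of the unitary group turns the supremum into a maximum. Attainment is what
  later provides a holomorphic function touching it from below at a given point.\<close>

lemma ext_norm_maximum:
  "\<exists>P Q. unitary P \<and> unitary Q \<and> ext_norm K M = norm (minor K (P ** M ** Q)) \<and>
    (\<forall>P' Q'. unitary P' \<longrightarrow> unitary Q' \<longrightarrow> norm (minor K (P' ** M ** Q')) \<le> ext_norm K M)"
proof -
  let ?S = "{P :: complex^'s^'s. unitary P} \<times> {Q. unitary Q}"
  let ?f = "\<lambda>PQ. norm (minor K (fst PQ ** M ** snd PQ))"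
  have "compact ?S" by (intro compact_Times compact_unitary)
  moreover have "(mat 1, mat 1) \<in> ?S" by simp
  moreover have "continuous_on ?S ?f"
    by (intro continuous_intros continuous_on_minor continuous_on_matrix_mult)
  ultimately obtain z where z: "z \<in> ?S" "\<forall>y\<in>?S. ?f y \<le> ?f z"
    using continuous_attains_sup[of ?S ?f] by blast
  have "ext_norm K M = ?f z"
    unfolding ext_norm_def by (rule cSup_eq_maximum) (use z in auto)
  with z show ?thesis
    by (intro exI[of _ "fst z"] exI[of _ "snd z"]) auto
qed

lemma ext_norm_attained:
  obtains P Q where "unitary P" "unitary Q" "ext_norm K M = norm (minor K (P ** M ** Q))"
  using ext_norm_maximum[of K M] by blast

lemma ext_norm_upper:
  assumes "unitary P" "unitary Q"
  shows "norm (minor K (P ** M ** Q)) \<le> ext_norm K M"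
  using ext_norm_maximum[of K M] assms by blast

lemma ext_norm_least:
  assumes "\<And>P Q. unitary P \<Longrightarrow> unitary Q \<Longrightarrow> norm (minor K (P ** M ** Q)) \<le> c"
  shows "ext_norm K M \<le> c"
  using ext_norm_attained[of K M] assms by metis

lemma ext_norm_nonneg: "0 \<le> ext_norm K M"
  using ext_norm_attained[of K M] by (metis norm_ge_zero)

text \<open>A unitary \<open>S\<close> with \<open>S ** N ** Q\<close> block triangular is inserted,
  followed by its inverse, between the two factors. The minor of the product then splits into a
  minor of each factor.\<close>

lemma ext_norm_mult: "ext_norm K (M ** N) \<le> ext_norm K M * ext_norm K N"
proof (rule ext_norm_least)
  fix P Q :: "complex^'a^'a" assume PQ: "unitary P" "unitary Q"
  obtain S where S: "unitary S" "\<And>i j. i \<notin> K \<Longrightarrow> j \<in> K \<Longrightarrow> (S ** (N ** Q)) $ i $ j = 0"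
    using exists_unitary_block_triangular[of K "N ** Q"] by blast
  have "P ** (M ** N) ** Q = (P ** M ** adj S) ** (S ** N ** Q)"
    by (simp add: matrix_mul_assoc[symmetric] unitary_cancel[OF S(1)])
  moreover have "minor K ((P ** M ** adj S) ** (S ** N ** Q))
      = minor K (P ** M ** adj S) * minor K (S ** N ** Q)"
    by (rule minor_mult_right) (use S(2) in \<open>simp add: matrix_mul_assoc\<close>)
  ultimately have "norm (minor K (P ** (M ** N) ** Q))
      = norm (minor K (P ** M ** adj S)) * norm (minor K (S ** N ** Q))"
    by (simp add: norm_mult)
  also have "\<dots> \<le> ext_norm K M * ext_norm K N"
    by (intro mult_mono ext_norm_upper ext_norm_nonneg) (use PQ S in auto)
  finally show "norm (minor K (P ** (M ** N) ** Q)) \<le> ext_norm K M * ext_norm K N" .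
qed

lemma ext_norm_unitary_left:
  assumes "unitary U"
  shows "ext_norm K (U ** M) = ext_norm K M"
proof -
  have le: "ext_norm K (V ** N) \<le> ext_norm K N" if "unitary V" for V N :: "complex^'a^'a"
    by (rule ext_norm_least)
       (use ext_norm_upper[of "_ ** V" _ K N] that unitary_mult in \<open>force simp: matrix_mul_assoc\<close>)
  show ?thesis
    using le[OF assms, of M] le[of "adj U" "U ** M"] assms by (simp add: unitary_cancel)
qed

lemma ext_norm_unitary_right:
  assumes "unitary U"
  shows "ext_norm K (M ** U) = ext_norm K M"
proof -
  have le: "ext_norm K (N ** V) \<le> ext_norm K N" if "unitary V" for V N :: "complex^'a^'a"
    by (rule ext_norm_least)
       (use ext_norm_upper[of _ "V ** _" K N] that unitary_mult in \<open>force simp: matrix_mul_assoc\<close>)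
  have "M ** U ** adj U = M"
    using unitary_right[OF assms] by (metis matrix_mul_assoc matrix_mul_rid)
  then show ?thesis
    using le[OF assms, of M] le[of "adj U" "M ** U"] assms by simp
qed

lemma ext_norm_contraction_le:
  assumes "norm_bounded 1 M"
  shows "ext_norm K M \<le> 1"
proof (rule ext_norm_least, rule norm_minor_contraction_le)
  fix P Q :: "complex^'a^'a" assume PQ: "unitary P" "unitary Q"
  show "norm_bounded 1 (P ** M ** Q)"
    using norm_bounded_mult[OF norm_bounded_mult[OF norm_bounded_unitary[OF PQ(1)] assms]
        norm_bounded_unitary[OF PQ(2)]] by simp
qed

lemma norm_minor_le_ext_norm: "norm (minor K M) \<le> ext_norm K M"
  using ext_norm_upper[of "mat 1" "mat 1" K M] by simp

lemma ext_norm_1: "ext_norm K (mat 1) = 1"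
  using ext_norm_contraction_le[of "mat 1" K] norm_minor_le_ext_norm[of K "mat 1"]
  by (simp add: norm_bounded_unitary)

lemma ext_norm_unitary: "unitary U \<Longrightarrow> ext_norm K U = 1"
  using ext_norm_unitary_left[of U K "mat 1"] by (simp add: ext_norm_1)

lemma ext_norm_empty [simp]: "ext_norm {} M = 1"
  by (metis ext_norm_attained minor_empty norm_one)

lemma ext_norm_pos:
  assumes "M ** N = mat 1"
  shows "0 < ext_norm K M"
proof -
  have "1 \<le> ext_norm K M * ext_norm K N"
    using ext_norm_mult[of K M N] by (simp add: assms ext_norm_1)
  then have "ext_norm K M \<noteq> 0" by auto
  then show ?thesis using ext_norm_nonneg[of K M] by simp
qed

text \<open>All singular values of \<open>M\<close> are at least 1, so leaving some of them out of
  |det M| only decreases it. In the proof the determinant of the triangularised matrix splits into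
  two complementary minors, and the one over \<open>- K\<close> has modulus at least 1, being the
  reciprocal of a minor of a contraction.\<close>

lemma ext_norm_le_det:
  assumes MN: "M ** N = mat 1" and N: "norm_bounded 1 N"
  shows "ext_norm K M \<le> norm (det M)"
proof (rule ext_norm_least)
  fix P Q :: "complex^'a^'a" assume PQ: "unitary P" "unitary Q"
  obtain S where S: "unitary S" "\<And>i j. i \<notin> K \<Longrightarrow> j \<in> K \<Longrightarrow> (S ** (P ** M ** Q)) $ i $ j = 0"
    using exists_unitary_block_triangular[of K "P ** M ** Q"] by blast
  define R where "R = S ** (P ** M ** Q)"
  define R' where "R' = adj Q ** N ** adj P ** adj S"
  have unit: "norm (det U) = 1" if "unitary U" for U :: "complex^'a^'a"
  proof -
    have "norm (det U) * norm (det (adj U)) = 1"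
      using unitary_right[OF that] by (metis det_I det_mul norm_mult norm_one)
    moreover have "norm (det U) \<le> 1" "norm (det (adj U)) \<le> 1"
      using that by (auto intro!: norm_det_contraction_le norm_bounded_unitary)
    ultimately show ?thesis
      by (metis antisym mult_left_le norm_ge_zero)
  qed
  have "M ** (Q ** (adj Q ** X)) = M ** X" for X
    by (simp add: unitary_cancel PQ)
  then have "R ** R' = mat 1"
    unfolding R_def R'_def
    by (metis (no_types, lifting) MN PQ(1) S(1) matrix_mul_assoc matrix_mul_lid unitary_cancel(2) unitary_right)
  then have "minor (- K) R * minor (- K) R' = 1"
    using minor_mult_left[of "-K" R R'] S(2) by (auto simp: R_def)
  moreover have "norm (minor (- K) R') \<le> 1"
  proof (rule norm_minor_contraction_le)
    have u: "norm_bounded 1 (adj U)" if "unitary U" for U :: "complex^'a^'a"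
      using that by (simp add: norm_bounded_unitary)
    show "norm_bounded 1 R'"
      using norm_bounded_mult[OF norm_bounded_mult[OF norm_bounded_mult[OF u[OF PQ(2)] N] u[OF PQ(1)]] u[OF S(1)]]
      unfolding R'_def by simp
  qed
  ultimately have ge: "1 \<le> norm (minor (- K) R)"
    by (metis mult_left_le norm_ge_zero norm_mult norm_one)
  have "P ** M ** Q = adj S ** R"
    by (simp add: R_def unitary_cancel[OF S(1)])
  then have "norm (minor K (P ** M ** Q)) = norm (minor K (adj S)) * norm (minor K R)"
    using minor_mult_right[of K R "adj S"] S(2) by (simp add: R_def norm_mult)
  also have "\<dots> \<le> norm (minor K R)"
    using norm_minor_contraction_le[of "adj S" K] S(1)
    by (intro mult_left_le_one_le) (auto simp: norm_bounded_unitary)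
  also have "\<dots> \<le> norm (minor K R) * norm (minor (-K) R)"
    using ge by (simp add: mult_le_cancel_left1)
  also have "\<dots> = norm (det R)"
    using det_block_triangular[of K R] S(2) by (simp add: R_def norm_mult)
  also have "\<dots> = norm (det M)"
    using unit S(1) PQ by (simp add: R_def det_mul norm_mult)
  finally show "norm (minor K (P ** M ** Q)) \<le> norm (det M)" .
qed

subsection \<open>Diagonal matrices\<close>

text \<open>Indexed by the coordinates themselves, unlike \<open>diag_matrix\<close>, so that the
  numbering enters only when entries have to be ordered.\<close>

definition diag :: "('s \<Rightarrow> complex) \<Rightarrow> complex^'s^'s" where
  "diag c = (\<chi> i j. if i = j then c i else 0)"

abbreviation real_diag :: "('s \<Rightarrow> real) \<Rightarrow> complex^'s^'s" where
  "real_diag l \<equiv> diag (\<lambda>i. of_real (l i))"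

lemma diag_nth: "diag c $ i $ j = (if i = j then c i else 0)"
  by (simp add: diag_def)

lemma diag_mult_nth: "(diag c ** M) $ i $ j = c i * M $ i $ j"
proof -
  have "(diag c ** M) $ i $ j = (\<Sum>l\<in>UNIV. (if i = l then 1 else 0) * (c i * M $ l $ j))"
    unfolding matrix_mult_nth by (intro sum.cong) (auto simp: diag_nth)
  then show ?thesis by simp
qed

lemma mult_diag_nth: "(M ** diag c) $ i $ j = M $ i $ j * c j"
proof -
  have "(M ** diag c) $ i $ j = (\<Sum>l\<in>UNIV. (if j = l then 1 else 0) * (M $ i $ l * c j))"
    unfolding matrix_mult_nth by (intro sum.cong) (auto simp: diag_nth)
  then show ?thesis by simp
qed

lemma diag_mult: "diag c ** diag d = diag (\<lambda>i. c i * d i)"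
  by (auto simp: vec_eq_iff diag_mult_nth diag_nth)

lemma diag_1: "diag (\<lambda>_. 1) = mat 1"
  by (simp add: diag_def mat_def)

lemma diag_adjoint: "adj (diag c) = diag (\<lambda>i. cnj (c i))"
  by (auto simp: vec_eq_iff diag_nth)

lemma det_diag: "det (diag c) = (\<Prod>i\<in>UNIV. c i)"
  by (subst det_diagonal) (auto simp: diag_nth)

lemma minor_diag: "minor K (diag c) = (\<Prod>i\<in>K. c i)"
proof -
  have "minor K (diag c) = (\<Prod>i\<in>UNIV. corner K (diag c) $ i $ i)"
    unfolding minor_def by (rule det_diagonal) (auto simp: corner_nth diag_nth)
  also have "\<dots> = (\<Prod>i\<in>K. c i)"
    by (rule prod.mono_neutral_cong_right) (auto simp: corner_nth diag_nth)
  finally show ?thesis .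
qed

lemma norm_bounded_diag:
  assumes "\<And>i. norm (c i) \<le> d"
  shows "norm_bounded d (diag c)"
  unfolding norm_bounded_def
proof
  fix v :: "complex^'a"
  have d: "0 \<le> d" using assms norm_ge_zero order.trans by blast
  have "norm (diag c *v v) \<le> L2_set (\<lambda>i. d * norm (v $ i)) UNIV"
    unfolding norm_vec_def[of "diag c *v v"]
  proof (rule L2_set_mono)
    fix i
    have "(diag c *v v) $ i = (\<Sum>l\<in>UNIV. (if i = l then 1 else 0) * (c i * v $ l))"
      unfolding matrix_vector_mult_def vec_lambda_beta by (intro sum.cong) (auto simp: diag_nth)
    then show "norm ((diag c *v v) $ i) \<le> d * norm (v $ i)"
      using assms by (simp add: norm_mult mult_right_mono)
  qed simp
  also have "\<dots> = d * norm v"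
    using d by (simp add: L2_set_right_distrib norm_vec_def[of v])
  finally show "norm (diag c *v v) \<le> d * norm v" .
qed

lemma scaleR_matrix_mult: "(c *\<^sub>R A) ** B = c *\<^sub>R (A ** B :: complex^'s^'s)"
  "A ** (c *\<^sub>R B) = c *\<^sub>R (A ** B :: complex^'s^'s)"
  by (simp_all add: vec_eq_iff matrix_mult_nth scaleR_sum_right)

lemma minor_scaleR: "minor K (c *\<^sub>R M) = of_real c ^ card K * minor K M"
proof -
  have "c *\<^sub>R M = diag (\<lambda>_. of_real c) ** M"
    by (simp add: vec_eq_iff diag_mult_nth) (simp add: scaleR_conv_of_real)
  then show ?thesis
    by (simp only:) (subst minor_mult_left, auto simp: diag_nth minor_diag)
qed

lemma ext_norm_scaleR:
  assumes "0 \<le> c"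
  shows "ext_norm K (c *\<^sub>R M) = c ^ card K * ext_norm K M"
proof (rule antisym)
  show "ext_norm K (c *\<^sub>R M) \<le> c ^ card K * ext_norm K M"
    by (rule ext_norm_least)
      (use assms in \<open>auto simp: scaleR_matrix_mult minor_scaleR norm_mult norm_power intro!: mult_left_mono ext_norm_upper\<close>)
  obtain P Q where PQ: "unitary P" "unitary Q" "ext_norm K M = norm (minor K (P ** M ** Q))"
    using ext_norm_attained .
  have "c ^ card K * ext_norm K M = norm (minor K (P ** (c *\<^sub>R M) ** Q))"
    using assms by (simp add: PQ(3) scaleR_matrix_mult minor_scaleR norm_mult norm_power)
  also have "\<dots> \<le> ext_norm K (c *\<^sub>R M)"
    by (intro ext_norm_upper PQ)
  finally show "c ^ card K * ext_norm K M \<le> ext_norm K (c *\<^sub>R M)" .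
qed

lemma ext_norm_le_power:
  assumes "norm_bounded c M" "0 < c"
  shows "ext_norm K M \<le> c ^ card K"
proof -
  have "norm_bounded 1 ((1 / c) *\<^sub>R M)"
    unfolding norm_bounded_def
  proof
    fix v
    have "((1 / c) *\<^sub>R M) *v v = (1 / c) *\<^sub>R (M *v v)"
      by (simp add: vec_eq_iff matrix_vector_mult_def scaleR_sum_right)
    then show "norm (((1 / c) *\<^sub>R M) *v v) \<le> 1 * norm v"
      using assms by (simp add: norm_bounded_def field_simps)
  qed
  then have "ext_norm K (c *\<^sub>R ((1 / c) *\<^sub>R M)) \<le> c ^ card K * 1"
    unfolding ext_norm_scaleR[OF less_imp_le[OF assms(2)]]
    using assms by (intro mult_left_mono ext_norm_contraction_le) auto
  then show ?thesis using assms by simp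
qed

text \<open>The value \<tau> separates the entries on \<open>K\<close> from the others. Dividing the
  former by \<tau> leaves a factor with entries at least 1, controlled by its determinant; the
  remaining factor has norm at most \<tau> and contributes at most the power of \<tau> that was
  divided out.\<close>

lemma ext_norm_diag:
  assumes pos: "\<And>i. 0 < \<sigma> i" and \<tau>: "0 < \<tau>" "\<And>i. i \<in> K \<Longrightarrow> \<tau> \<le> \<sigma> i" "\<And>i. i \<notin> K \<Longrightarrow> \<sigma> i \<le> \<tau>"
  shows "ext_norm K (real_diag \<sigma>) = (\<Prod>i\<in>K. \<sigma> i)"
proof (rule antisym)
  define a where "a i = (if i \<in> K then \<sigma> i / \<tau> else 1)" for i
  define b where "b i = (if i \<in> K then \<tau> else \<sigma> i)" for i
  have ab: "real_diag \<sigma> = diag (\<lambda>i. of_real (a i)) ** diag (\<lambda>i. of_real (b i))"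
    unfolding diag_mult using \<tau> by (intro arg_cong[of _ _ diag]) (auto simp: a_def b_def)
  have a1: "1 \<le> a i" for i using \<tau> by (auto simp: a_def)
  have "ext_norm K (real_diag a) \<le> norm (det (real_diag a))"
  proof (rule ext_norm_le_det)
    have "a i \<noteq> 0" for i using a1[of i] by auto
    then show "real_diag a ** diag (\<lambda>i. of_real (1 / a i)) = mat 1"
      by (simp add: diag_mult diag_1)
    show "norm_bounded 1 (diag (\<lambda>i. of_real (1 / a i)))"
    proof (rule norm_bounded_diag)
      fix i show "norm (complex_of_real (1 / a i)) \<le> 1"
        unfolding norm_of_real using a1[of i] by simp
    qed
  qed
  also have "\<dots> = (\<Prod>i\<in>UNIV. a i)"
    unfolding det_diag prod_norm[symmetric] norm_of_real using a1
    by (intro prod.cong refl abs_of_nonneg) (meson order.trans zero_le_one)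
  also have "\<dots> = (\<Prod>i\<in>K. \<sigma> i / \<tau>)"
    by (rule prod.mono_neutral_cong_right) (auto simp: a_def)
  finally have A: "ext_norm K (real_diag a) \<le> (\<Prod>i\<in>K. \<sigma> i / \<tau>)" .
  have B: "ext_norm K (real_diag b) \<le> \<tau> ^ card K"
  proof (rule ext_norm_le_power[OF norm_bounded_diag])
    fix i show "norm (complex_of_real (b i)) \<le> \<tau>"
      unfolding norm_of_real using \<tau> pos[of i] by (auto simp: b_def)
  qed (rule \<tau>)
  have "ext_norm K (real_diag \<sigma>) \<le> (\<Prod>i\<in>K. \<sigma> i / \<tau>) * \<tau> ^ card K"
    unfolding ab
    by (rule order.trans[OF ext_norm_mult])
       (intro mult_mono A B ext_norm_nonneg prod_nonneg ballI divide_nonneg_nonneg less_imp_le pos \<tau>(1))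
  also have "\<dots> = (\<Prod>i\<in>K. \<sigma> i)"
    using \<tau>(1) by (simp add: prod_dividef)
  finally show "ext_norm K (real_diag \<sigma>) \<le> (\<Prod>i\<in>K. \<sigma> i)" .
  have "(\<Prod>i\<in>K. \<sigma> i) = norm (minor K (real_diag \<sigma>))"
    unfolding minor_diag prod_norm[symmetric] norm_of_real using pos
    by (intro prod.cong refl) (simp add: less_imp_le)
  also have "\<dots> \<le> ext_norm K (real_diag \<sigma>)"
    by (rule norm_minor_le_ext_norm)
  finally show "(\<Prod>i\<in>K. \<sigma> i) \<le> ext_norm K (real_diag \<sigma>)" .
qed

subsection \<open>Diagonalisation of Hermitian matrices\<close>

text \<open>
  A unitary \<open>W\<close> maximising \<open>\<Sum>\<^sub>i c\<^sub>i (W\<^sup>* H W)\<^sub>i\<^sub>i\<close> for distinct weights \<open>c\<^sub>i\<close> diagonalises \<open>H\<close>: otherwise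
  a Givens rotation in a coordinate plane increases the sum.
\<close>

lemma hermitian_diagonalisable:
  fixes H :: "complex^'s^'s" and c :: "'s \<Rightarrow> real"
  assumes herm: "adj H = H" and c: "inj c"
  obtains W l where "unitary W" "adj W ** H ** W = real_diag l"
    "\<And>p q. c q < c p \<Longrightarrow> l q \<le> l p"
proof -
  define \<phi> where "\<phi> W = (\<Sum>i\<in>UNIV. c i * Re ((adj W ** H ** W) $ i $ i))" for W
  have "continuous_on {P. unitary P} \<phi>"
    unfolding \<phi>_def by (intro continuous_intros continuous_on_matrix_mult continuous_on_adjoint)
  then obtain W where W: "unitary W" "\<And>V. unitary V \<Longrightarrow> \<phi> V \<le> \<phi> W"
    using continuous_attains_sup[OF compact_unitary, of \<phi>] unitary_1 by blast
  define G where "G = adj W ** H ** W"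
  have G: "cnj (G $ i $ j) = G $ j $ i" for i j
  proof -
    have "adj G = G"
      by (simp add: G_def adj_mult herm matrix_mul_assoc)
    then show ?thesis by (metis adj_nth)
  qed
  \<comment> \<open>Givens rotation in the plane of p and q with cosine C, sine S and phase u. It
    raises the p-th diagonal entry by the second factor, lowers the q-th by the same amount and
    keeps the others, so maximality of \<open>W\<close> gives the inequality.\<close>
  have key: "(c p - c q) * (S\<^sup>2 * (Re (G $ q $ q) - Re (G $ p $ p)) + 2 * C * S * Re (u * G $ p $ q)) \<le> 0"
    if pq: "p \<noteq> q" and CS: "C\<^sup>2 + S\<^sup>2 = 1" and u: "norm u = 1" for p q and C S :: real and u
  proof -
    have uu: "cnj u * u = 1" "u * cnj u = 1"
      using u by (metis complex_norm_square mult.commute of_real_1 one_power2)+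
    have CS': "complex_of_real C * of_real C + of_real S * of_real S = 1"
      using CS by (metis of_real_1 of_real_add of_real_mult power2_eq_square)
    define R where "R = (\<chi> a b. if b = p then (if a = p then 1 else 0) * of_real C + (if a = q then 1 else 0) * (of_real S * u)
       else if b = q then (if a = q then 1 else 0) * of_real C - (if a = p then 1 else 0) * (of_real S * cnj u)
       else if a = b then 1 else (0::complex))"
    have colp: "(\<Sum>a\<in>UNIV. X a * R $ a $ p) = X p * of_real C + X q * (of_real S * u)" for X
    proof -
      have "(\<Sum>a\<in>UNIV. X a * R $ a $ p)
        = (\<Sum>a\<in>UNIV. (if a = p then 1 else 0) * (X a * of_real C) + (if a = q then 1 else 0) * (X a * (of_real S * u)))"
        using pq by (intro sum.cong refl) (auto simp: R_def)
      then show ?thesis by (simp only: sum.distrib sum_delta_mult)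
    qed
    have colq: "(\<Sum>a\<in>UNIV. X a * R $ a $ q) = X q * of_real C - X p * (of_real S * cnj u)" for X
    proof -
      have "(\<Sum>a\<in>UNIV. X a * R $ a $ q)
        = (\<Sum>a\<in>UNIV. (if a = q then 1 else 0) * (X a * of_real C) - (if a = p then 1 else 0) * (X a * (of_real S * cnj u)))"
        using pq by (intro sum.cong refl) (auto simp: R_def)
      then show ?thesis by (simp only: sum_subtractf sum_delta_mult)
    qed
    have colo: "(\<Sum>a\<in>UNIV. X a * R $ a $ b) = X b" if "b \<noteq> p" "b \<noteq> q" for X b
      using that by (simp add: R_def)
    have cnjsum: "(\<Sum>a\<in>UNIV. cnj (R $ a $ b) * X a) = cnj (\<Sum>a\<in>UNIV. cnj (X a) * R $ a $ b)" for X b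
      by (simp add: mult.commute)
    have rowp: "(\<Sum>a\<in>UNIV. cnj (R $ a $ p) * X a) = X p * of_real C + X q * (of_real S * cnj u)" for X
      unfolding cnjsum colp by simp
    have rowq: "(\<Sum>a\<in>UNIV. cnj (R $ a $ q) * X a) = X q * of_real C - X p * (of_real S * u)" for X
      unfolding cnjsum colq by simp
    have rowo: "(\<Sum>a\<in>UNIV. cnj (R $ a $ b) * X a) = X b" if "b \<noteq> p" "b \<noteq> q" for X b
      unfolding cnjsum colo[OF that] by simp
    have Rent: "R $ p $ p = of_real C" "R $ q $ p = of_real S * u" "R $ p $ q = - of_real S * cnj u" "R $ q $ q = of_real C"
      using pq by (auto simp: R_def)
    have "(adj R ** R) $ i $ j = mat 1 $ i $ j" for i j
    proof -
      have pp: "of_real C * of_real C + of_real S * u * (of_real S * cnj u) = 1"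
      proof -
        have "of_real S * u * (of_real S * cnj u) = of_real S * of_real S * (u * cnj u)"
          by (simp only: mult_ac)
        then show ?thesis by (simp only: uu(2) mult_1_right CS')
      qed
      consider "i = p" | "i = q" | "i \<noteq> p" "i \<noteq> q" by blast
      then show ?thesis
      proof cases
        case 1
        have "(adj R ** R) $ i $ j = R $ p $ j * of_real C + R $ q $ j * (of_real S * cnj u)"
          unfolding matrix_mult_nth adj_nth 1 by (rule rowp)
        then show ?thesis
          using 1 pq pp Rent by (cases "j = p"; cases "j = q") (auto simp: mat_def R_def)
      next
        case 2
        have "(adj R ** R) $ i $ j = R $ q $ j * of_real C - R $ p $ j * (of_real S * u)"
          unfolding matrix_mult_nth adj_nth 2 by (rule rowq)
        then show ?thesis
          using 2 pq pp Rent by (cases "j = p"; cases "j = q") (auto simp: mat_def R_def mult_ac)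
      next
        case 3
        have "(adj R ** R) $ i $ j = R $ i $ j"
          unfolding matrix_mult_nth adj_nth by (rule rowo[OF 3])
        then show ?thesis
          using 3 by (auto simp: mat_def R_def)
      qed
    qed
    then have R: "unitary R"
      by (simp add: unitary_def vec_eq_iff)
    define G' where "G' = adj R ** (G ** R)"
    define \<Delta> where "\<Delta> = S\<^sup>2 * (Re (G $ q $ q) - Re (G $ p $ p)) + 2 * C * S * Re (u * G $ p $ q)"
    have C2: "C * C = 1 - S * S" using CS by (simp add: power2_eq_square)
    have Gqp: "G $ q $ p = cnj (G $ p $ q)" using G by simp
    have Gp: "Re (G' $ p $ p) = Re (G $ p $ p) + \<Delta>"
    proof -
      have "G' $ p $ p = (G ** R) $ p $ p * of_real C + (G ** R) $ q $ p * (of_real S * cnj u)"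
        unfolding G'_def matrix_mult_nth[of "adj R"] adj_nth by (rule rowp)
      also have "\<dots> = (G $ p $ p * of_real C + G $ p $ q * (of_real S * u)) * of_real C
          + (G $ q $ p * of_real C + G $ q $ q * (of_real S * u)) * (of_real S * cnj u)"
        unfolding matrix_mult_nth colp ..
      also have "\<dots> = (of_real C * of_real C) * G $ p $ p + of_real C * of_real S * (u * G $ p $ q)
         + of_real C * of_real S * cnj (u * G $ p $ q) + (of_real S * of_real S) * (u * cnj u) * G $ q $ q"
        by (simp add: Gqp algebra_simps)
      also have "Re \<dots> = C * C * Re (G $ p $ p) + 2 * C * S * Re (u * G $ p $ q) + S * S * Re (G $ q $ q)"
        unfolding uu(2) by (simp flip: of_real_mult)
      finally show ?thesis
        unfolding C2 \<Delta>_def by (simp add: algebra_simps power2_eq_square)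
    qed
    have Gq: "Re (G' $ q $ q) = Re (G $ q $ q) - \<Delta>"
    proof -
      have "G' $ q $ q = (G ** R) $ q $ q * of_real C - (G ** R) $ p $ q * (of_real S * u)"
        unfolding G'_def matrix_mult_nth[of "adj R"] adj_nth by (rule rowq)
      also have "\<dots> = (G $ q $ q * of_real C - G $ q $ p * (of_real S * cnj u)) * of_real C
          - (G $ p $ q * of_real C - G $ p $ p * (of_real S * cnj u)) * (of_real S * u)"
        unfolding matrix_mult_nth colq ..
      also have "\<dots> = (of_real C * of_real C) * G $ q $ q - of_real C * of_real S * (u * G $ p $ q)
         - of_real C * of_real S * cnj (u * G $ p $ q) + (of_real S * of_real S) * (u * cnj u) * G $ p $ p"
        by (simp add: Gqp algebra_simps)
      also have "Re \<dots> = C * C * Re (G $ q $ q) - 2 * C * S * Re (u * G $ p $ q) + S * S * Re (G $ p $ p)"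
        unfolding uu(2) by (simp flip: of_real_mult)
      finally show ?thesis
        unfolding C2 \<Delta>_def by (simp add: algebra_simps power2_eq_square)
    qed
    have Go: "G' $ b $ b = G $ b $ b" if b: "b \<noteq> p" "b \<noteq> q" for b
    proof -
      have "G' $ b $ b = (G ** R) $ b $ b"
        unfolding G'_def matrix_mult_nth[of "adj R"] adj_nth by (rule rowo[OF b])
      also have "\<dots> = G $ b $ b"
        unfolding matrix_mult_nth by (rule colo[OF b])
      finally show ?thesis .
    qed
    have "\<phi> (W ** R) = (\<Sum>i\<in>UNIV. c i * Re (G' $ i $ i))"
      unfolding \<phi>_def G'_def G_def adj_mult by (simp add: matrix_mul_assoc)
    also have "\<dots> = (\<Sum>i\<in>UNIV. c i * Re (G $ i $ i) + (if i = p then 1 else 0) * (c p * \<Delta>) - (if i = q then 1 else 0) * (c q * \<Delta>))"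
      using pq by (intro sum.cong refl) (auto simp: Gp Gq Go algebra_simps)
    also have "\<dots> = \<phi> W + (c p - c q) * \<Delta>"
      by (simp only: sum.distrib sum_subtractf sum_delta_mult) (simp add: \<phi>_def G_def algebra_simps)
    finally have "(c p - c q) * \<Delta> \<le> 0"
      using W(2)[OF unitary_mult[OF W(1) R]] by simp
    then show ?thesis by (simp add: \<Delta>_def)
  qed
  have off: "G $ p $ q = 0" if cpq: "c q < c p" for p q
  proof (rule ccontr)
    assume nz: "G $ p $ q \<noteq> 0"
    define m where "m = norm (G $ p $ q)"
    have m: "m > 0" using nz by (simp add: m_def)
    define u where "u = cnj (sgn (G $ p $ q))"
    have u: "norm u = 1" using nz by (simp add: u_def norm_sgn)
    have "u * G $ p $ q = of_real m"
    proof -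
      have "G $ p $ q = of_real m * cnj u"
        using nz by (simp add: u_def m_def sgn_eq)
      moreover have "u * cnj u = 1"
        using u by (metis complex_norm_square of_real_1 one_power2)
      ultimately show ?thesis by (metis mult.left_commute mult.right_neutral)
    qed
    then have ur: "Re (u * G $ p $ q) = m" by simp
    define d where "d = Re (G $ q $ q) - Re (G $ p $ p)"
    \<comment> \<open>With sine \<open>C * t\<close> the gain in \<open>key\<close> is
      \<open>C * C * t * (t * d + 2 * m)\<close>. This choice ensures
      \<open>t * \<bar>d\<bar> \<le> m\<close>, so the term linear in t outweighs the quadratic
      one.\<close>
    define t where "t = m / (\<bar>d\<bar> + 1)"
    have t: "t > 0" using m by (simp add: t_def)
    define C where "C = 1 / sqrt (1 + t\<^sup>2)"
    have C: "C > 0" by (simp add: C_def add_pos_nonneg)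
    have "C\<^sup>2 * (1 + t\<^sup>2) = 1"
      by (simp add: C_def power_divide add_nonneg_eq_0_iff)
    then have "C\<^sup>2 + (C * t)\<^sup>2 = 1" by (simp add: algebra_simps power_mult_distrib)
    from key[of p q C "C * t" u] this u cpq have "(C * t)\<^sup>2 * d + 2 * C * (C * t) * m \<le> 0"
      unfolding ur d_def[symmetric] by (cases "p = q") (simp_all add: mult_le_0_iff)
    then have "(C * C * t) * (t * d + 2 * m) \<le> 0"
      by (simp add: algebra_simps power2_eq_square)
    then have "t * d + 2 * m \<le> 0"
      using C t by (simp add: mult_le_0_iff)
    moreover have "t * \<bar>d\<bar> \<le> m"
      using m by (simp add: t_def field_simps)
    moreover have "- (t * \<bar>d\<bar>) \<le> t * d"
      using t by (simp add: abs_if)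
    ultimately show False using m by linarith
  qed
  \<comment> \<open>Cosine 0 and sine 1: up to a sign the rotation exchanges the two
    coordinates.\<close>
  have ord: "Re (G $ q $ q) \<le> Re (G $ p $ p)" if cpq: "c q < c p" for p q
    using key[of p q 0 1 1] cpq by (auto simp: mult_le_0_iff)
  have "G $ i $ j = diag (\<lambda>i. of_real (Re (G $ i $ i))) $ i $ j" for i j
  proof (cases "i = j")
    case True
    have "Im (G $ i $ i) = 0" using G[of i i] by (simp add: complex_eq_iff)
    then show ?thesis using True by (simp add: diag_nth complex_eq_iff)
  next
    case False
    then have "c i \<noteq> c j" using c by (auto dest: injD)
    then have "c i < c j \<or> c j < c i" by linarith
    then have "G $ i $ j = 0"
    proof
      assume "c i < c j"
      then have "cnj (G $ i $ j) = 0" unfolding G by (rule off)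
      then show ?thesis by simp
    qed (rule off)
    then show ?thesis using False by (simp add: diag_nth)
  qed
  then have "G = diag (\<lambda>i. of_real (Re (G $ i $ i)))"
    unfolding vec_eq_iff by blast
  then show ?thesis
    using that[OF W(1), of "\<lambda>i. Re (G $ i $ i)"] ord unfolding G_def by blast
qed

subsection \<open>Singular values\<close>

lemma coord_number_bij: "bij_betw (coord_number :: 's::finite \<Rightarrow> nat) UNIV {1..CARD('s)}"
proof -
  have "\<exists>e. bij_betw e (UNIV :: 's set) {1..CARD('s)}"
    by (rule finite_same_card_bij) auto
  then show ?thesis
    unfolding coord_number_def by (rule someI_ex)
qed

lemma coord_number_inj: "inj (coord_number :: 's::finite \<Rightarrow> nat)"
  using coord_number_bij bij_betw_imp_inj_on by blast

lemma coord_number_bounds: "1 \<le> coord_number (i :: 's::finite)" "coord_number i \<le> CARD('s)"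
  using coord_number_bij[where 's = 's] bij_betwE by fastforce+

definition leading :: "nat \<Rightarrow> 's::finite set" where
  "leading k = {i. coord_number i \<le> k}"

lemma leading_0 [simp]: "leading 0 = {}"
proof -
  have "coord_number i \<noteq> 0" for i :: 'a
    using coord_number_bounds(1)[of i] by simp
  then show ?thesis by (simp add: leading_def)
qed

lemma bij_betw_leading:
  assumes "k \<le> CARD('s::finite)"
  shows "bij_betw coord_number (leading k :: 's set) {1..k}"
proof -
  have "coord_number ` (leading k :: 's set) = {1..k}"
  proof (intro equalityI subsetI)
    fix j assume "j \<in> {1..k}"
    then have "j \<in> coord_number ` (UNIV :: 's set)"
      using assms coord_number_bij[where 's = 's] by (auto simp: bij_betw_def)
    with \<open>j \<in> {1..k}\<close> show "j \<in> coord_number ` (leading k :: 's set)"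
      by (auto simp: leading_def)
  qed (use coord_number_bounds in \<open>auto simp: leading_def\<close>)
  then show ?thesis
    using coord_number_inj[where 's = 's] by (auto simp: bij_betw_def intro: inj_on_subset)
qed

definition decreasing :: "('s::finite \<Rightarrow> real) \<Rightarrow> bool" where
  "decreasing f \<longleftrightarrow> (\<forall>p q. coord_number p < coord_number q \<longrightarrow> f q \<le> f p)"

text \<open>The threshold is the smallest value on \<open>leading k\<close>, or the overall maximum
  if that set is empty. Taking it from the range lets it inherit the positivity of
  \<open>f\<close>.\<close>

lemma decreasing_separating:
  fixes f :: "'s::finite \<Rightarrow> real"
  assumes "decreasing f"
  obtains \<tau> where "\<tau> \<in> range f" "\<And>i. i \<in> leading k \<Longrightarrow> \<tau> \<le> f i" "\<And>i. i \<notin> leading k \<Longrightarrow> f i \<le> \<tau>"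
proof (cases "leading k = ({} :: 's set)")
  case True
  show ?thesis
    by (rule that[of "Max (range f)"]) (use True in \<open>auto intro!: Max_in Max_ge\<close>)
next
  case False
  then have "Min (f ` leading k) \<in> f ` leading k" by (intro Min_in) auto
  then obtain j where j: "j \<in> leading k" "Min (f ` leading k) = f j" by auto
  show ?thesis
  proof (rule that[of "f j"])
    show "f j \<le> f i" if "i \<in> leading k" for i
      using that j(2) by (metis Min_le finite finite_imageI image_eqI)
    show "f i \<le> f j" if "i \<notin> leading k" for i
      using that j(1) assms by (auto simp: leading_def decreasing_def)
  qed simp
qed

lemma ext_norm_diag_leading:
  fixes \<sigma> :: "'s::finite \<Rightarrow> real"
  assumes "decreasing \<sigma>" "\<And>i. 0 < \<sigma> i"
  shows "ext_norm (leading k) (real_diag \<sigma>) = (\<Prod>i\<in>leading k. \<sigma> i)"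
proof -
  obtain \<tau> where \<tau>: "\<tau> \<in> range \<sigma>" "\<And>i. i \<in> leading k \<Longrightarrow> \<tau> \<le> \<sigma> i" "\<And>i. i \<notin> leading k \<Longrightarrow> \<sigma> i \<le> \<tau>"
    using decreasing_separating[OF assms(1), of k] by blast
  show ?thesis
    by (rule ext_norm_diag[of \<sigma> \<tau>]) (use \<tau> assms(2) in auto)
qed

lemma hermitian_diagonalisable_decreasing:
  fixes H :: "complex^'s^'s"
  assumes "adj H = H"
  obtains W l where "unitary W" "adj W ** H ** W = real_diag l"
    "decreasing l"
proof -
  \<comment> \<open>Weights that decrease along the numbering make the maximiser list the
    eigenvalues in non-increasing order.\<close>
  have "inj (\<lambda>i :: 's. - real (coord_number i))"
    using coord_number_inj[where 's = 's] by (auto simp: inj_def)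
  then obtain W l where W: "unitary W" "adj W ** H ** W = real_diag l"
    "\<And>p q. - real (coord_number q) < - real (coord_number p) \<Longrightarrow> l q \<le> l p"
    using hermitian_diagonalisable[OF assms] by blast
  then have "decreasing l" by (simp add: decreasing_def)
  with W that show ?thesis by blast
qed

lemma unitary_conj_eq:
  assumes "unitary W" "adj W ** H ** W = D"
  shows "H = W ** D ** adj W"
  unfolding assms(2)[symmetric]
  by (metis assms(1) matrix_mul_assoc matrix_mul_rid unitary_cancel(2) unitary_right)

text \<open>Each eigenvalue is the squared norm of a column of \<open>M ** W\<close>, hence
  non-negative; invertibility of \<open>M\<close> makes the determinant non-zero, which excludes the
  eigenvalue 0.\<close>

lemma gram_diagonalisable:
  fixes M :: "complex^'s^'s"
  assumes "M ** N = mat 1"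
  obtains W l where "unitary W" "adj W ** (adj M ** M) ** W = real_diag l"
    "decreasing l" "\<And>i. 0 < l i"
proof -
  let ?H = "adj M ** M"
  obtain W l where W: "unitary W" "adj W ** ?H ** W = real_diag l" "decreasing l"
    using hermitian_diagonalisable_decreasing[of ?H] by (auto simp: adj_mult)
  have eq: "real_diag l = adj (M ** W) ** (M ** W)"
    unfolding W(2)[symmetric] by (simp add: adj_mult matrix_mul_assoc)
  have "det M * det N = 1" using assms by (metis det_I det_mul)
  moreover have "det (adj W) * det W = 1" using unitary_left[OF W(1)] by (metis det_I det_mul)
  moreover have "det (adj M) = cnj (det M)"
  proof -
    have "corner UNIV B = B" for B :: "complex^'s^'s" by (simp add: corner_def vec_eq_iff)
    then show ?thesis using minor_adjoint[of UNIV M] by (simp add: minor_def)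
  qed
  ultimately have "det (real_diag l) \<noteq> 0"
    unfolding eq adj_mult det_mul by auto
  then have nz: "l i \<noteq> 0" for i
    by (auto simp: det_diag)
  have "complex_of_real (l i) = of_real (\<Sum>a\<in>UNIV. (norm ((M ** W) $ a $ i))\<^sup>2)" for i
  proof -
    have "complex_of_real (l i) = (adj (M ** W) ** (M ** W)) $ i $ i"
      unfolding eq[symmetric] by (simp add: diag_nth)
    also have "\<dots> = (\<Sum>a\<in>UNIV. of_real ((norm ((M ** W) $ a $ i))\<^sup>2))"
      unfolding matrix_mult_nth[of "adj (M ** W)"] adj_nth
      by (intro sum.cong refl) (metis complex_norm_square mult.commute)
    finally show ?thesis by simp
  qed
  then have "0 \<le> l i" for i
    by (metis of_real_eq_iff sum_nonneg zero_le_power2)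
  with nz have "0 < l i" for i
    by (metis order_le_less)
  with W that show ?thesis by blast
qed

lemma matrix_diff_conj:
  fixes A B C D :: "'a::comm_ring_1^'s^'s"
  shows "A ** (C - D) ** B = A ** C ** B - A ** D ** B"
  by (simp add: vec_eq_iff matrix_mult_nth left_diff_distrib right_diff_distrib sum_subtractf)

text \<open>Embedding constants as constant polynomials is multiplicative and the indeterminate
  commutes with every matrix, so the conjugation passes through the characteristic matrix and
  cancels in the determinant.\<close>

lemma charpoly_unitary_conj:
  fixes W D :: "complex^'s^'s"
  assumes W: "unitary W"
  shows "charpoly (W ** D ** adj W) = charpoly D"
proof -
  let ?e = "map_matrix (\<lambda>c :: complex. [:c:]) :: complex^'s^'s \<Rightarrow> _"
  let ?X = "mat [:0, 1:] :: complex poly^'s^'s"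
  have const_sum: "[:sum f A:] = (\<Sum>x\<in>A. [:f x :: complex:])" for f and A :: "'s set"
  proof (induction A rule: infinite_finite_induct)
    case (insert x F)
    have "[:sum f (insert x F):] = [:f x:] + [:sum f F:]"
      using insert.hyps by simp
    also have "\<dots> = (\<Sum>x\<in>insert x F. [:f x:])"
      unfolding insert.IH using insert.hyps by simp
    finally show ?case .
  qed auto
  have e_mult: "?e (A ** B) = ?e A ** ?e B" for A B
    by (simp add: vec_eq_iff matrix_mult_nth const_sum mult.commute)
  have "?e (mat 1) = mat 1"
    by (simp add: vec_eq_iff mat_def one_pCons)
  then have ee: "?e W ** ?e (adj W) = mat 1"
    using unitary_right[OF W] by (metis e_mult)
  have comm: "?X ** A = A ** ?X" for A
    by (simp add: vec_eq_iff matrix_mult_nth mat_def if_distrib if_distribR mult.commute cong: if_cong)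
  have "?e W ** ?X ** ?e (adj W) = ?X"
    by (metis comm ee matrix_mul_assoc matrix_mul_rid)
  then have "?X - ?e (W ** D ** adj W) = ?e W ** (?X - ?e D) ** ?e (adj W)"
    by (simp only: e_mult matrix_diff_conj)
  then have "charpoly (W ** D ** adj W) = det (?e W) * charpoly D * det (?e (adj W))"
    by (simp add: charpoly_def det_mul)
  also have "\<dots> = charpoly D * det (?e W ** ?e (adj W))"
    by (simp add: det_mul)
  finally show ?thesis by (simp add: ee)
qed

lemma charpoly_diag: "charpoly (diag c) = (\<Prod>i\<in>UNIV. [:- c i, 1:])"
  unfolding charpoly_def by (subst det_diagonal) (auto simp: mat_def diag_nth)

text \<open>The roots of the characteristic polynomial form the multiset of the \<open>l i\<close>.
  Read along the numbering they are already non-increasing, so the sorting in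
  \<open>singular_values\<close> returns them in exactly this order.\<close>

lemma singular_values_eq:
  fixes M :: "complex^'s^'s"
  assumes W: "unitary W" "adj W ** (adj M ** M) ** W = real_diag l"
    and l: "decreasing l" and k: "1 \<le> k" "k \<le> CARD('s)"
  shows "singular_value k M = sqrt (l (inv coord_number k))"
proof -
  let ?c = "inv (coord_number :: 's \<Rightarrow> nat)"
  let ?L = "map (\<lambda>k. sqrt (l (?c k))) [1..<Suc CARD('s)]"
  have inv_c: "coord_number (?c k) = k" if "k \<in> {1..CARD('s)}" for k
    using that coord_number_bij[where 's = 's] by (metis bij_betw_imp_surj_on f_inv_into_f)
  have "charpoly (adj M ** M) = (\<Prod>i\<in>UNIV. [:- complex_of_real (l i), 1:])"
    unfolding unitary_conj_eq[OF W] charpoly_unitary_conj[OF W(1)] charpoly_diag ..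
  then have "proots (charpoly (adj M ** M)) = (\<Sum>i\<in>UNIV. {#complex_of_real (l i)#})"
    by (simp add: proots_prod)
  also have "\<dots> = image_mset (\<lambda>i. complex_of_real (l i)) (mset_set UNIV)"
  proof -
    have "(\<Sum>i\<in>A. {#f i#}) = image_mset f (mset_set A)" if "finite A" for A and f :: "'s \<Rightarrow> complex"
      using that by (induction A) auto
    then show ?thesis by simp
  qed
  finally have "image_mset (\<lambda>z. sqrt (Re z)) (proots (charpoly (adj M ** M)))
      = image_mset (\<lambda>i. sqrt (l i)) (mset_set UNIV)"
    by (simp add: image_mset.compositionality o_def)
  also have "mset_set (UNIV :: 's set) = image_mset ?c (mset_set {1..CARD('s)})"
  proof -
    have "bij_betw ?c {1..CARD('s)} UNIV"
      using bij_betw_inv_into[OF coord_number_bij[where 's = 's]] .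
    then show ?thesis
      by (metis bij_betw_def image_mset_mset_set)
  qed
  also have "image_mset (\<lambda>i. sqrt (l i)) (image_mset ?c (mset_set {1..CARD('s)})) = mset (rev ?L)"
    by (simp add: image_mset.compositionality o_def del: upt_Suc flip: atLeastLessThanSuc_atLeastAtMost)
  finally have "singular_values M = rev (sort (rev ?L))"
    unfolding singular_values_def by (simp only: sorted_list_of_multiset_mset)
  moreover have "sorted (rev ?L)"
    unfolding sorted_rev_iff_nth_mono
  proof (intro allI impI)
    fix i j assume ij: "i \<le> j" "j < length ?L"
    have "l (?c (Suc j)) \<le> l (?c (Suc i))"
    proof (cases "i = j")
      case False
      then show ?thesis
        using l ij inv_c[of "Suc i"] inv_c[of "Suc j"] by (simp add: decreasing_def)
    qed simp
    then show "?L ! j \<le> ?L ! i"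
      using ij by (simp del: upt_Suc)
  qed
  ultimately have "singular_values M = ?L"
    by (simp add: sorted_sort_id del: upt_Suc)
  moreover obtain m where "k = Suc m" using k by (cases k) auto
  ultimately show ?thesis
    using k by (simp add: singular_value_def del: upt_Suc)
qed

text \<open>Singular value decomposition: the columns of \<open>M ** W\<close> are orthogonal with
  norms \<open>sqrt (l i)\<close>, and normalising them gives the unitary factor.\<close>

lemma unitary_of_gram:
  fixes M :: "complex^'s^'s"
  assumes W: "unitary W" "adj W ** (adj M ** M) ** W = real_diag l"
    and l: "\<And>i. 0 < l i"
  obtains U where "unitary U" "M = U ** diag (\<lambda>i. of_real (sqrt (l i))) ** adj W"
proof
  let ?d = "diag (\<lambda>i. of_real (1 / sqrt (l i)))"
  let ?U = "M ** W ** ?d"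
  have "adj ?U ** ?U = ?d ** (adj W ** (adj M ** M) ** W) ** ?d"
    by (simp add: adj_mult diag_adjoint matrix_mul_assoc)
  also have "\<dots> = diag (\<lambda>i. of_real (1 / sqrt (l i) * l i * (1 / sqrt (l i))))"
    unfolding W(2) diag_mult by (simp only: of_real_mult)
  also have "(\<lambda>i. 1 / sqrt (l i) * l i * (1 / sqrt (l i))) = (\<lambda>_. 1)"
  proof
    fix i
    have "l i = sqrt (l i) * sqrt (l i)" "sqrt (l i) \<noteq> 0" using l[of i] by simp_all
    then show "1 / sqrt (l i) * l i * (1 / sqrt (l i)) = 1" by (metis divide_self_if mult.assoc nonzero_eq_divide_eq mult_1_right times_divide_eq_left)
  qed
  finally show "unitary ?U"
    by (simp add: unitary_def diag_1)
  have "?d ** diag (\<lambda>i. of_real (sqrt (l i))) = diag (\<lambda>i. of_real (1 / sqrt (l i) * sqrt (l i)))"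
    unfolding diag_mult by (simp only: of_real_mult)
  also have "(\<lambda>i. 1 / sqrt (l i) * sqrt (l i)) = (\<lambda>_. 1)"
  proof
    fix i show "1 / sqrt (l i) * sqrt (l i) = 1" using l[of i] by simp
  qed
  finally have "?d ** diag (\<lambda>i. of_real (sqrt (l i))) = mat 1"
    by (simp add: diag_1)
  then show "M = ?U ** diag (\<lambda>i. of_real (sqrt (l i))) ** adj W"
    by (metis W(1) matrix_mul_assoc matrix_mul_rid unitary_right)
qed

lemma singular_value_pos:
  fixes M :: "complex^'s^'s"
  assumes "M ** N = mat 1" "1 \<le> k" "k \<le> CARD('s)"
  shows "0 < singular_value k M"
proof -
  obtain W l where W: "unitary W" "adj W ** (adj M ** M) ** W = real_diag l"
    and l: "decreasing l" "\<And>i. 0 < l i"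
    using gram_diagonalisable[OF assms(1)] by blast
  show ?thesis
    using singular_values_eq[OF W l(1) assms(2,3)] l(2) by simp
qed

text \<open>Joins the definition by roots of a characteristic polynomial to the supremum of minors;
  unitary invariance reduces the claim to the diagonal case.\<close>

lemma prod_singular_values:
  fixes M :: "complex^'s^'s"
  assumes MN: "M ** N = mat 1" and "k \<le> CARD('s)"
  shows "(\<Prod>j = 1..k. singular_value j M) = ext_norm (leading k) M"
proof -
  obtain W l where W: "unitary W" "adj W ** (adj M ** M) ** W = real_diag l"
    and l: "decreasing l" "\<And>i. 0 < l i"
    using gram_diagonalisable[OF MN] by blast
  obtain U where U: "unitary U" "M = U ** diag (\<lambda>i. of_real (sqrt (l i))) ** adj W"
    using unitary_of_gram[OF W l(2)] by blast
  have "ext_norm (leading k) M = ext_norm (leading k) (diag (\<lambda>i. of_real (sqrt (l i))))"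
    using U W(1) by (metis ext_norm_unitary_left ext_norm_unitary_right unitary_adjoint)
  also have "\<dots> = (\<Prod>i\<in>leading k. sqrt (l i))"
    by (rule ext_norm_diag_leading) (use l in \<open>auto simp: decreasing_def\<close>)
  also have "\<dots> = (\<Prod>j = 1..k. singular_value j M)"
  proof -
    have "(\<Prod>j = 1..k. singular_value j M) = (\<Prod>i\<in>(leading k :: 's set). singular_value (coord_number i) M)"
      by (rule prod.reindex_bij_betw[OF bij_betw_leading[OF assms(2)], symmetric])
    also have "\<dots> = (\<Prod>i\<in>leading k. sqrt (l i))"
    proof (rule prod.cong)
      fix i :: 's
      show "singular_value (coord_number i) M = sqrt (l i)"
        using singular_values_eq[OF W l(1), of "coord_number i"] coord_number_bounds[of i]
        by (simp add: inv_f_f coord_number_inj)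
    qed simp
    finally show ?thesis ..
  qed
  finally show ?thesis ..
qed

text \<open>Single exponents become differences of the quantities that are subadditive. For k = 1
  the subtracted term is ln 1, as \<open>leading 0\<close> is empty.\<close>

lemma ln_singular_value:
  fixes M :: "complex^'s^'s"
  assumes "M ** N = mat 1" "1 \<le> k" "k \<le> CARD('s)"
  shows "ln (singular_value k M) = ln (ext_norm (leading k) M) - ln (ext_norm (leading (k - 1)) M)"
proof -
  obtain m where m: "k = Suc m" using assms(2) by (cases k) auto
  have "ext_norm (leading k) M = singular_value k M * ext_norm (leading m) M"
    using prod_singular_values[OF assms(1), of k] prod_singular_values[OF assms(1), of m] assms
    by (simp add: m mult.commute)
  then show ?thesis
    using singular_value_pos[OF assms] ext_norm_pos[OF assms(1), of "leading m"] by (simp add: ln_mult m)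
qed

subsection \<open>Sums of the largest eigenvalues\<close>

text \<open>For Hermitian \<open>H\<close> this is the sum of the \<open>card K\<close> largest
  eigenvalues, by Ky Fan's maximum principle. As a supremum of partial traces it is visibly
  Lipschitz in \<open>H\<close>.\<close>

definition ky_fan :: "'s set \<Rightarrow> complex^'s^'s \<Rightarrow> real" where
  "ky_fan K H = (SUP P \<in> {P. unitary P}. \<Sum>i\<in>K. Re ((adj P ** H ** P) $ i $ i))"

lemma ky_fan_upper:
  assumes "unitary P"
  shows "(\<Sum>i\<in>K. Re ((adj P ** H ** P) $ i $ i)) \<le> ky_fan K H"
proof -
  let ?f = "\<lambda>P. \<Sum>i\<in>K. Re ((adj P ** H ** P) $ i $ i)"
  have "continuous_on {P. unitary P} ?f"
    by (intro continuous_intros continuous_on_matrix_mult continuous_on_adjoint)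
  then have "bdd_above (?f ` {P. unitary P})"
    by (intro bounded_imp_bdd_above compact_imp_bounded compact_continuous_image compact_unitary)
  then show ?thesis
    unfolding ky_fan_def using assms by (intro cSUP_upper) auto
qed

lemma ky_fan_least:
  assumes "\<And>P. unitary P \<Longrightarrow> (\<Sum>i\<in>K. Re ((adj P ** H ** P) $ i $ i)) \<le> c"
  shows "ky_fan K H \<le> c"
  unfolding ky_fan_def by (rule cSUP_least) (use unitary_1 assms in blast)+

text \<open>Replacing \<open>H'\<close> by \<open>H\<close> moves each diagonal entry in each
  competitor's trace by at most the norm of the difference. \<open>CARD('s)\<close> replaces
  \<open>card K\<close> as a constant independent of \<open>K\<close>.\<close>

lemma ky_fan_diff_le: "ky_fan K H \<le> ky_fan K H' + real CARD('s) * norm (H - H')"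
  for K :: "'s::finite set"
proof (rule ky_fan_least)
  fix P :: "complex^'s^'s" assume P: "unitary P"
  have eq: "adj P ** H ** P = adj P ** H' ** P + adj P ** (H - H') ** P"
    by (simp add: vec_eq_iff matrix_mult_nth algebra_simps sum.distrib sum_subtractf)
  have b: "Re ((adj P ** (H - H') ** P) $ i $ i) \<le> norm (H - H')" for i
  proof -
    have "norm_bounded (1 * norm (H - H') * 1) (adj P ** (H - H') ** P)"
      by (intro norm_bounded_mult norm_bounded_unitary norm_bounded_norm) (auto simp: P)
    then have "norm ((adj P ** (H - H') ** P) $ i $ i) \<le> norm (H - H')"
      using norm_bounded_entry by fastforce
    then show ?thesis
      using complex_Re_le_cmod order.trans by blast
  qed
  have "(\<Sum>i\<in>K. Re ((adj P ** H ** P) $ i $ i))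
      = (\<Sum>i\<in>K. Re ((adj P ** H' ** P) $ i $ i)) + (\<Sum>i\<in>K. Re ((adj P ** (H - H') ** P) $ i $ i))"
    unfolding eq by (simp add: sum.distrib)
  also have "\<dots> \<le> ky_fan K H' + (\<Sum>i\<in>K. norm (H - H'))"
    by (intro add_mono ky_fan_upper P sum_mono b)
  also have "\<dots> \<le> ky_fan K H' + real CARD('s) * norm (H - H')"
    by (simp add: mult_right_mono card_mono)
  finally show "(\<Sum>i\<in>K. Re ((adj P ** H ** P) $ i $ i)) \<le> ky_fan K H' + real CARD('s) * norm (H - H')" .
qed

lemma ky_fan_lipschitz: "\<bar>ky_fan K H - ky_fan K H'\<bar> \<le> real CARD('s) * norm (H - H')"
  for K :: "'s::finite set"
  using ky_fan_diff_le[of K H H'] ky_fan_diff_le[of K H' H] by (simp add: norm_minus_commute abs_if)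

lemma unitary_column_norm:
  assumes "unitary P"
  shows "(\<Sum>j\<in>UNIV. (norm (P $ j $ i))\<^sup>2) = 1"
proof -
  have "(adj P ** P) $ i $ i = complex_of_real (\<Sum>j\<in>UNIV. (norm (P $ j $ i))\<^sup>2)"
    unfolding matrix_mult_nth adj_nth of_real_sum
    by (intro sum.cong refl) (metis complex_norm_square mult.commute)
  then show ?thesis
    unfolding unitary_left[OF assms] by (simp add: mat_def del: of_real_sum)
qed

text \<open>In the eigenbasis a competitor gives the eigenvalues weights \<open>w j\<close> between
  0 and 1 of total \<open>card (leading k)\<close>, because rows and columns of a unitary matrix
  have norm 1. Such weights do best when concentrated on \<open>leading k\<close>.\<close>

lemma ky_fan_diagonal:
  fixes V :: "complex^'s^'s"
  assumes V: "unitary V" and l: "decreasing l"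
  shows "ky_fan (leading k) (V ** real_diag l ** adj V) = (\<Sum>i\<in>leading k. l i)"
    (is "ky_fan ?K ?H = _")
proof (rule antisym)
  have diag: "Re ((adj P ** real_diag l ** P) $ i $ i)
      = (\<Sum>j\<in>UNIV. (norm (P $ j $ i))\<^sup>2 * l j)" for P i
  proof -
    have "(adj P ** real_diag l ** P) $ i $ i
        = complex_of_real (\<Sum>j\<in>UNIV. (norm (P $ j $ i))\<^sup>2 * l j)"
      unfolding matrix_mult_nth[of "adj P ** _"] mult_diag_nth adj_nth of_real_sum
    proof (intro sum.cong refl)
      fix j
      have "complex_of_real ((norm (P $ j $ i))\<^sup>2) = cnj (P $ j $ i) * P $ j $ i"
        by (metis complex_norm_square mult.commute)
      then show "cnj (P $ j $ i) * complex_of_real (l j) * P $ j $ i = complex_of_real ((norm (P $ j $ i))\<^sup>2 * l j)"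
        by (simp only: of_real_mult mult_ac)
    qed
    then show ?thesis by simp
  qed
  have V': "adj V ** ?H ** V = real_diag l"
    by (simp add: matrix_mul_assoc[symmetric] unitary_cancel[OF V] unitary_left[OF V])
  have "(\<Sum>i\<in>?K. l i) = (\<Sum>i\<in>?K. Re ((adj V ** ?H ** V) $ i $ i))"
    unfolding V' by (simp add: diag_nth)
  also have "\<dots> \<le> ky_fan ?K ?H"
    by (rule ky_fan_upper[OF V])
  finally show "(\<Sum>i\<in>?K. l i) \<le> ky_fan ?K ?H" .
  show "ky_fan ?K ?H \<le> (\<Sum>i\<in>?K. l i)"
  proof (rule ky_fan_least)
    fix P0 :: "complex^'s^'s" assume P0: "unitary P0"
    define P where "P = adj V ** P0"
    have P: "unitary P" using P0 V by (simp add: P_def unitary_mult)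
    define w where "w j = (\<Sum>i\<in>?K. (norm (P $ j $ i))\<^sup>2)" for j
    have w0: "0 \<le> w j" for j by (simp add: w_def sum_nonneg)
    have w1: "w j \<le> 1" for j
    proof -
      have "w j \<le> (\<Sum>i\<in>UNIV. (norm (P $ j $ i))\<^sup>2)"
        unfolding w_def by (rule sum_mono2) auto
      then show ?thesis using unitary_column_norm[of "adj P" j] P by simp
    qed
    have wsum: "(\<Sum>j\<in>UNIV. w j) = real (card ?K)"
      unfolding w_def by (subst sum.swap) (simp add: unitary_column_norm[OF P])
    obtain \<tau> where \<tau>: "\<forall>i. (i \<in> ?K \<longrightarrow> \<tau> \<le> l i) \<and> (i \<notin> ?K \<longrightarrow> l i \<le> \<tau>)"
      using decreasing_separating[OF l] by metis
    define ind where "ind j = (if j \<in> ?K then 1 else (0::real))" for j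
    have chi: "(\<Sum>j\<in>UNIV. ind j * f j) = (\<Sum>j\<in>?K. f j)" for f :: "'s \<Rightarrow> real"
    proof -
      have "(\<Sum>j\<in>UNIV. ind j * f j) = (\<Sum>j\<in>UNIV. if j \<in> ?K then f j else 0)"
        by (intro sum.cong) (simp_all add: ind_def)
      then show ?thesis by (simp add: sum.If_cases)
    qed
    have "adj P0 ** ?H ** P0 = adj P ** real_diag l ** P"
      by (simp add: P_def adj_mult matrix_mul_assoc)
    then have "(\<Sum>i\<in>?K. Re ((adj P0 ** ?H ** P0) $ i $ i)) = (\<Sum>i\<in>?K. \<Sum>j\<in>UNIV. (norm (P $ j $ i))\<^sup>2 * l j)"
      by (simp add: diag)
    also have "\<dots> = (\<Sum>j\<in>UNIV. w j * l j)"
      unfolding w_def sum_distrib_right by (rule sum.swap)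
    \<comment> \<open>The two weights have equal totals, so \<tau> may be subtracted from the
      eigenvalues at no cost. Then every product is non-positive: \<open>w j - ind j\<close> and
      \<open>l j - \<tau>\<close> have opposite signs both on and off
      \<open>leading k\<close>.\<close>
    also have "\<dots> = (\<Sum>j\<in>UNIV. (w j - ind j) * (l j - \<tau>)) + (\<Sum>j\<in>UNIV. ind j * l j)
        + \<tau> * ((\<Sum>j\<in>UNIV. w j) - (\<Sum>j\<in>UNIV. ind j * 1))"
    proof -
      have "w j * l j = (w j - ind j) * (l j - \<tau>) + ind j * l j + \<tau> * (w j - ind j * 1)" for j
        by (simp add: algebra_simps)
      then show ?thesis
        by (simp only: sum.distrib sum_subtractf sum_distrib_left[symmetric])
    qed
    also have "\<dots> = (\<Sum>j\<in>UNIV. (w j - ind j) * (l j - \<tau>)) + (\<Sum>j\<in>?K. l j)"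
      unfolding chi wsum by simp
    also have "(\<Sum>j\<in>UNIV. (w j - ind j) * (l j - \<tau>)) \<le> 0"
    proof (rule sum_nonpos)
      fix j
      show "(w j - ind j) * (l j - \<tau>) \<le> 0"
        using \<tau>[rule_format, of j] w0[of j] w1[of j] by (auto simp: ind_def mult_le_0_iff)
    qed
    finally show "(\<Sum>i\<in>?K. Re ((adj P0 ** ?H ** P0) $ i $ i)) \<le> (\<Sum>i\<in>?K. l i)" by simp
  qed
qed

subsection \<open>Local estimates\<close>

text \<open>The triangle inequality gives |v| \<le> 2 |(1 + Z) v|. This yields injectivity, hence
  invertibility in finite dimension, and the bound on the inverse at once.\<close>

lemma inverse_near_identity:
  fixes Z :: "complex^'s^'s"
  assumes Z: "norm_bounded (1/2) Z"
  obtains N where "(mat 1 + Z) ** N = mat 1" "norm_bounded 2 N"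
proof -
  have lower: "norm v \<le> 2 * norm ((mat 1 + Z) *v v)" for v
  proof -
    have "norm v \<le> norm (v + Z *v v) + norm (Z *v v)"
      using norm_triangle_ineq4[of "v + Z *v v" "Z *v v"] by simp
    moreover have "norm (Z *v v) \<le> 1/2 * norm v"
      using Z by (simp add: norm_bounded_def)
    ultimately show ?thesis
      by (simp add: matrix_vector_mult_add_rdistrib)
  qed
  have "inj ((*v) (mat 1 + Z))"
  proof (rule injI)
    fix x y assume "(mat 1 + Z) *v x = (mat 1 + Z) *v y"
    then have "norm (x - y) \<le> 0"
      using lower[of "x - y"] by (simp add: matrix_vector_mult_diff_distrib)
    then show "x = y" by simp
  qed
  then obtain N where "N ** (mat 1 + Z) = mat 1"
    using matrix_left_invertible_injective by blast
  then have N: "(mat 1 + Z) ** N = mat 1"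
    using matrix_left_right_inverse by blast
  have "norm_bounded 2 N"
    unfolding norm_bounded_def
  proof
    fix v
    show "norm (N *v v) \<le> 2 * norm v"
      using lower[of "N *v v"] by (simp add: matrix_vector_mul_assoc N)
  qed
  with N that show ?thesis by blast
qed

lemma norm_bounded_add:
  assumes "norm_bounded c M" "norm_bounded d N"
  shows "norm_bounded (c + d) (M + N)"
  unfolding norm_bounded_def
proof
  fix v
  have "norm (M *v v + N *v v) \<le> c * norm v + d * norm v"
    using assms by (intro norm_triangle_mono) (auto simp: norm_bounded_def)
  then show "norm ((M + N) *v v) \<le> (c + d) * norm v"
    by (simp add: matrix_vector_mult_add_rdistrib algebra_simps)
qed

text \<open>Factor \<open>M' = M ** (mat 1 + N ** (M' - M))\<close>: the second factor has norm at
  most 1 + x with x = c |M' - M|, it contributes at most (1 + x)^k, and ln (1 + x) \<le> x.\<close>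

lemma ln_ext_norm_diff_le:
  fixes M :: "complex^'s^'s"
  assumes MN: "M ** N = mat 1" and c: "norm_bounded c N" "0 \<le> c" and M': "M' ** N' = mat 1"
  shows "ln (ext_norm K M') - ln (ext_norm K M) \<le> real CARD('s) * c * norm (M' - M)"
proof -
  let ?x = "c * norm (M' - M)"
  have x: "0 \<le> ?x" using c by simp
  have "M ** (N ** X) = X" for X :: "complex^'s^'s"
    using MN by (metis matrix_mul_assoc matrix_mul_lid)
  then have eq: "M' = M ** (mat 1 + N ** (M' - M))"
    by (simp only: matrix_add_ldistrib matrix_mul_rid) simp
  have "norm_bounded (1 + ?x) (mat 1 + N ** (M' - M))"
    by (intro norm_bounded_add norm_bounded_mult c norm_bounded_norm norm_bounded_unitary) simp
  then have "ext_norm K (mat 1 + N ** (M' - M)) \<le> (1 + ?x) ^ card K"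
    using x by (intro ext_norm_le_power) auto
  then have "ext_norm K M' \<le> ext_norm K M * (1 + ?x) ^ card K"
    using ext_norm_mult[of K M "mat 1 + N ** (M' - M)"] mult_left_mono[OF _ ext_norm_nonneg[of K M]]
    unfolding eq[symmetric] by (meson order.trans)
  then have "ln (ext_norm K M') \<le> ln (ext_norm K M * (1 + ?x) ^ card K)"
    using ext_norm_pos[OF M'] ext_norm_pos[OF MN] x by (intro ln_mono) auto
  also have "\<dots> = ln (ext_norm K M) + real (card K) * ln (1 + ?x)"
    using ext_norm_pos[OF MN, of K] x by (simp add: ln_mult ln_realpow)
  also have "real (card K) * ln (1 + ?x) \<le> real CARD('s) * ?x"
    using x by (intro mult_mono ln_add_one_self_le_self) (auto intro: card_mono)
  finally show ?thesis by (simp add: mult.assoc)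
qed

text \<open>The one-sided estimate is applied in both directions. Closeness makes \<open>M'\<close>
  invertible with inverse bounded by \<open>2 * c\<close>, which is the origin of the factor
  2.\<close>

lemma ln_ext_norm_near:
  fixes M :: "complex^'s^'s"
  assumes MN: "M ** N = mat 1" and c: "norm_bounded c N" "0 \<le> c" and near: "c * norm (M' - M) \<le> 1/2"
  shows "\<exists>N'. M' ** N' = mat 1 \<and>
    (\<forall>K. \<bar>ln (ext_norm K M') - ln (ext_norm K M)\<bar> \<le> 2 * real CARD('s) * c * norm (M' - M))"
proof -
  have "M ** (N ** X) = X" for X :: "complex^'s^'s"
    using MN by (metis matrix_mul_assoc matrix_mul_lid)
  then have eq: "M' = M ** (mat 1 + N ** (M' - M))"
    by (simp only: matrix_add_ldistrib matrix_mul_rid) simp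
  have "norm_bounded (1/2) (N ** (M' - M))"
    by (rule norm_bounded_mono[OF norm_bounded_mult near]) (auto intro: c norm_bounded_norm)
  then obtain R where R: "(mat 1 + N ** (M' - M)) ** R = mat 1" "norm_bounded 2 R"
    using inverse_near_identity by blast
  have M': "M' ** (R ** N) = mat 1"
    by (subst eq) (metis MN R(1) matrix_mul_assoc matrix_mul_rid)
  have R': "norm_bounded (2 * c) (R ** N)"
    by (intro norm_bounded_mult R c) simp
  have x: "0 \<le> real CARD('s) * c * norm (M' - M)" using c by simp
  show ?thesis
  proof (intro exI[of _ "R ** N"] conjI M' allI)
    fix K
    show "\<bar>ln (ext_norm K M') - ln (ext_norm K M)\<bar> \<le> 2 * real CARD('s) * c * norm (M' - M)"
      using ln_ext_norm_diff_le[OF MN c M', of K] ln_ext_norm_diff_le[OF M' R' _ MN, of K] c x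
      by (simp add: norm_minus_commute abs_if)
  qed
qed

text \<open>After diagonalisation the singular values of 1 + e H are the positive numbers 1 + e l_i.
  For e \<ge> 0 they are ordered like the eigenvalues of H, so both sides select the same indices
  and ln (1 + t) = t + O(t^2) finishes.\<close>

lemma ln_ext_norm_hermitian:
  fixes H :: "complex^'s^'s"
  assumes H: "adj H = H" "norm H \<le> b" and e: "0 \<le> e" "e * b \<le> 1/2"
  shows "\<bar>ln (ext_norm (leading k) (mat 1 + e *\<^sub>R H)) - e * ky_fan (leading k) H\<bar> \<le> 2 * real CARD('s) * (e * b)\<^sup>2"
proof -
  obtain W l where W: "unitary W" "adj W ** H ** W = real_diag l" "decreasing l"
    using hermitian_diagonalisable_decreasing[OF H(1)] by blast
  have lb: "\<bar>l i\<bar> \<le> b" for i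
  proof -
    have "norm_bounded (1 * norm H * 1) (adj W ** H ** W)"
      by (intro norm_bounded_mult norm_bounded_unitary norm_bounded_norm) (auto simp: W(1))
    then have "norm (real_diag l $ i $ i) \<le> norm H"
      unfolding W(2) using norm_bounded_entry by fastforce
    then show ?thesis using H(2) by (simp add: diag_nth)
  qed
  have el: "\<bar>e * l i\<bar> \<le> e * b" for i
    using lb[of i] e(1) by (simp add: abs_mult mult_left_mono)
  then have el': "\<bar>e * l i\<bar> \<le> 1/2" for i
    using e(2) order.trans by blast
  have pos: "0 < 1 + e * l i" for i using el'[of i] by (simp add: abs_le_iff)
  have "diag (\<lambda>i. of_real (1 + e * l i)) = mat 1 + e *\<^sub>R (adj W ** H ** W)"
    unfolding W(2) by (simp add: vec_eq_iff diag_nth mat_def) (simp add: scaleR_conv_of_real)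
  also have "\<dots> = adj W ** (mat 1 + e *\<^sub>R H) ** W"
  proof -
    have "(A + B) ** C = A ** C + B ** C" for A B C :: "complex^'s^'s"
      by (simp add: vec_eq_iff matrix_mult_nth distrib_right sum.distrib)
    then show ?thesis
      using W(1) by (simp add: matrix_add_ldistrib scaleR_matrix_mult unitary_left)
  qed
  finally have "ext_norm (leading k) (mat 1 + e *\<^sub>R H) = ext_norm (leading k) (diag (\<lambda>i. of_real (1 + e * l i)))"
    using W(1) by (simp only: ext_norm_unitary_left ext_norm_unitary_right unitary_adjoint)
  also have "\<dots> = (\<Prod>i\<in>leading k. 1 + e * l i)"
  proof (rule ext_norm_diag_leading[OF _ pos])
    show "decreasing (\<lambda>i. 1 + e * l i)"
      using W(3) e(1) by (auto simp: decreasing_def mult_left_mono)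
  qed
  finally have "ln (ext_norm (leading k) (mat 1 + e *\<^sub>R H)) = (\<Sum>i\<in>leading k. ln (1 + e * l i))"
    using pos by (simp add: ln_prod less_imp_neq[OF pos, symmetric])
  moreover have "ky_fan (leading k) H = (\<Sum>i\<in>leading k. l i)"
    using ky_fan_diagonal[OF W(1,3), of k] unitary_conj_eq[OF W(1,2)] by simp
  ultimately have "\<bar>ln (ext_norm (leading k) (mat 1 + e *\<^sub>R H)) - e * ky_fan (leading k) H\<bar>
      = \<bar>\<Sum>i\<in>leading k. ln (1 + e * l i) - e * l i\<bar>"
    by (simp add: sum_subtractf sum_distrib_left)
  also have "\<dots> \<le> (\<Sum>i\<in>leading k. \<bar>ln (1 + e * l i) - e * l i\<bar>)"
    by (rule sum_abs)
  also have "\<dots> \<le> (\<Sum>i\<in>(leading k :: 's set). 2 * (e * b)\<^sup>2)"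
  proof (rule sum_mono)
    fix i
    have "\<bar>ln (1 + e * l i) - e * l i\<bar> \<le> 2 * (e * l i)\<^sup>2"
      by (rule abs_ln_one_plus_x_minus_x_bound[OF el'])
    also have "(e * l i)\<^sup>2 \<le> (e * b)\<^sup>2"
      using el[of i] by (metis abs_ge_zero power2_abs power_mono)
    finally show "\<bar>ln (1 + e * l i) - e * l i\<bar> \<le> 2 * (e * b)\<^sup>2" by simp
  qed
  also have "\<dots> \<le> 2 * real CARD('s) * (e * b)\<^sup>2"
    by (simp add: mult_right_mono card_mono)
  finally show ?thesis .
qed

text \<open>The constant 4 is the factor 2 of \<open>ln_ext_norm_near\<close> times the bound 2 on
  the inverse of \<open>mat 1 + e *\<^sub>R H\<close>; the bound 1/4 on r is its closeness
  condition.\<close>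

lemma ln_ext_norm_expansion:
  fixes H :: "complex^'s^'s"
  assumes H: "adj H = H" "norm H \<le> b" and e: "0 \<le> e" "e * b \<le> 1/2"
    and E: "norm (M - (mat 1 + e *\<^sub>R H)) \<le> r" "r \<le> 1/4"
  shows "\<bar>ln (ext_norm (leading k) M) - e * ky_fan (leading k) H\<bar> \<le> 4 * real CARD('s) * r + 2 * real CARD('s) * (e * b)\<^sup>2"
proof -
  have "norm_bounded (1/2) (e *\<^sub>R H)"
    by (rule norm_bounded_mono[OF norm_bounded_norm])
       (use e mult_left_mono[OF H(2) e(1)] in simp)
  then obtain N where N: "(mat 1 + e *\<^sub>R H) ** N = mat 1" "norm_bounded 2 N"
    using inverse_near_identity by blast
  have "\<bar>ln (ext_norm (leading k) M) - ln (ext_norm (leading k) (mat 1 + e *\<^sub>R H))\<bar>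
      \<le> 2 * real CARD('s) * 2 * norm (M - (mat 1 + e *\<^sub>R H))"
  proof -
    have "2 * norm (M - (mat 1 + e *\<^sub>R H)) \<le> 1/2" using E by simp
    then show ?thesis using ln_ext_norm_near[OF N, of M] by auto
  qed
  also have "\<dots> \<le> 4 * real CARD('s) * r"
    using E(1) by simp
  finally show ?thesis
    using ln_ext_norm_hermitian[OF H e, of k] by linarith
qed

subsection \<open>Holomorphic extension to a strip\<close>

lemma holomorphic_eq_of_real_eq:
  assumes S: "open S" "connected S" and f: "f holomorphic_on S" and g: "g holomorphic_on S"
    and x0: "complex_of_real x0 \<in> S" and eq: "\<And>x. complex_of_real x \<in> S \<Longrightarrow> f (of_real x) = g (of_real x)"
    and z: "z \<in> S"
  shows "f z = g z"
proof -
  have "of_real x0 islimpt (S \<inter> range complex_of_real)"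
    unfolding islimpt_approachable
  proof (intro allI impI)
    fix e :: real assume e: "e > 0"
    obtain d where d: "d > 0" "ball (complex_of_real x0) d \<subseteq> S"
      using S(1) x0 open_contains_ball by blast
    define t where "t = min e d / 2"
    have t: "0 < t" "t < e" "t < d" using e d by (auto simp: t_def min_def)
    have dist: "dist (complex_of_real (x0 + t)) (complex_of_real x0) = t"
      using t by (simp add: dist_norm)
    then have "complex_of_real (x0 + t) \<in> S"
      using d t by (intro subsetD[OF d(2)]) (simp add: dist_commute)
    then show "\<exists>x'\<in>S \<inter> range complex_of_real. x' \<noteq> complex_of_real x0 \<and> dist x' (complex_of_real x0) < e"
      using dist t by (intro bexI[of _ "complex_of_real (x0 + t)"] IntI) (auto simp del: of_real_add)
  qed
  then have "f z - g z = 0"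
    by (rule analytic_continuation[of "\<lambda>z. f z - g z" S "S \<inter> range complex_of_real" "of_real x0" z,
          rotated 5]) (use S f g x0 eq z in \<open>auto intro!: holomorphic_intros\<close>)
  then show ?thesis by simp
qed

lemma of_real_in_ball: "complex_of_real t \<in> ball (of_real y) e \<longleftrightarrow> \<bar>t - y\<bar> < e"
  by (simp add: dist_real_def abs_minus_commute)

text \<open>Convergence at a real distance t from the centre forces convergence at every complex
  point closer than t, for each t < r.\<close>

lemma power_series_complexify:
  fixes f :: "real \<Rightarrow> real"
  assumes f: "\<And>x. \<bar>x - x0\<bar> < r \<Longrightarrow> (\<lambda>n. (x - x0) ^ n * a n) sums f x"
  shows "\<exists>G. G holomorphic_on ball (of_real x0) r \<and> (\<forall>x. \<bar>x - x0\<bar> < r \<longrightarrow> G (of_real x) = of_real (f x))"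
proof -
  define G where "G w = (\<Sum>n. complex_of_real (a n) * (w - of_real x0) ^ n)" for w
  have "(\<lambda>n. complex_of_real (a n) * (w - of_real x0) ^ n) sums G w" if w: "w \<in> ball (of_real x0) r" for w
  proof -
    obtain t where t: "norm (w - of_real x0) < t" "t < r"
      using w dense[of "norm (w - of_real x0)" r] by (auto simp: dist_norm norm_minus_commute)
    then have t0: "0 < t" using norm_ge_zero order.strict_trans1 by blast
    have "(\<lambda>n. t ^ n * a n) sums f (x0 + t)"
      using f[of "x0 + t"] t t0 by simp
    then have "summable (\<lambda>n. complex_of_real (t ^ n * a n))"
      using sums_of_real sums_summable by blast
    then have "summable (\<lambda>n. complex_of_real (a n) * (complex_of_real t) ^ n)"
      by (simp add: mult.commute)
    then have "summable (\<lambda>n. complex_of_real (a n) * (w - of_real x0) ^ n)"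
      by (rule powser_inside) (use t t0 in simp)
    then show ?thesis
      unfolding G_def by (rule summable_sums)
  qed
  note G_sums = this
  have "G holomorphic_on ball (of_real x0) r"
    by (rule power_series_holomorphic[OF G_sums])
  moreover have "G (of_real x) = of_real (f x)" if x: "\<bar>x - x0\<bar> < r" for x
  proof -
    have "(\<lambda>n. complex_of_real ((x - x0) ^ n * a n)) sums of_real (f x)"
      using f[OF x] by (rule sums_of_real)
    moreover have "complex_of_real x \<in> ball (complex_of_real x0) r"
      using x by (simp add: dist_norm norm_minus_commute flip: of_real_diff)
    from G_sums[OF this] have "(\<lambda>n. complex_of_real ((x - x0) ^ n * a n)) sums G (of_real x)"
      by (simp add: mult.commute)
    ultimately show ?thesis
      using sums_unique2 by blast
  qed
  ultimately show ?thesis by blast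
qed

text \<open>A Lebesgue number for the cover of one period gives local extensions on discs of a
  common radius, and periodicity carries them to all real centres. Two of these discs with a common
  point meet in a convex set containing a real segment, so the extensions agree there.\<close>

lemma periodic_strip_extension:
  fixes f :: "real \<Rightarrow> real"
  assumes per: "\<And>x. f (x + 1) = f x"
    and loc: "\<And>x0. \<exists>r>0. \<exists>G. G holomorphic_on ball (of_real x0) r \<and>
      (\<forall>x. \<bar>x - x0\<bar> < r \<longrightarrow> G (of_real x) = of_real (f x))"
  shows "\<exists>\<delta>>0. \<exists>F. F holomorphic_on {z. \<bar>Im z\<bar> < \<delta>} \<and> (\<forall>x. F (of_real x) = of_real (f x))"
proof -
  obtain r G where r: "\<And>x. r x > 0"
    and G: "\<And>x0. G x0 holomorphic_on ball (of_real x0) (r x0)"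
       "\<And>x0 x. \<bar>x - x0\<bar> < r x0 \<Longrightarrow> G x0 (of_real x) = of_real (f x)"
    using loc by metis
  let ?B = "range (\<lambda>x. ball (complex_of_real x) (r x))"
  obtain \<epsilon> where \<epsilon>: "0 < \<epsilon>"
    and \<epsilon>_ball: "\<And>z. z \<in> complex_of_real ` {0..1} \<Longrightarrow> \<exists>B \<in> ?B. ball z \<epsilon> \<subseteq> B"
  proof (rule Heine_Borel_lemma[of "complex_of_real ` {0..1}" ?B])
    show "compact (complex_of_real ` {0..1})"
      by (intro compact_continuous_image continuous_intros) simp
    show "complex_of_real ` {0..1} \<subseteq> \<Union> ?B"
    proof
      fix z assume "z \<in> complex_of_real ` {0..1}"
      then obtain x where "z = complex_of_real x" by blast
      then have "z \<in> ball (of_real x) (r x)" using r by simp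
      then show "z \<in> \<Union> ?B" by blast
    qed
  qed auto
  interpret periodic_fun_simple' f
    by standard (rule per)
  have "\<exists>E. E holomorphic_on ball (of_real x) \<epsilon> \<and> (\<forall>t. \<bar>t - x\<bar> < \<epsilon> \<longrightarrow> E (of_real t) = of_real (f t))" for x
  proof -
    \<comment> \<open>The disc about x is an integer translate of a disc about a point of the
      compact period, where the common radius is available.\<close>
    define y where "y = frac x"
    have "y \<in> {0..1}" using frac_ge_0 frac_lt_1[of x] by (auto simp: y_def less_imp_le)
    then obtain x0 where x0: "ball (complex_of_real y) \<epsilon> \<subseteq> ball (complex_of_real x0) (r x0)"
      using \<epsilon>_ball by blast
    define n where "n = \<lfloor>x\<rfloor>"
    have x: "x = y + of_int n" by (simp add: y_def n_def frac_def)
    define E where "E z = G x0 (z - of_int n)" for z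
    have sub: "z - of_int n \<in> ball (complex_of_real y) \<epsilon>" if "z \<in> ball (of_real x) \<epsilon>" for z
      using that by (simp add: x dist_norm algebra_simps)
    have "(G x0 \<circ> (\<lambda>z. z - of_int n)) holomorphic_on ball (of_real x) \<epsilon>"
      by (rule holomorphic_on_compose_gen[OF _ G(1)]) (use sub x0 in \<open>auto intro!: holomorphic_intros\<close>)
    then have "E holomorphic_on ball (of_real x) \<epsilon>"
      unfolding E_def[abs_def] o_def .
    moreover have "E (of_real t) = of_real (f t)" if t: "\<bar>t - x\<bar> < \<epsilon>" for t
    proof -
      have "complex_of_real (t - of_int n) \<in> ball (complex_of_real y) \<epsilon>"
        unfolding of_real_in_ball using t x by simp
      then have "complex_of_real (t - of_int n) \<in> ball (complex_of_real x0) (r x0)"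
        using x0 by blast
      then have "\<bar>(t - of_int n) - x0\<bar> < r x0"
        unfolding of_real_in_ball .
      then have "G x0 (of_real (t - of_int n)) = of_real (f (t - of_int n))"
        by (rule G(2))
      also have "f (t - of_int n) = f t" by (rule minus_of_int)
      finally show ?thesis by (simp add: E_def)
    qed
    ultimately show ?thesis by blast
  qed
  then obtain E where E: "\<And>x. E x holomorphic_on ball (of_real x) \<epsilon>"
      "\<And>x t. \<bar>t - x\<bar> < \<epsilon> \<Longrightarrow> E x (of_real t) = of_real (f t)"
    by metis
  \<comment> \<open>Each point uses the disc centred at its own real part. \<open>F_eq\<close> makes
    the value independent of the centre, so locally \<open>F\<close> is one fixed holomorphic
    function.\<close>
  define F where "F z = E (Re z) z" for z
  have F_eq: "F z = E x z" if z: "z \<in> ball (of_real x) \<epsilon>" for x z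
  proof -
    have re: "\<bar>Re z - x\<bar> < \<epsilon>" "\<bar>Im z\<bar> < \<epsilon>"
      using abs_Re_le_cmod[of "z - of_real x"] abs_Im_le_cmod[of "z - of_real x"] z
      by (auto simp: dist_norm norm_minus_commute)
    let ?S = "ball (complex_of_real (Re z)) \<epsilon> \<inter> ball (complex_of_real x) \<epsilon>"
    have inS: "\<bar>t - Re z\<bar> < \<epsilon>" "\<bar>t - x\<bar> < \<epsilon>" if "complex_of_real t \<in> ?S" for t
      using that unfolding Int_iff of_real_in_ball by auto
    have "E (Re z) z = E x z"
    proof (rule holomorphic_eq_of_real_eq[of ?S "E (Re z)" "E x" "Re z"])
      show "open ?S" by (intro open_Int) auto
      show "connected ?S" by (intro convex_connected convex_Int convex_ball)
      show "E (Re z) holomorphic_on ?S" "E x holomorphic_on ?S"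
        using E(1) by (auto intro: holomorphic_on_subset)
      show "complex_of_real (Re z) \<in> ?S"
        unfolding Int_iff of_real_in_ball using re(1) \<epsilon> by simp
      show "E (Re z) (of_real t) = E x (of_real t)" if "complex_of_real t \<in> ?S" for t
        using E(2) inS[OF that] by simp
      have "z - of_real (Re z) = \<i> * of_real (Im z)" by (simp add: complex_eq_iff)
      then have "norm (z - of_real (Re z)) = \<bar>Im z\<bar>" by (simp add: norm_mult)
      then show "z \<in> ?S" using z re(2) by (simp add: dist_norm norm_minus_commute)
    qed
    then show ?thesis by (simp add: F_def)
  qed
  have "F holomorphic_on {z. \<bar>Im z\<bar> < \<epsilon>}"
  proof -
    have "\<exists>D. (F has_field_derivative D) (at z within {z. \<bar>Im z\<bar> < \<epsilon>})" if z: "\<bar>Im z\<bar> < \<epsilon>" for z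
    proof -
      have "z - of_real (Re z) = \<i> * of_real (Im z)" by (simp add: complex_eq_iff)
      then have "norm (z - of_real (Re z)) = \<bar>Im z\<bar>" by (simp add: norm_mult)
      then have zb: "z \<in> ball (of_real (Re z)) \<epsilon>" using z by (simp add: dist_norm norm_minus_commute)
      then have "(E (Re z) has_field_derivative deriv (E (Re z)) z) (at z)"
        using E(1) holomorphic_derivI open_ball by blast
      then have "(F has_field_derivative deriv (E (Re z)) z) (at z)"
        by (rule has_field_derivative_transform_within_open[OF _ open_ball zb]) (simp add: F_eq)
      then show ?thesis using has_field_derivative_at_within by blast
    qed
    then show ?thesis
      by (auto simp: holomorphic_on_def field_differentiable_def)
  qed
  moreover have "F (of_real x) = of_real (f x)" for x
    using E(2)[of x x] \<epsilon> by (simp add: F_def)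
  ultimately show ?thesis using \<epsilon> by blast
qed

section \<open>Analytic cocycles as holomorphic matrix functions on a strip\<close>

lemma strip_open: "open {z. \<bar>Im z\<bar> < \<delta>}"
  by (intro open_Collect_less continuous_intros)

lemma strip_convex: "convex {z. \<bar>Im z\<bar> < \<delta>}"
proof -
  have "{z. \<bar>Im z\<bar> < \<delta>} = {z. Im z < \<delta>} \<inter> {z. Im z > - \<delta>}" by auto
  then show ?thesis by (simp add: convex_Int convex_halfspace_Im_lt convex_halfspace_Im_gt)
qed

lemma exists_strip_extension:
  assumes "A \<in> (analytic_circle_SO :: (real \<Rightarrow> real^'s^'s) set)"
  shows "\<exists>F. \<exists>\<delta>>0. strip_extension A \<delta> F"
proof -
  have an: "real_analytic A" and per: "\<And>x. A (x + 1) = A x"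
    using assms by (auto simp: analytic_circle_SO_def)
  have "\<exists>\<delta>>0. \<exists>F. F holomorphic_on {z. \<bar>Im z\<bar> < \<delta>} \<and> (\<forall>x. F (of_real x) = of_real (A x $ i $ j))" for i j
  proof (rule periodic_strip_extension)
    fix x0 :: real
    obtain r a where r: "r > 0" and a: "\<And>x. \<bar>x - x0\<bar> < r \<Longrightarrow> (\<lambda>n. (x - x0) ^ n *\<^sub>R a n) sums A x"
      using an unfolding real_analytic_def by blast
    have "(\<lambda>n. (x - x0) ^ n * (a n $ i $ j)) sums (A x $ i $ j)" if "\<bar>x - x0\<bar> < r" for x
    proof -
      have "(\<lambda>m. (\<Sum>n<m. (x - x0) ^ n *\<^sub>R a n) $ i $ j) \<longlonglongrightarrow> A x $ i $ j"
        using a[OF that] unfolding sums_def by (intro tendsto_vec_nth)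
      then show ?thesis by (simp add: sums_def)
    qed
    then show "\<exists>r>0. \<exists>G. G holomorphic_on ball (of_real x0) r \<and>
        (\<forall>x. \<bar>x - x0\<bar> < r \<longrightarrow> G (of_real x) = of_real (A x $ i $ j))"
      using power_series_complexify[of x0 r "\<lambda>n. a n $ i $ j" "\<lambda>x. A x $ i $ j"] r by blast
  qed (simp add: per)
  then obtain d E where d: "\<And>i j. d i j > 0"
    and E: "\<And>i j. E i j holomorphic_on {z. \<bar>Im z\<bar> < d i j}" "\<And>i j x. E i j (complex_of_real x) = of_real (A x $ i $ j)"
    by metis
  define \<delta> where "\<delta> = Min (range (\<lambda>ij. d (fst ij) (snd ij)))"
  have \<delta>: "\<delta> > 0" using d by (simp add: \<delta>_def)
  have le: "\<delta> \<le> d i j" for i j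
    unfolding \<delta>_def by (rule Min_le) (auto intro: image_eqI[of _ _ "(i, j)"])
  have "strip_extension A \<delta> (\<lambda>z. \<chi> i j. E i j z)"
    unfolding strip_extension_def
  proof (intro conjI allI)
    fix i j show "(\<lambda>z. (\<chi> i j. E i j z) $ i $ j) holomorphic_on {z. \<bar>Im z\<bar> < \<delta>}"
      using holomorphic_on_subset[OF E(1)[of i j], of "{z. \<bar>Im z\<bar> < \<delta>}"] le[of i j] by force
  qed (simp add: E vec_eq_iff)
  then show ?thesis using \<delta> by blast
qed

text \<open>Collects the properties that the extension of \<open>A\<close> shares with all its
  iterates, so that the analysis is done once for every n. Determinant 1 gives invertibility off the
  real axis; unitarity is demanded only on that axis.\<close>

locale strip_matrix =
  fixes \<Phi> :: "complex \<Rightarrow> complex^'s^'s" and \<delta> :: real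
  assumes \<delta>_pos: "0 < \<delta>"
    and holo: "\<And>i j. (\<lambda>z. \<Phi> z $ i $ j) holomorphic_on {z. \<bar>Im z\<bar> < \<delta>}"
    and per: "\<And>z. \<bar>Im z\<bar> < \<delta> \<Longrightarrow> \<Phi> (z + 1) = \<Phi> z"
    and det1: "\<And>z. \<bar>Im z\<bar> < \<delta> \<Longrightarrow> det (\<Phi> z) = 1"
    and unit: "\<And>x. unitary (\<Phi> (of_real x))"

lemma of_real_matrix_mult: "of_real_matrix (A ** B) = of_real_matrix A ** of_real_matrix B"
  by (simp add: vec_eq_iff matrix_mult_nth)

lemma unitary_of_real_matrix:
  assumes "orthogonal_matrix A"
  shows "unitary (of_real_matrix A)"
proof -
  have "of_real_matrix (transpose A ** A) = mat 1"
    using assms by (simp add: orthogonal_matrix_def vec_eq_iff mat_def)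
  moreover have "adj (of_real_matrix A) = of_real_matrix (transpose A)"
    by (simp add: vec_eq_iff transpose_def)
  ultimately show ?thesis
    by (simp add: unitary_def of_real_matrix_mult)
qed

text \<open>Periodicity and determinant 1 are identities between holomorphic functions and spread
  from the real line by the identity theorem. Unitarity involves conjugation and stays on the
  line.\<close>

lemma strip_matrix_extension:
  assumes A: "A \<in> (analytic_circle_SO :: (real \<Rightarrow> real^'s^'s) set)" and "\<delta> > 0" "strip_extension A \<delta> F"
  shows "strip_matrix F \<delta>"
proof
  show "0 < \<delta>" by fact
  show h: "(\<lambda>z. F z $ i $ j) holomorphic_on {z. \<bar>Im z\<bar> < \<delta>}" for i j
    using assms by (auto simp: strip_extension_def)
  have F: "F (of_real x) = of_real_matrix (A x)" for x
    using assms by (auto simp: strip_extension_def)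
  have Ax: "orthogonal_matrix (A x)" "det (A x) = 1" "A (x + 1) = A x" for x
    using A by (auto simp: analytic_circle_SO_def rotation_matrix_def)
  show "unitary (F (of_real x))" for x
    unfolding F using Ax by (intro unitary_of_real_matrix)
  note id = holomorphic_eq_of_real_eq[OF strip_open convex_connected[OF strip_convex], of _ \<delta> _ 0]
  show "F (z + 1) = F z" if z: "\<bar>Im z\<bar> < \<delta>" for z
  proof -
    have "F (z + 1) $ i $ j = F z $ i $ j" for i j
    proof (rule id[where f = "\<lambda>z. F (z + 1) $ i $ j" and g = "\<lambda>z. F z $ i $ j"])
      have "((\<lambda>z. F z $ i $ j) \<circ> (\<lambda>z. z + 1)) holomorphic_on {z. \<bar>Im z\<bar> < \<delta>}"
        by (rule holomorphic_on_compose_gen[OF _ h]) (auto intro!: holomorphic_intros)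
      then show "(\<lambda>z. F (z + 1) $ i $ j) holomorphic_on {z. \<bar>Im z\<bar> < \<delta>}" by (simp add: o_def)
      show "F (of_real x + 1) $ i $ j = F (of_real x) $ i $ j" for x
        using F[of "x + 1"] F[of x] Ax(3)[of x] by simp
    qed (use z \<open>0 < \<delta>\<close> h in auto)
    then show ?thesis by (simp add: vec_eq_iff)
  qed
  show "det (F z) = 1" if z: "\<bar>Im z\<bar> < \<delta>" for z
  proof (rule id[where f = "\<lambda>z. det (F z)" and g = "\<lambda>_. 1"])
    show "(\<lambda>z. det (F z)) holomorphic_on {z. \<bar>Im z\<bar> < \<delta>}"
      unfolding det_def by (intro holomorphic_intros h)
    have "det (of_real_matrix B) = complex_of_real (det B)" for B :: "real^'s^'s"
      by (simp add: det_def)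
    then show "det (F (of_real x)) = 1" for x
      unfolding F using Ax by simp
  qed (use z \<open>0 < \<delta>\<close> in auto)
qed

subsection \<open>A discrete sub-mean value property\<close>

definition ln_cross :: "(complex \<Rightarrow> complex) \<Rightarrow> complex \<Rightarrow> real \<Rightarrow> real" where
  "ln_cross h z r = ln (norm (h (z + of_real r))) + ln (norm (h (z - of_real r)))
    + ln (norm (h (z + \<i> * of_real r))) + ln (norm (h (z - \<i> * of_real r)))"

text \<open>Near the centre ln |h| is the real part of a holomorphic logarithm. Over the four
  directions the sums of w and of w^2 both vanish, so its Taylor polynomial of degree 2 cancels and
  only a cubic remainder is left. The constants depend on \<rho> and \<open>B\<close> alone, because
  Cauchy's inequality is the only source of bounds.\<close>

lemma four_points:
  assumes \<rho>: "0 < \<rho>" and B: "0 < (B::real)"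
  shows "\<exists>C r0. 0 < r0 \<and> r0 \<le> \<rho> \<and> (\<forall>h z0. h holomorphic_on ball z0 \<rho> \<longrightarrow> h z0 = 1 \<longrightarrow> (\<forall>z\<in>ball z0 \<rho>. norm (h z) \<le> B) \<longrightarrow>
    (\<forall>z\<in>ball z0 r0. h z \<noteq> 0) \<and>
    (\<forall>r. 0 < r \<longrightarrow> r < r0 \<longrightarrow>
      - (C * r ^ 3) \<le> ln_cross h z0 r))"
proof -
  define L where "L = B / (\<rho> / 4)"
  have L: "L > 0" using \<rho> B by (simp add: L_def)
  \<comment> \<open>\<open>L\<close> bounds the derivative of h on the half disc, so within distance
    \<open>r1\<close> the function stays within 1/2 of its central value 1 and the principal
    logarithm is holomorphic.\<close>
  define r1 where "r1 = min (\<rho> / 2) (1 / (2 * L))"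
  have r1: "r1 > 0" "r1 \<le> \<rho> / 2" "L * r1 \<le> 1 / 2"
    using \<rho> L by (auto simp: r1_def min_def field_simps)
  \<comment> \<open>Cauchy's inequality for the third derivative of the logarithm on discs of radius
    \<open>r1 / 4\<close>. Its modulus is below 6, as the real part is at most 1 and the imaginary
    part at most pi in absolute value.\<close>
  define C3 where "C3 = fact 3 * 6 / (r1 / 4) ^ 3"
  have main: "(\<forall>z\<in>ball z0 (r1 / 2). h z \<noteq> 0) \<and>
    (\<forall>r. 0 < r \<longrightarrow> r < r1 / 2 \<longrightarrow>
      - (2 * C3 * r ^ 3) \<le> ln_cross h z0 r)"
    if h: "h holomorphic_on ball z0 \<rho>" and h1: "h z0 = 1" and hB: "\<And>z. z \<in> ball z0 \<rho> \<Longrightarrow> norm (h z) \<le> B" for h z0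
  proof -
    have dh: "norm (deriv h z) \<le> L" if z: "z \<in> ball z0 (\<rho> / 2)" for z
    proof -
      have sub: "cball z (\<rho> / 4) \<subseteq> ball z0 \<rho>"
      proof
        fix w assume "w \<in> cball z (\<rho> / 4)"
        then show "w \<in> ball z0 \<rho>"
          using z dist_triangle[of z0 w z] \<rho> by auto
      qed
      have "norm ((deriv ^^ 1) h z) \<le> fact 1 * B / (\<rho> / 4) ^ 1"
      proof (rule Cauchy_inequality)
        show "h holomorphic_on ball z (\<rho> / 4)"
          using h sub by (meson ball_subset_cball holomorphic_on_subset order.trans)
        show "continuous_on (cball z (\<rho> / 4)) h"
          using h sub holomorphic_on_imp_continuous_on holomorphic_on_subset by blast
        show "norm (h x) \<le> B" if "norm (z - x) = \<rho> / 4" for x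
          using sub that by (intro hB subsetD[OF sub]) (simp add: dist_norm)
      qed (use \<rho> in simp)
      then show ?thesis by (simp add: L_def)
    qed
    have near: "norm (h z - 1) \<le> 1 / 2" if z: "z \<in> ball z0 r1" for z
    proof -
      have "norm (h z - h z0) \<le> L * norm (z - z0)"
      proof (rule field_differentiable_bound[of "ball z0 (\<rho> / 2)"])
        show "(h has_field_derivative deriv h w) (at w within ball z0 (\<rho> / 2))" if "w \<in> ball z0 (\<rho> / 2)" for w
        proof -
          have "w \<in> ball z0 \<rho>" using that \<rho> by simp
          then show ?thesis
            using h holomorphic_derivI open_ball has_field_derivative_at_within by blast
        qed
      qed (use dh z r1 \<rho> in auto)
      also have "\<dots> \<le> L * r1"
        using z L by (intro mult_left_mono) (auto simp: dist_norm norm_minus_commute)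
      finally show ?thesis using r1 h1 by simp
    qed
    have Re: "Re (h z) \<ge> 1 / 2" if z: "z \<in> ball z0 r1" for z
      using near[OF z] abs_Re_le_cmod[of "h z - 1"] by simp
    define \<phi> where "\<phi> z = Ln (h z)" for z
    have \<phi>_holo: "\<phi> holomorphic_on ball z0 r1"
      unfolding \<phi>_def
    proof (intro holomorphic_on_Ln')
      show "h holomorphic_on ball z0 r1"
        by (rule holomorphic_on_subset[OF h]) (use r1 \<rho> in auto)
      show "h z \<notin> \<real>\<^sub>\<le>\<^sub>0" if "z \<in> ball z0 r1" for z
        using Re[OF that] by (auto simp: complex_nonpos_Reals_iff)
    qed
    have nz: "h z \<noteq> 0" if "z \<in> ball z0 r1" for z
      using Re[OF that] by auto
    have \<phi>_bound: "norm (\<phi> z) \<le> 6" if z: "z \<in> ball z0 r1" for z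
    proof -
      have n: "norm (h z) \<ge> 1 / 2" "norm (h z) \<le> 3 / 2"
        using norm_triangle_ineq2[of 1 "1 - h z"] norm_triangle_ineq[of "1" "h z - 1"] near[OF z]
        by (auto simp: norm_minus_commute)
      have "ln (norm (h z)) \<le> norm (h z) - 1"
        by (rule ln_le_minus_one) (use n in linarith)
      moreover have "- ln (norm (h z)) \<le> inverse (norm (h z)) - 1"
        using ln_le_minus_one[of "inverse (norm (h z))"] nz[OF z] by (simp add: ln_inverse)
      moreover have "inverse (norm (h z)) \<le> 2"
        using n(1) nz[OF z] by (simp add: field_simps)
      ultimately have "\<bar>Re (\<phi> z)\<bar> \<le> 1"
        using n nz[OF z] by (simp add: \<phi>_def abs_le_iff)
      moreover have "\<bar>Im (\<phi> z)\<bar> \<le> pi"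
        using mpi_less_Im_Ln[OF nz[OF z]] Im_Ln_le_pi[OF nz[OF z]] by (simp add: \<phi>_def)
      ultimately show ?thesis
        using cmod_le[of "\<phi> z"] pi_less_4 by linarith
    qed
    have d3: "norm ((deriv ^^ 3) \<phi> z) \<le> C3" if z: "z \<in> ball z0 (r1 / 2)" for z
      unfolding C3_def
    proof (rule Cauchy_inequality)
      have sub: "cball z (r1 / 4) \<subseteq> ball z0 r1"
      proof
        fix w assume "w \<in> cball z (r1 / 4)"
        then show "w \<in> ball z0 r1"
          using z dist_triangle[of z0 w z] r1 by auto
      qed
      show "\<phi> holomorphic_on ball z (r1 / 4)"
        using \<phi>_holo sub by (meson ball_subset_cball holomorphic_on_subset order.trans)
      show "continuous_on (cball z (r1 / 4)) \<phi>"
        using \<phi>_holo sub holomorphic_on_imp_continuous_on holomorphic_on_subset by blast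
      show "norm (\<phi> x) \<le> 6" if "norm (z - x) = r1 / 4" for x
        using sub that by (intro \<phi>_bound subsetD[OF sub]) (simp add: dist_norm)
    qed (use r1 in simp)
    have C3: "C3 \<ge> 0" using r1 by (simp add: C3_def)
    have taylor: "norm (\<phi> z - (\<Sum>i\<le>2. (deriv ^^ i) \<phi> z0 * (z - z0) ^ i / fact i)) \<le> C3 * norm (z - z0) ^ 3 / 2"
      if z: "z \<in> ball z0 (r1 / 2)" for z
    proof -
      have "norm ((deriv ^^ 0) \<phi> z - (\<Sum>i\<le>2. (deriv ^^ i) \<phi> z0 * (z - z0) ^ i / fact i))
          \<le> C3 * norm (z - z0) ^ Suc 2 / fact 2"
      proof (rule complex_Taylor[of "ball z0 (r1 / 2)"])
        show "((deriv ^^ i) \<phi> has_field_derivative (deriv ^^ Suc i) \<phi> w) (at w within ball z0 (r1 / 2))"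
          if "w \<in> ball z0 (r1 / 2)" for i w
        proof -
          have w: "w \<in> ball z0 r1" using that r1 by simp
          have "(deriv ^^ i) \<phi> holomorphic_on ball z0 r1"
            by (rule holomorphic_higher_deriv[OF \<phi>_holo]) simp
          then have "((deriv ^^ i) \<phi> has_field_derivative deriv ((deriv ^^ i) \<phi>) w) (at w)"
            using w holomorphic_derivI open_ball by blast
          then show ?thesis
            using has_field_derivative_at_within by (simp add: has_field_derivative_at_within)
        qed
      qed (use d3 z r1 in \<open>auto simp: numeral_3_eq_3 numeral_2_eq_2\<close>)
      then show ?thesis by (simp add: numeral_3_eq_3 numeral_2_eq_2)
    qed
    have \<phi>0: "\<phi> z0 = 0" by (simp add: \<phi>_def h1)
    have ln_eq: "ln (norm (h z)) = Re (\<phi> z)" if "z \<in> ball z0 r1" for z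
      using nz[OF that] by (simp add: \<phi>_def)
    have "- (2 * C3 * r ^ 3) \<le> ln_cross h z0 r"
      if r: "0 < r" "r < r1 / 2" for r
    proof -
      define a where "a = deriv \<phi> z0"
      define b where "b = deriv (deriv \<phi>) z0 / 2"
      have poly: "(\<Sum>i\<le>2. (deriv ^^ i) \<phi> z0 * w ^ i / fact i) = a * w + b * w ^ 2" for w
        by (simp add: numeral_2_eq_2 a_def b_def \<phi>0)
      have est: "norm (\<phi> (z0 + w) - (a * w + b * w ^ 2)) \<le> C3 * r ^ 3 / 2" if "norm w = r" for w
        using taylor[of "z0 + w"] that r poly[of w] by (simp add: dist_norm)
      have re: "Re (a * w + b * w ^ 2) - C3 * r ^ 3 / 2 \<le> ln (norm (h (z0 + w)))" if "norm w = r" for w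
      proof -
        have "z0 + w \<in> ball z0 r1" using that r by (simp add: dist_norm)
        then show ?thesis
          using est[OF that] abs_Re_le_cmod[of "\<phi> (z0 + w) - (a * w + b * w ^ 2)"] ln_eq[of "z0 + w"]
          by (simp add: abs_le_iff)
      qed
      \<comment> \<open>Opposite points cancel the linear term; the horizontal and vertical pairs
        cancel the quadratic one, since the square of i is -1.\<close>
      have "Re (a * of_real r + b * (of_real r) ^ 2) + Re (a * (- of_real r) + b * (- of_real r) ^ 2)
         + Re (a * (\<i> * of_real r) + b * (\<i> * of_real r) ^ 2) + Re (a * (- (\<i> * of_real r)) + b * (- (\<i> * of_real r)) ^ 2) = 0"
        by (simp add: power_mult_distrib)
      then show ?thesis
        using re[of "of_real r"] re[of "- of_real r"] re[of "\<i> * of_real r"] re[of "- (\<i> * of_real r)"] r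
        by (simp add: norm_mult ln_cross_def)
    qed
    then show ?thesis
      using nz r1 by auto
  qed
  show ?thesis
    by (rule exI[of _ "2 * C3"], rule exI[of _ "r1 / 2"]) (use main r1 \<rho> in auto)
qed

text \<open>Maximum principle. If f exceeded its chord somewhere, f minus the chord minus a small
  concave parabola would have a positive interior maximum. The parabola adds 2 \<eta> r^2 to the
  second difference there, which beats C r^3 for small r. \<open>C\<close> and \<open>r0\<close> may
  depend on the point.\<close>

lemma convex_of_second_difference:
  fixes f :: "real \<Rightarrow> real"
  assumes ab: "a < b" and cont: "continuous_on {a..b} f"
    and sd: "\<And>y. a < y \<Longrightarrow> y < b \<Longrightarrow> \<exists>C r0. 0 < r0 \<and> (\<forall>r. 0 < r \<longrightarrow> r < r0 \<longrightarrow> - (C * r ^ 3) \<le> f (y + r) + f (y - r) - 2 * f y)"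
    and t: "0 \<le> t" "t \<le> 1"
  shows "f ((1 - t) * a + t * b) \<le> (1 - t) * f a + t * f b"
proof (rule ccontr)
  assume neg: "\<not> ?thesis"
  define q where "q = (f b - f a) / (b - a)"
  define l where "l y = f a + q * (y - a)" for y
  define y1 where "y1 = (1 - t) * a + t * b"
  have l: "l y1 = (1 - t) * f a + t * f b" "l a = f a" "l b = f b"
  proof -
    have "y1 - a = t * (b - a)" by (simp add: y1_def algebra_simps)
    then have "q * (y1 - a) = t * (f b - f a)"
      using ab by (simp add: q_def)
    then show "l y1 = (1 - t) * f a + t * f b"
      unfolding l_def by (simp add: algebra_simps)
  qed (use ab in \<open>auto simp: l_def q_def\<close>)
  have y1: "y1 \<in> {a..b}"
  proof -
    have "y1 = a + t * (b - a)" "y1 = b - (1 - t) * (b - a)" by (simp_all add: y1_def algebra_simps)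
    moreover have "0 \<le> t * (b - a)" "0 \<le> (1 - t) * (b - a)" using t ab by simp_all
    ultimately have "a \<le> y1" "y1 \<le> b" by linarith+
    then show ?thesis by simp
  qed
  have gt: "0 < f y1 - l y1" using neg l by (simp add: y1_def)
  define m where "m = (b - y1) * (y1 - a)"
  have m: "0 \<le> m" using y1 by (simp add: m_def)
  \<comment> \<open>Small enough to keep the perturbed function positive at \<open>y1\<close>; m + 1
    avoids a zero denominator.\<close>
  define \<eta> where "\<eta> = (f y1 - l y1) / (2 * (m + 1))"
  have \<eta>: "\<eta> > 0" using gt m by (simp add: \<eta>_def)
  define \<psi> where "\<psi> y = f y - l y - \<eta> * ((b - y) * (y - a))" for y
  have "\<eta> * m < f y1 - l y1"
  proof -
    have "\<eta> * m \<le> \<eta> * (m + 1)" using \<eta> by simp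
    also have "\<dots> = (f y1 - l y1) / 2" using m by (simp add: \<eta>_def field_simps)
    finally show ?thesis using gt by simp
  qed
  then have \<psi>1: "0 < \<psi> y1" by (simp add: \<psi>_def m_def)
  have "continuous_on {a..b} \<psi>"
    unfolding \<psi>_def l_def by (intro continuous_intros cont)
  then obtain y where y: "y \<in> {a..b}" "\<And>x. x \<in> {a..b} \<Longrightarrow> \<psi> x \<le> \<psi> y"
    using continuous_attains_sup[of "{a..b}" \<psi>] ab by auto
  have \<psi>y: "0 < \<psi> y" using y(2)[OF y1] \<psi>1 by simp
  have "y \<noteq> a" "y \<noteq> b" using \<psi>y l by (auto simp: \<psi>_def)
  then have ya: "a < y" "y < b" using y(1) by auto
  obtain C r0 where r0: "0 < r0" "\<And>r. 0 < r \<Longrightarrow> r < r0 \<Longrightarrow> - (C * r ^ 3) \<le> f (y + r) + f (y - r) - 2 * f y"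
    using sd[OF ya] by blast
  \<comment> \<open>Keeps both neighbours in the interval and makes the cubic error at most \<eta>
    r^2, half of the quadratic gain.\<close>
  define r where "r = min (min (r0 / 2) (min (y - a) (b - y))) (\<eta> / (\<bar>C\<bar> + 1))"
  have rle: "r \<le> r0 / 2" "r \<le> y - a" "r \<le> b - y" and r5: "r \<le> \<eta> / (\<bar>C\<bar> + 1)"
    unfolding r_def by linarith+
  have "0 < \<eta> / (\<bar>C\<bar> + 1)" using \<eta> by simp
  then have rpos: "0 < r" using r0(1) ya by (simp add: r_def)
  have r: "0 < r" "r < r0" "y - r \<in> {a..b}" "y + r \<in> {a..b}" "r \<le> \<eta> / (\<bar>C\<bar> + 1)"
    using rle r5 rpos r0(1) by auto
  have quad: "(b - (y + r)) * ((y + r) - a) + (b - (y - r)) * ((y - r) - a) - 2 * ((b - y) * (y - a)) = - 2 * r ^ 2"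
    by (simp add: algebra_simps power2_eq_square)
  have lin: "l (y + r) + l (y - r) - 2 * l y = 0"
    by (simp add: l_def algebra_simps)
  have "\<psi> (y + r) + \<psi> (y - r) - 2 * \<psi> y = (f (y + r) + f (y - r) - 2 * f y) - (l (y + r) + l (y - r) - 2 * l y)
     - \<eta> * ((b - (y + r)) * ((y + r) - a) + (b - (y - r)) * ((y - r) - a) - 2 * ((b - y) * (y - a)))"
    by (simp add: \<psi>_def algebra_simps)
  also have "\<dots> \<ge> - (C * r ^ 3) + 2 * \<eta> * r ^ 2"
    unfolding quad lin using r0(2)[OF r(1,2)] by simp
  finally have "- (C * r ^ 3) + 2 * \<eta> * r ^ 2 \<le> 0"
    using y(2)[OF r(3)] y(2)[OF r(4)] by linarith
  then have "r ^ 2 * (2 * \<eta> - C * r) \<le> 0"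
    by (simp add: algebra_simps power2_eq_square power3_eq_cube)
  then have "2 * \<eta> \<le> C * r"
    using r(1) by (simp add: mult_le_0_iff)
  also have "C * r \<le> \<bar>C\<bar> * r" using r(1) by (simp add: mult_right_mono)
  also have "\<dots> \<le> (\<bar>C\<bar> + 1) * r" using r(1) by simp
  also have "\<dots> \<le> \<eta>" using r(5) by (simp add: field_simps)
  finally show False using \<eta> by simp
qed

lemma integral_periodic_shift:
  fixes f :: "real \<Rightarrow> real"
  assumes cont: "continuous_on UNIV f" and per: "\<And>x. f (x + 1) = f x"
  shows "integral {0..1} (\<lambda>x. f (x + c)) = integral {0..1} f"
proof -
  interpret periodic_fun_simple' f by standard (rule per)
  have int: "f integrable_on {a..b}" for a b
    by (intro integrable_continuous_real continuous_on_subset[OF cont]) simp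
  have shift: "integral {a..b} (\<lambda>x. f (x + t)) = integral {a + t..b + t} f" for a b t
    using integral_shift_Icc_real[of a b f t] by (simp add: o_def add.commute)
  define t where "t = frac c"
  have t: "0 \<le> t" "t \<le> 1" using frac_ge_0 frac_lt_1[of c] by (auto simp: t_def less_imp_le)
  have "f (x + c) = f (x + t)" for x
    using plus_of_int[of "x + t" "\<lfloor>c\<rfloor>"] by (simp add: t_def frac_def algebra_simps)
  then have "integral {0..1} (\<lambda>x. f (x + c)) = integral {t..1 + t} f"
    using shift[of 0 1 t] by simp
  also have "\<dots> = integral {t..1} f + integral {1..1 + t} f"
    by (rule Henstock_Kurzweil_Integration.integral_combine[symmetric]) (use t int in auto)
  also have "integral {1..1 + t} f = integral {0..t} f"
    using shift[of 0 t 1] by (simp add: per add.commute)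
  also have "integral {t..1} f + integral {0..t} f = integral {0..1} f"
    using Henstock_Kurzweil_Integration.integral_combine[of 0 t 1 f] t int by simp
  finally show ?thesis .
qed

subsection \<open>Circle averages along a strip\<close>

context strip_matrix
begin

abbreviation "strip \<equiv> {z :: complex. \<bar>Im z\<bar> < \<delta>}"

lemma continuous_on_entry: "continuous_on strip (\<lambda>z. \<Phi> z $ i $ j)"
  by (rule holomorphic_on_imp_continuous_on[OF holo])

lemma continuous_on_matrix: "continuous_on strip \<Phi>"
  by (rule continuous_on_matrixI[OF continuous_on_entry])

lemma right_inverse:
  assumes "\<bar>Im z\<bar> < \<delta>"
  obtains N where "\<Phi> z ** N = mat 1"
proof -
  have "invertible (\<Phi> z)"
    using det1[OF assms] by (simp add: invertible_det_nz)
  then show ?thesis using that unfolding invertible_def by blast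
qed

definition lnorm :: "'s set \<Rightarrow> complex \<Rightarrow> real" where
  "lnorm K z = ln (ext_norm K (\<Phi> z))"

lemma exp_lnorm: "\<bar>Im z\<bar> < \<delta> \<Longrightarrow> exp (lnorm K z) = ext_norm K (\<Phi> z)"
  using right_inverse[of z] ext_norm_pos by (metis exp_ln lnorm_def)

lemma lnorm_real: "lnorm K (of_real x) = 0"
  by (simp add: lnorm_def ext_norm_unitary unit)

lemma lnorm_periodic: "\<bar>Im z\<bar> < \<delta> \<Longrightarrow> lnorm K (z + 1) = lnorm K z"
  by (simp add: lnorm_def per)

lemma continuous_on_lnorm: "continuous_on strip (lnorm K)"
  unfolding continuous_on_def
proof
  fix z0 assume z0: "z0 \<in> strip"
  then obtain N where N: "\<Phi> z0 ** N = mat 1" using right_inverse by auto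
  define c where "c = norm N"
  have lim: "((\<lambda>z. norm (\<Phi> z - \<Phi> z0)) \<longlongrightarrow> 0) (at z0 within strip)"
    using continuous_on_matrix z0 unfolding continuous_on_def
    by (intro tendsto_norm_zero LIM_zero) blast
  have "((\<lambda>z. c * norm (\<Phi> z - \<Phi> z0)) \<longlongrightarrow> c * 0) (at z0 within strip)"
    by (intro tendsto_intros lim)
  then have ev: "eventually (\<lambda>z. c * norm (\<Phi> z - \<Phi> z0) < 1/2) (at z0 within strip)"
    by (rule order_tendstoD) simp
  have "((\<lambda>z. lnorm K z - lnorm K z0) \<longlongrightarrow> 0) (at z0 within strip)"
  proof (rule Lim_null_comparison)
    show "eventually (\<lambda>z. norm (lnorm K z - lnorm K z0) \<le> 2 * real CARD('s) * c * norm (\<Phi> z - \<Phi> z0)) (at z0 within strip)"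
      using ev
    proof eventually_elim
      case (elim z)
      then show ?case
        using ln_ext_norm_near[OF N, of c "\<Phi> z"] by (auto simp: lnorm_def c_def norm_bounded_norm)
    qed
    have "((\<lambda>z. 2 * real CARD('s) * c * norm (\<Phi> z - \<Phi> z0)) \<longlongrightarrow> 2 * real CARD('s) * c * 0) (at z0 within strip)"
      by (intro tendsto_intros lim)
    then show "((\<lambda>z. 2 * real CARD('s) * c * norm (\<Phi> z - \<Phi> z0)) \<longlongrightarrow> 0) (at z0 within strip)" by simp
  qed
  then show "(lnorm K \<longlongrightarrow> lnorm K z0) (at z0 within strip)"
    by (rule LIM_zero_cancel)
qed

lemma continuous_on_lnorm_line:
  assumes "\<bar>y\<bar> < \<delta>"
  shows "continuous_on S (\<lambda>x. lnorm K (Complex x y))"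
proof (rule continuous_on_compose2[OF continuous_on_lnorm])
  have "continuous_on S (\<lambda>x. of_real x + \<i> * of_real y :: complex)" by (intro continuous_intros)
  then show "continuous_on S (\<lambda>x. Complex x y)" by (simp add: Complex_eq)
qed (use assms in auto)

definition avg :: "'s set \<Rightarrow> real \<Rightarrow> real" where
  "avg K y = integral {0..1} (\<lambda>x. lnorm K (Complex x y))"

lemma avg_0 [simp]: "avg K 0 = 0"
  by (simp add: avg_def flip: complex_of_real_def) (simp add: lnorm_real)

lemma continuous_on_avg: "continuous_on {-\<delta><..<\<delta>} (avg K)"
proof -
  have "continuous_on ({-\<delta><..<\<delta>} \<times> cbox 0 1) (\<lambda>(y, x). lnorm K (Complex x y))"
    unfolding case_prod_unfold
  proof (rule continuous_on_compose2[OF continuous_on_lnorm])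
    have "continuous_on ({-\<delta><..<\<delta>} \<times> cbox 0 1) (\<lambda>p. of_real (snd p) + \<i> * of_real (fst p) :: complex)"
      by (intro continuous_intros)
    then show "continuous_on ({-\<delta><..<\<delta>} \<times> cbox 0 1) (\<lambda>p. Complex (snd p) (fst p))" by (simp add: Complex_eq)
  qed auto
  then show ?thesis
    using integral_continuous_on_param[of "{-\<delta><..<\<delta>}" 0 1 "\<lambda>y x. lnorm K (Complex x y)"]
    by (simp add: avg_def[abs_def])
qed

lemma avg_shift:
  assumes "\<bar>y\<bar> < \<delta>"
  shows "integral {0..1} (\<lambda>x. lnorm K (Complex (x + c) y)) = avg K y"
  unfolding avg_def
proof (rule integral_periodic_shift[where f = "\<lambda>x. lnorm K (Complex x y)"])
  show "lnorm K (Complex (x + 1) y) = lnorm K (Complex x y)" for x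
    using lnorm_periodic[of "Complex x y" K] assms by (simp add: Complex_eq algebra_simps)
qed (rule continuous_on_lnorm_line[OF assms])

lemma lnorm_integrable: "\<bar>y\<bar> < \<delta> \<Longrightarrow> (\<lambda>x. lnorm K (Complex (x + c) y)) integrable_on {0..1}"
  by (intro integrable_continuous_real continuous_on_compose2[OF continuous_on_lnorm_line[where S = UNIV]] continuous_intros) auto

abbreviation lcross :: "'s set \<Rightarrow> real \<Rightarrow> real \<Rightarrow> real \<Rightarrow> real" where
  "lcross K x y r \<equiv> lnorm K (Complex (x + r) y) + lnorm K (Complex (x + (- r)) y)
       + lnorm K (Complex x (y + r)) + lnorm K (Complex x (y - r))"

text \<open>The unitary pair optimal at the centre gives a holomorphic minor g with ln |g| \<le>
  \<open>lnorm\<close> nearby and equality at the centre. The four-point inequality for g divided by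
  its central value transfers to \<open>lnorm\<close>. Uniformity in x permits integration
  afterwards.\<close>

lemma lnorm_submean:
  assumes y: "\<bar>y\<bar> < \<delta>"
  shows "\<exists>C r0. 0 < r0 \<and> r0 \<le> \<delta> - \<bar>y\<bar> \<and> (\<forall>r x. 0 < r \<longrightarrow> r < r0 \<longrightarrow> x \<in> {0..1} \<longrightarrow>
     4 * lnorm K (Complex x y) - C * r ^ 3 \<le> lcross K x y r)"
proof -
  define \<rho> where "\<rho> = (\<delta> - \<bar>y\<bar>) / 2"
  have \<rho>: "\<rho> > 0" "\<bar>y\<bar> + \<rho> < \<delta>" "\<rho> \<le> \<delta> - \<bar>y\<bar>" using y by (auto simp: \<rho>_def field_simps)
  \<comment> \<open>A compact rectangle in the strip containing the \<rho>-discs about all points of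
    the segment. If \<open>b\<close> bounds |\<open>lnorm\<close>| on it, then
    \<open>exp (2 * b)\<close> bounds the normalised minor, independently of x.\<close>
  define R where "R = cbox (Complex (- \<rho>) (y - \<rho>)) (Complex (1 + \<rho>) (y + \<rho>))"
  have R: "z \<in> R \<longleftrightarrow> - \<rho> \<le> Re z \<and> Re z \<le> 1 + \<rho> \<and> \<bar>Im z - y\<bar> \<le> \<rho>" for z
    by (auto simp: R_def in_cbox_complex_iff abs_le_iff)
  have Rs: "R \<subseteq> strip" using \<rho> by (auto simp: R abs_le_iff abs_less_iff)
  have "compact (lnorm K ` R)"
    using continuous_on_subset[OF continuous_on_lnorm Rs] by (rule compact_continuous_image) (simp add: R_def)
  then obtain b where b: "\<And>z. z \<in> R \<Longrightarrow> \<bar>lnorm K z\<bar> \<le> b"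
    using compact_imp_bounded bounded_iff by (metis (no_types, lifting) imageI real_norm_def)
  obtain C r0 where r0: "0 < r0" "r0 \<le> \<rho>"
    and four: "\<And>h z0. h holomorphic_on ball z0 \<rho> \<Longrightarrow> h z0 = 1 \<Longrightarrow> (\<forall>z\<in>ball z0 \<rho>. norm (h z) \<le> exp (2 * b)) \<Longrightarrow>
      (\<forall>z\<in>ball z0 r0. h z \<noteq> 0) \<and>
      (\<forall>r. 0 < r \<longrightarrow> r < r0 \<longrightarrow>
        - (C * r ^ 3) \<le> ln_cross h z0 r)"
    using four_points[OF \<rho>(1), of "exp (2 * b)"] by auto
  have "4 * lnorm K (Complex x y) - C * r ^ 3 \<le> lcross K x y r"
    if r: "0 < r" "r < r0" and x: "x \<in> {0..1}" for r x
  proof -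
    define z0 where "z0 = Complex x y"
    obtain P Q where PQ: "unitary P" "unitary Q" "ext_norm K (\<Phi> z0) = norm (minor K (P ** \<Phi> z0 ** Q))"
      using ext_norm_attained .
    define g where "g z = minor K (P ** \<Phi> z ** Q)" for z
    have bs: "ball z0 \<rho> \<subseteq> R"
    proof
      fix z assume "z \<in> ball z0 \<rho>"
      then have "norm (z - z0) < \<rho>" by (simp add: dist_norm norm_minus_commute)
      then have "\<bar>Re z - x\<bar> < \<rho>" "\<bar>Im z - y\<bar> < \<rho>"
        using abs_Re_le_cmod[of "z - z0"] abs_Im_le_cmod[of "z - z0"] by (auto simp: z0_def)
      then show "z \<in> R" using x by (auto simp: R)
    qed
    have z0R: "z0 \<in> R" using bs \<rho>(1) by auto
    have entry: "(\<lambda>z. corner K (P ** \<Phi> z ** Q) $ i $ j) holomorphic_on ball z0 \<rho>" for i j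
    proof -
      have "(\<lambda>z. (P ** \<Phi> z ** Q) $ i $ j) holomorphic_on ball z0 \<rho>"
        unfolding matrix_mult_nth
        by (intro holomorphic_intros holomorphic_on_subset[OF holo] order.trans[OF bs Rs])
      then show ?thesis unfolding corner_nth by (cases "i \<in> K \<and> j \<in> K") auto
    qed
    have g_holo: "g holomorphic_on ball z0 \<rho>"
      unfolding g_def minor_def det_def by (intro holomorphic_intros entry)
    have strip_R: "\<bar>Im z\<bar> < \<delta>" if "z \<in> R" for z using Rs that by auto
    have g_le: "norm (g z) \<le> exp (lnorm K z)" if "z \<in> R" for z
      unfolding g_def exp_lnorm[OF strip_R[OF that]] by (rule ext_norm_upper[OF PQ(1,2)])
    have g0: "norm (g z0) = exp (lnorm K z0)"
      unfolding exp_lnorm[OF strip_R[OF z0R]] by (simp add: g_def PQ(3))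
    then have g0nz: "g z0 \<noteq> 0" by auto
    define h where "h z = g z / g z0" for z
    have "h holomorphic_on ball z0 \<rho>"
      unfolding h_def by (intro holomorphic_intros g_holo) (use g0nz in auto)
    moreover have "h z0 = 1" using g0nz by (simp add: h_def)
    moreover have "\<forall>z\<in>ball z0 \<rho>. norm (h z) \<le> exp (2 * b)"
    proof
      fix z assume "z \<in> ball z0 \<rho>"
      then have zR: "z \<in> R" using bs by blast
      have "norm (h z) \<le> exp (lnorm K z) / exp (lnorm K z0)"
        unfolding h_def norm_divide g0 using g_le[OF zR] by (simp add: divide_right_mono)
      also have "\<dots> = exp (lnorm K z - lnorm K z0)" by (simp add: exp_diff)
      also have "\<dots> \<le> exp (2 * b)" using b[OF zR] b[OF z0R] by simp
      finally show "norm (h z) \<le> exp (2 * b)" .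
    qed
    ultimately have nz: "\<And>z. z \<in> ball z0 r0 \<Longrightarrow> h z \<noteq> 0"
      and sum: "- (C * r ^ 3) \<le> ln_cross h z0 r"
      using four[of h z0] r by auto
    have le: "ln (norm (h (z0 + w))) \<le> lnorm K (z0 + w) - lnorm K z0" if w: "norm w = r" for w
    proof -
      have wb: "z0 + w \<in> ball z0 r0" using w r by (simp add: dist_norm)
      then have wR: "z0 + w \<in> R" using bs r0 by auto
      have "norm (h (z0 + w)) \<le> exp (lnorm K (z0 + w)) / exp (lnorm K z0)"
        unfolding h_def norm_divide g0 using g_le[OF wR] by (simp add: divide_right_mono)
      also have "\<dots> = exp (lnorm K (z0 + w) - lnorm K z0)" by (simp add: exp_diff)
      finally have "ln (norm (h (z0 + w))) \<le> ln (exp (lnorm K (z0 + w) - lnorm K z0))"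
        using nz[OF wb] by (intro ln_mono) auto
      then show ?thesis by simp
    qed
    have c: "Complex (x + r) y = z0 + of_real r" "Complex (x + (- r)) y = z0 + (- of_real r)"
      "Complex x (y + r) = z0 + \<i> * of_real r" "Complex x (y - r) = z0 + (- (\<i> * of_real r))"
      by (auto simp: z0_def complex_eq_iff)
    show ?thesis
      unfolding c z0_def[symmetric]
      using sum le[of "of_real r"] le[of "- of_real r"] le[of "\<i> * of_real r"] le[of "- (\<i> * of_real r)"] r
      by (simp add: norm_mult ln_cross_def)
  qed
  then show ?thesis using r0 \<rho> by (intro exI[of _ C] exI[of _ r0]) auto
qed

text \<open>Integration over the period: a horizontal shift does not change the circle average, so
  two of the four copies of the centre cancel and the vertical second difference remains.\<close>

lemma avg_second_difference:
  assumes y: "\<bar>y\<bar> < \<delta>"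
  shows "\<exists>C r0. 0 < r0 \<and> (\<forall>r. 0 < r \<longrightarrow> r < r0 \<longrightarrow> - (C * r ^ 3) \<le> avg K (y + r) + avg K (y - r) - 2 * avg K y)"
proof -
  obtain C r0 where r0: "0 < r0" "r0 \<le> \<delta> - \<bar>y\<bar>"
    and sub: "\<And>r x. 0 < r \<Longrightarrow> r < r0 \<Longrightarrow> x \<in> {0..1} \<Longrightarrow>
     4 * lnorm K (Complex x y) - C * r ^ 3 \<le> lcross K x y r"
    using lnorm_submean[OF y, of K] by blast
  have "- (C * r ^ 3) \<le> avg K (y + r) + avg K (y - r) - 2 * avg K y" if r: "0 < r" "r < r0" for r
  proof -
    have yr: "\<bar>y + r\<bar> < \<delta>" "\<bar>y - r\<bar> < \<delta>" using r r0 by linarith+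
    have sh: "((\<lambda>x. lnorm K (Complex (x + c) y)) has_integral avg K y) {0..1}" for c
      using integrable_integral[OF lnorm_integrable[OF y, of K c]] unfolding avg_shift[OF y] .
    have av: "((\<lambda>x. lnorm K (Complex x w)) has_integral avg K w) {0..1}" if "\<bar>w\<bar> < \<delta>" for w
      using integrable_integral[OF lnorm_integrable[OF that, of K 0]] by (simp add: avg_def)
    have "((\<lambda>x. 4 * lnorm K (Complex x y) - C * r ^ 3) has_integral (4 * avg K y - C * r ^ 3)) {0..1}"
      using has_integral_diff[OF has_integral_mult_right[OF av[OF y], of 4] has_integral_const_real[of "C * r ^ 3" 0 1]]
      by simp
    moreover have "((\<lambda>x. lcross K x y r) has_integral
        (avg K y + avg K y + avg K (y + r) + avg K (y - r))) {0..1}"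
      by (intro has_integral_add sh av yr)
    ultimately have "4 * avg K y - C * r ^ 3 \<le> avg K y + avg K y + avg K (y + r) + avg K (y - r)"
      by (rule has_integral_le) (use sub r in auto)
    then show ?thesis by simp
  qed
  with r0 show ?thesis by blast
qed

text \<open>Convexity on the segment from 0 to e, where the left end has value 0: chord slopes from
  the origin do not decrease.\<close>

lemma avg_star_convex:
  assumes e: "0 < e" "e < \<delta>" and t: "0 \<le> t" "t \<le> 1"
  shows "avg K (t * e) \<le> t * avg K e"
proof -
  have "avg K ((1 - t) * 0 + t * e) \<le> (1 - t) * avg K 0 + t * avg K e"
  proof (rule convex_of_second_difference[OF e(1) _ _ t])
    show "continuous_on {0..e} (avg K)"
      by (rule continuous_on_subset[OF continuous_on_avg]) (use e in auto)
  qed (rule avg_second_difference, use e in auto)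
  then show ?thesis by simp
qed

subsection \<open>First-order expansion at the circle\<close>

definition dmat :: "complex \<Rightarrow> complex^'s^'s" where
  "dmat z = (\<chi> i j. deriv (\<lambda>z. \<Phi> z $ i $ j) z)"

definition logd :: "real \<Rightarrow> complex^'s^'s" where
  "logd x = adj (\<Phi> (of_real x)) ** dmat (of_real x)"

text \<open>The derivative in the imaginary direction: \<Phi> (x + i e) equals \<Phi> (x) (1 + e
  \<open>herm x\<close>) up to O(e^2). The factor i turns the skew-Hermitian logarithmic derivative
  into a Hermitian matrix.\<close>

definition herm :: "real \<Rightarrow> complex^'s^'s" where
  "herm x = (\<chi> i j. \<i> * logd x $ i $ j)"

lemma entry_deriv:
  assumes "\<bar>Im z\<bar> < \<delta>"
  shows "((\<lambda>z. \<Phi> z $ i $ j) has_field_derivative dmat z $ i $ j) (at z)"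
  using holomorphic_derivI[OF holo strip_open] assms by (simp add: dmat_def)

lemma dmat_holo: "(\<lambda>z. dmat z $ i $ j) holomorphic_on strip"
  unfolding dmat_def by (simp add: holomorphic_deriv[OF holo strip_open])

lemma entry_vector_deriv:
  "((\<lambda>x. \<Phi> (of_real x) $ i $ j) has_vector_derivative dmat (of_real x) $ i $ j) (at x)"
  using has_vector_derivative_real_field[OF entry_deriv[of "of_real x" i j]] \<delta>_pos by simp

text \<open>Differentiates the relation of unitarity along the real axis, the only place where it
  holds.\<close>

lemma logd_skew: "adj (logd x) = - logd x"
proof -
  have "cnj (logd x $ j $ i) + logd x $ i $ j = 0" for i j
  proof -
    let ?d = "(\<Sum>l\<in>UNIV. cnj (\<Phi> (of_real x) $ l $ i) * dmat (of_real x) $ l $ j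
         + cnj (dmat (of_real x) $ l $ i) * \<Phi> (of_real x) $ l $ j)"
    have "((\<lambda>t. \<Sum>l\<in>UNIV. cnj (\<Phi> (of_real t) $ l $ i) * \<Phi> (of_real t) $ l $ j) has_vector_derivative
      ?d) (at x)"
      by (intro has_vector_derivative_sum has_vector_derivative_mult has_vector_derivative_cnj entry_vector_deriv)
    moreover have "(\<Sum>l\<in>UNIV. cnj (\<Phi> (of_real t) $ l $ i) * \<Phi> (of_real t) $ l $ j) = mat 1 $ i $ j" for t
      using unitary_left[OF unit[of t]] by (metis (no_types, lifting) adj_nth matrix_mult_nth sum.cong)
    ultimately have "((\<lambda>t. mat 1 $ i $ j :: complex) has_vector_derivative
      ?d) (at x)"
      by simp
    then have "?d = 0"
      using has_vector_derivative_const by (rule vector_derivative_unique_at)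
    then show ?thesis
      unfolding logd_def matrix_mult_nth by (simp add: sum.distrib mult.commute add.commute)
  qed
  then show ?thesis
    by (simp add: vec_eq_iff add_eq_0_iff2)
qed

lemma herm_hermitian: "adj (herm x) = herm x"
proof -
  have "cnj (logd x $ j $ i) = - logd x $ i $ j" for i j
    using logd_skew[of x] by (metis adj_nth vector_uminus_component)
  then show ?thesis by (simp add: vec_eq_iff herm_def)
qed

lemma continuous_on_herm: "continuous_on S herm"
proof (rule continuous_on_matrixI)
  fix i j
  have r: "continuous_on S (\<lambda>x. f (complex_of_real x))" if "continuous_on strip f" for f :: "complex \<Rightarrow> complex"
    by (rule continuous_on_compose2[OF that]) (use \<delta>_pos in \<open>auto intro!: continuous_intros\<close>)
  show "continuous_on S (\<lambda>x. herm x $ i $ j)"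
    unfolding herm_def logd_def vec_lambda_beta matrix_mult_nth adj_nth
    by (intro continuous_intros r[OF continuous_on_entry] r[OF holomorphic_on_imp_continuous_on[OF dmat_holo]])
qed

lemma continuous_on_ky_fan_herm: "continuous_on S (\<lambda>x. ky_fan K (herm x))"
proof -
  have "continuous_on UNIV (ky_fan K)"
    unfolding continuous_on_def
  proof
    fix H :: "complex^'s^'s"
    have "((\<lambda>G. ky_fan K G - ky_fan K H) \<longlongrightarrow> 0) (at H within UNIV)"
    proof (rule Lim_null_comparison)
      show "eventually (\<lambda>G. norm (ky_fan K G - ky_fan K H) \<le> real CARD('s) * norm (G - H)) (at H within UNIV)"
        by (rule always_eventually) (simp add: ky_fan_lipschitz)
      have "((\<lambda>G. real CARD('s) * norm (G - H)) \<longlongrightarrow> real CARD('s) * norm (H - H)) (at H within UNIV)"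
        by (intro tendsto_intros)
      then show "((\<lambda>G. real CARD('s) * norm (G - H)) \<longlongrightarrow> 0) (at H within UNIV)" by simp
    qed
    then show "(ky_fan K \<longlongrightarrow> ky_fan K H) (at H within UNIV)"
      by (rule LIM_zero_cancel)
  qed
  then show ?thesis
    by (rule continuous_on_compose2[OF _ continuous_on_herm]) auto
qed

abbreviation remainder :: "real \<Rightarrow> real \<Rightarrow> complex^'s^'s" where
  "remainder x e \<equiv> adj (\<Phi> (of_real x)) ** \<Phi> (Complex x e) - (mat 1 + e *\<^sub>R herm x)"

text \<open>Entrywise Taylor expansion from x to x + i e, with second derivatives bounded on a
  compact rectangle. Multiplication by the unitary adjoint then costs only a factor depending on the
  size.\<close>

lemma taylor_uniform:
  "\<exists>B\<ge>0. \<forall>x\<in>{0..1}. \<forall>e\<in>{0..\<delta>/2}. norm (remainder x e) \<le> B * e\<^sup>2"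
proof -
  define R where "R = cbox (Complex 0 0) (Complex 1 (\<delta>/2))"
  have R: "z \<in> R \<longleftrightarrow> 0 \<le> Re z \<and> Re z \<le> 1 \<and> 0 \<le> Im z \<and> Im z \<le> \<delta> / 2" for z
    by (auto simp: R_def in_cbox_complex_iff)
  have Rs: "R \<subseteq> strip" using \<delta>_pos by (auto simp: R)
  have "\<exists>b. \<forall>z\<in>R. norm (deriv (\<lambda>z. dmat z $ i $ j) z) \<le> b" for i j
  proof -
    have "continuous_on R (deriv (\<lambda>z. dmat z $ i $ j))"
      using holomorphic_on_imp_continuous_on[OF holomorphic_deriv[OF dmat_holo strip_open]] Rs
      by (rule continuous_on_subset)
    then have "compact (deriv (\<lambda>z. dmat z $ i $ j) ` R)"
      by (rule compact_continuous_image) (simp add: R_def)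
    then show ?thesis
      using compact_imp_bounded bounded_iff by (metis (no_types, lifting) imageI)
  qed
  then obtain b where b: "\<And>i j z. z \<in> R \<Longrightarrow> norm (deriv (\<lambda>z. dmat z $ i $ j) z) \<le> b i j"
    by metis
  define b' where "b' = (\<Sum>i\<in>UNIV. \<Sum>j\<in>UNIV. b i j)"
  have b0: "0 \<le> b i j" for i j
  proof -
    have "0 \<in> R" using \<delta>_pos by (simp add: R)
    then show ?thesis using b[of 0 i j] norm_ge_zero order.trans by blast
  qed
  have T: "norm (\<Phi> (Complex x e) $ i $ j - (\<Phi> (of_real x) $ i $ j + dmat (of_real x) $ i $ j * (\<i> * of_real e))) \<le> b i j * e\<^sup>2"
    if x: "x \<in> {0..1}" and e: "e \<in> {0..\<delta>/2}" for x e i j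
  proof -
    \<comment> \<open>The entry and its first two derivatives, as the sequence that the Taylor
      theorem expects.\<close>
    define f where "f n = (case n of 0 \<Rightarrow> (\<lambda>z. \<Phi> z $ i $ j) | Suc 0 \<Rightarrow> (\<lambda>z. dmat z $ i $ j) | _ \<Rightarrow> deriv (\<lambda>z. dmat z $ i $ j))" for n :: nat
    have "norm (f 0 (Complex x e) - (\<Sum>n\<le>1. f n (of_real x) * (Complex x e - of_real x) ^ n / fact n))
        \<le> b i j * norm (Complex x e - of_real x) ^ Suc 1 / fact 1"
    proof (rule complex_Taylor[of R])
      show "convex R" by (simp add: R_def)
      show "(f n has_field_derivative f (Suc n) z) (at z within R)" if z: "z \<in> R" and n: "n \<le> 1" for n z
      proof -
        have zs: "z \<in> strip" using z Rs by blast
        consider "n = 0" | "n = 1" using n by linarith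
        then have "(f n has_field_derivative f (Suc n) z) (at z)"
        proof cases
          case 1
          then show ?thesis using entry_deriv[of z i j] zs by (simp add: f_def)
        next
          case 2
          then show ?thesis using holomorphic_derivI[OF dmat_holo strip_open zs] by (simp add: f_def)
        qed
        then show ?thesis by (rule has_field_derivative_at_within)
      qed
      show "norm (f (Suc 1) z) \<le> b i j" if "z \<in> R" for z
        using b[OF that] by (simp add: f_def)
    qed (use x e in \<open>auto simp: R\<close>)
    moreover have "Complex x e - of_real x = \<i> * of_real e" by (simp add: complex_eq_iff)
    ultimately show ?thesis
      using e by (simp add: f_def norm_mult power2_eq_square)
  qed
  have "norm (remainder x e) \<le> (real CARD('s) * real CARD('s) * b') * e\<^sup>2"
    if x: "x \<in> {0..1}" and e: "e \<in> {0..\<delta>/2}" for x e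
  proof -
    define U where "U = adj (\<Phi> (of_real x))"
    have U: "unitary U" by (simp add: U_def unit)
    define E where "E = (\<chi> i j. \<Phi> (Complex x e) $ i $ j - (\<Phi> (of_real x) $ i $ j + dmat (of_real x) $ i $ j * (\<i> * of_real e)))"
    have "norm E \<le> (\<Sum>i\<in>UNIV. \<Sum>j\<in>UNIV. b i j * e\<^sup>2)"
      by (rule order.trans[OF norm_matrix_le_sum]) (intro sum_mono, simp add: E_def T[OF x e])
    then have E: "norm E \<le> b' * e\<^sup>2" by (simp add: b'_def sum_distrib_right)
    have "U ** \<Phi> (Complex x e) - (mat 1 + e *\<^sub>R herm x) = U ** E"
    proof -
      have "(U ** E) $ i $ j = (U ** \<Phi> (Complex x e)) $ i $ j - ((U ** \<Phi> (of_real x)) $ i $ j + (U ** dmat (of_real x)) $ i $ j * (\<i> * of_real e))" for i j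
        unfolding matrix_mult_nth E_def vec_lambda_beta
        by (simp add: right_diff_distrib distrib_left sum_subtractf sum.distrib sum_distrib_right mult.assoc)
      moreover have "U ** \<Phi> (of_real x) = mat 1" using unitary_left[OF unit[of x]] by (simp add: U_def)
      ultimately show ?thesis
        by (simp add: vec_eq_iff herm_def logd_def U_def[symmetric]) (simp add: scaleR_conv_of_real mult_ac)
    qed
    moreover have "norm (U ** E) \<le> (\<Sum>i\<in>(UNIV::'s set). \<Sum>j\<in>(UNIV::'s set). norm E)"
    proof (rule order.trans[OF norm_matrix_le_sum], intro sum_mono)
      fix i j
      have "norm_bounded (1 * norm E) (U ** E)"
        by (intro norm_bounded_mult norm_bounded_unitary U norm_bounded_norm) simp
      then show "norm ((U ** E) $ i $ j) \<le> norm E"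
        using norm_bounded_entry by fastforce
    qed
    ultimately have "norm (U ** \<Phi> (Complex x e) - (mat 1 + e *\<^sub>R herm x)) \<le> real CARD('s) * real CARD('s) * norm E"
      by simp
    also have "\<dots> \<le> real CARD('s) * real CARD('s) * (b' * e\<^sup>2)"
      using E by (intro mult_left_mono) auto
    finally show ?thesis by (simp add: U_def mult.assoc)
  qed
  moreover have "0 \<le> real CARD('s) * real CARD('s) * b'"
    unfolding b'_def using b0 by (simp add: sum_nonneg)
  ultimately show ?thesis by blast
qed

abbreviation herm_avg :: "nat \<Rightarrow> real" where
  "herm_avg k \<equiv> integral {0..1} (\<lambda>x. ky_fan (leading k) (herm x))"

text \<open>Identifies \<open>herm_avg k\<close> as the right derivative of the circle average at 0.
  Left multiplication by the unitary adjoint of \<Phi> (x) does not change \<open>lnorm\<close>, so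
  the expansion at the identity applies at each x.\<close>

lemma avg_expansion:
  "\<exists>C e0. 0 < e0 \<and> (\<forall>e. 0 < e \<longrightarrow> e < e0 \<longrightarrow>
     \<bar>avg (leading k) e - e * herm_avg k\<bar> \<le> C * e\<^sup>2)"
proof -
  obtain B where B: "0 \<le> B" "\<And>x e. x \<in> {0..1} \<Longrightarrow> e \<in> {0..\<delta>/2} \<Longrightarrow>
      norm (remainder x e) \<le> B * e\<^sup>2"
    using taylor_uniform by blast
  have "compact (herm ` {0..1})"
    by (intro compact_continuous_image continuous_on_herm) simp
  then obtain b where b: "\<And>x. x \<in> {0..1} \<Longrightarrow> norm (herm x) \<le> b"
    using compact_imp_bounded bounded_iff by (metis (no_types, lifting) imageI)
  have b0: "0 \<le> b" using order.trans[OF norm_ge_zero b[of 0]] by simp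
  define C where "C = 4 * real CARD('s) * B + 2 * real CARD('s) * b\<^sup>2"
  \<comment> \<open>The bounds serve in turn: the Taylor range, e^2 \<le> e,
    \<open>e * b \<le> 1/2\<close>, and \<open>B * e\<close> at most 1/4, so that the remainder
    meets the conditions of \<open>ln_ext_norm_expansion\<close>.\<close>
  define e0 where "e0 = min (min (\<delta> / 2) 1) (min (1 / (2 * (b + 1))) (1 / (4 * (B + 1))))"
  have e0: "0 < e0" using \<delta>_pos B(1) b0 by (simp add: e0_def)
  have "\<bar>avg (leading k) e - e * herm_avg k\<bar> \<le> C * e\<^sup>2" if e: "0 < e" "e < e0" for e
  proof -
    have e1: "e < \<delta>/2" "e < 1" "e < 1 / (2 * (b + 1))" "e < 1 / (4 * (B + 1))" using e by (auto simp: e0_def)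
    have "e * (2 * (b + 1)) < 1" using e1(3) b0 by (simp add: field_simps)
    then have eb: "e * b \<le> 1/2" using e by (simp add: algebra_simps)
    have eB': "e * (4 * (B + 1)) < 1" using e1(4) B(1) by (simp add: field_simps)
    have "e * e \<le> e * 1" using e e1(2) by (intro mult_left_mono) auto
    then have "B * (e * e) \<le> B * e" using B(1) by (intro mult_left_mono) auto
    then have eB: "B * e\<^sup>2 \<le> 1/4" using eB' e by (simp add: power2_eq_square algebra_simps)
    have pt: "\<bar>lnorm (leading k) (Complex x e) - e * ky_fan (leading k) (herm x)\<bar> \<le> C * e\<^sup>2" if x: "x \<in> {0..1}" for x
    proof -
      have u: "unitary (adj (\<Phi> (of_real x)))" by (simp add: unit)
      have "\<bar>ln (ext_norm (leading k) (adj (\<Phi> (of_real x)) ** \<Phi> (Complex x e))) - e * ky_fan (leading k) (herm x)\<bar>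
          \<le> 4 * real CARD('s) * (B * e\<^sup>2) + 2 * real CARD('s) * (e * b)\<^sup>2"
        by (rule ln_ext_norm_expansion[OF herm_hermitian b[OF x] _ eb B(2)[OF x] eB]) (use e e1 in auto)
      then show ?thesis
        unfolding ext_norm_unitary_left[OF u] lnorm_def by (simp add: C_def power_mult_distrib algebra_simps)
    qed
    have e\<delta>: "\<bar>e\<bar> < \<delta>" using e e1 \<delta>_pos by simp
    have i1: "(\<lambda>x. lnorm (leading k) (Complex x e)) integrable_on {0..1}"
      using lnorm_integrable[OF e\<delta>, of _ 0] by simp
    have i2: "(\<lambda>x. e * ky_fan (leading k) (herm x)) integrable_on {0..1}"
      by (intro integrable_continuous_real continuous_intros continuous_on_ky_fan_herm)
    have "avg (leading k) e - e * herm_avg k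
        = integral {0..1} (\<lambda>x. lnorm (leading k) (Complex x e) - e * ky_fan (leading k) (herm x))"
      unfolding avg_def by (simp add: Henstock_Kurzweil_Integration.integral_diff[OF i1 i2])
    also have "norm \<dots> \<le> C * e\<^sup>2 * (1 - 0)"
    proof (rule integral_bound)
      show "continuous_on {0..1} (\<lambda>x. lnorm (leading k) (Complex x e) - e * ky_fan (leading k) (herm x))"
        by (intro continuous_intros continuous_on_ky_fan_herm continuous_on_lnorm_line e\<delta>)
    qed (use pt in auto)
    finally show ?thesis by simp
  qed
  with e0 show ?thesis by blast
qed

text \<open>Slopes from the origin do not decrease and tend to \<open>herm_avg k\<close> at 0. The
  bound has no error term and holds on the whole upper half of the strip, which is why it survives
  the limit over iterates.\<close>

lemma avg_ge:
  assumes e: "0 < e" "e < \<delta>"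
  shows "e * herm_avg k \<le> avg (leading k) e"
proof (rule ccontr)
  let ?I = "herm_avg k"
  assume "\<not> ?thesis"
  then have gap: "0 < ?I - avg (leading k) e / e" using e by (simp add: field_simps)
  obtain C e0 where C: "0 < e0" "\<And>e. 0 < e \<Longrightarrow> e < e0 \<Longrightarrow> \<bar>avg (leading k) e - e * ?I\<bar> \<le> C * e\<^sup>2"
    using avg_expansion by blast
  \<comment> \<open>At this r the expansion error in the slope is at most half of the supposed
    gap.\<close>
  define r where "r = min (min (e0 / 2) e) ((?I - avg (leading k) e / e) / (2 * (\<bar>C\<bar> + 1)))"
  have r: "0 < r" "r < e0" "r \<le> e" "r \<le> (?I - avg (leading k) e / e) / (2 * (\<bar>C\<bar> + 1))"
  proof -
    have "0 < (?I - avg (leading k) e / e) / (2 * (\<bar>C\<bar> + 1))" using gap by (intro divide_pos_pos) auto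
    then show "0 < r" using C(1) e by (simp add: r_def)
    have "r \<le> e0 / 2" "r \<le> e" "r \<le> (?I - avg (leading k) e / e) / (2 * (\<bar>C\<bar> + 1))"
      unfolding r_def by linarith+
    then show "r < e0" "r \<le> e" "r \<le> (?I - avg (leading k) e / e) / (2 * (\<bar>C\<bar> + 1))"
      using C(1) by auto
  qed
  have "avg (leading k) ((r / e) * e) \<le> (r / e) * avg (leading k) e"
    by (rule avg_star_convex[OF e]) (use r e in auto)
  then have "avg (leading k) r \<le> r * (avg (leading k) e / e)" using e by simp
  moreover have "r * ?I - C * r\<^sup>2 \<le> avg (leading k) r"
    using C(2)[OF r(1,2)] by (simp add: abs_le_iff)
  ultimately have "r * (?I - avg (leading k) e / e) \<le> r * (C * r)"
    by (simp add: algebra_simps power2_eq_square)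
  then have "?I - avg (leading k) e / e \<le> C * r" using r(1) by simp
  also have "\<dots> \<le> (\<bar>C\<bar> + 1) * r" using r(1) by (intro mult_right_mono) auto
  also have "\<dots> \<le> (?I - avg (leading k) e / e) / 2" using r(4) by (simp add: field_simps)
  finally show False using gap by simp
qed

end

subsection \<open>Subadditive sequences\<close>

text \<open>The limit is the infimum of the quotients, so it lies below every single one of them;
  this second statement yields the upper bound on the exponents.\<close>

lemma fekete:
  fixes a :: "nat \<Rightarrow> real"
  assumes sub: "\<And>m n. a (m + n) \<le> a m + a n" and lb: "\<And>n. 1 \<le> n \<Longrightarrow> c \<le> a n / real n"
  shows "\<exists>L. (\<lambda>n. a n / real n) \<longlonglongrightarrow> L \<and> (\<forall>n\<ge>1. L \<le> a n / real n)"
proof -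
  let ?S = "(\<lambda>n. a n / real n) ` {1..}"
  define L where "L = Inf ?S"
  have bdd: "bdd_below ?S" using lb by (intro bdd_belowI[of _ c]) auto
  have L: "L \<le> a n / real n" if "1 \<le> n" for n
    unfolding L_def using that by (intro cInf_lower bdd) auto
  have "(\<lambda>n. a n / real n) \<longlonglongrightarrow> L"
  proof (rule LIMSEQ_I)
    fix e :: real assume e: "0 < e"
    have "\<exists>x\<in>?S. x < L + e / 2"
      by (rule cInf_lessD) (use e in \<open>auto simp: L_def\<close>)
    then obtain m where m: "1 \<le> m" "a m / real m < L + e / 2" by auto
    define b where "b = a m / real m"
    have am: "a m = b * real m" using m(1) by (simp add: b_def)
    \<comment> \<open>Bounds, uniformly in n, what division by m leaves over: the value at the
      remainder and the defect of replacing q m by n.\<close>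
    define M where "M = (\<Sum>r<m. \<bar>a r\<bar>) + real m * \<bar>b\<bar>"
    have mult: "a (q * m + r) \<le> real q * a m + a r" for q r
    proof (induction q)
      case (Suc q)
      have "a (Suc q * m + r) = a (m + (q * m + r))" by (simp add: algebra_simps)
      also have "\<dots> \<le> a m + a (q * m + r)" by (rule sub)
      finally show ?case using Suc by (simp add: algebra_simps)
    qed simp
    have up: "a n \<le> real n * b + M" for n
    proof -
      define q r where "q = n div m" and "r = n mod m"
      have n: "n = q * m + r" by (simp add: q_def r_def)
      have r: "r < m" using m(1) by (simp add: r_def)
      have "a n \<le> real q * (b * real m) + a r" using mult[of q r] unfolding n am .
      also have "\<dots> = real n * b - real r * b + a r" by (simp add: n algebra_simps)
      also have "- (real r * b) \<le> real m * \<bar>b\<bar>"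
      proof -
        have "- (real r * b) \<le> real r * \<bar>b\<bar>" by (simp add: abs_if)
        also have "\<dots> \<le> real m * \<bar>b\<bar>" using r by (intro mult_right_mono) auto
        finally show ?thesis .
      qed
      then have "real n * b - real r * b + a r \<le> real n * b + real m * \<bar>b\<bar> + a r" by simp
      also have "a r \<le> (\<Sum>r<m. \<bar>a r\<bar>)"
        using member_le_sum[of r "{..<m}" "\<lambda>r. \<bar>a r\<bar>"] r by simp
      finally show ?thesis by (simp add: M_def)
    qed
    obtain N where N: "2 * M / e < real N" using reals_Archimedean2 by blast
    show "\<exists>no. \<forall>n\<ge>no. norm (a n / real n - L) < e"
    proof (intro exI allI impI)
      fix n assume n: "max 1 N \<le> n"
      then have n1: "1 \<le> n" by simp
      have "2 * M / e < real n" using N n by simp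
      then have "M / real n < e / 2" using e n1 by (simp add: field_simps)
      moreover have "a n / real n \<le> b + M / real n"
        using up[of n] n1 by (simp add: field_simps)
      ultimately have "a n / real n < L + e" using m(2)[folded b_def] by linarith
      then show "norm (a n / real n - L) < e" using L[OF n1] e by simp
    qed
  qed
  with L show ?thesis by blast
qed

subsection \<open>Iterates\<close>

text \<open>The rotation is real, so the height \<open>Im z\<close> is constant along an orbit and
  the cocycle over a horizontal line is a function of the single variable z. Its holomorphy is read
  off from \<open>iterate_Suc\<close>.\<close>

definition iterate :: "real \<Rightarrow> (complex \<Rightarrow> complex^'s^'s) \<Rightarrow> nat \<Rightarrow> complex \<Rightarrow> complex^'s^'s" where
  "iterate \<alpha> F n z = cocycle_iterate \<alpha> (\<lambda>x. F (Complex x (Im z))) n (Re z)"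

lemma iterate_0 [simp]: "iterate \<alpha> F 0 z = mat 1"
  by (simp add: iterate_def)

lemma iterate_Suc: "iterate \<alpha> F (Suc n) z = F (z + of_real (real n * \<alpha>)) ** iterate \<alpha> F n z"
proof -
  have "Complex (Re z + real n * \<alpha>) (Im z) = z + of_real (real n * \<alpha>)" by (simp add: complex_eq_iff)
  then show ?thesis by (simp add: iterate_def)
qed

lemma iterate_add: "iterate \<alpha> F (m + n) z = iterate \<alpha> F m (z + of_real (real n * \<alpha>)) ** iterate \<alpha> F n z"
proof (induction m)
  case (Suc m)
  have "z + of_real (real (m + n) * \<alpha>) = (z + of_real (real n * \<alpha>)) + of_real (real m * \<alpha>)"
    by (simp add: algebra_simps)
  then show ?case using Suc by (simp only: add_Suc iterate_Suc matrix_mul_assoc)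
qed simp

text \<open>Real translations preserve the strip, so every iterate keeps the same width
  \<delta>.\<close>

lemma strip_matrix_iterate:
  fixes F :: "complex \<Rightarrow> complex^'s^'s"
  assumes "strip_matrix F \<delta>"
  shows "strip_matrix (iterate \<alpha> F n) \<delta>"
proof -
  interpret F: strip_matrix F \<delta> by fact
  show ?thesis
  proof (induction n)
    case 0
    show ?case
    proof
      show "(\<lambda>z. iterate \<alpha> F 0 z $ i $ j) holomorphic_on F.strip" for i j
        by simp
    qed (use F.\<delta>_pos in auto)
  next
    case (Suc n)
    then interpret G: strip_matrix "iterate \<alpha> F n" \<delta> .
    let ?t = "complex_of_real (real n * \<alpha>)"
    show ?case
    proof
      show "(\<lambda>z. iterate \<alpha> F (Suc n) z $ i $ j) holomorphic_on F.strip" for i j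
      proof -
        have "(\<lambda>z. F (z + ?t) $ k $ l) holomorphic_on F.strip" for k l
        proof -
          have "((\<lambda>z. F z $ k $ l) \<circ> (\<lambda>z. z + ?t)) holomorphic_on F.strip"
            by (rule holomorphic_on_compose_gen[OF _ F.holo]) (auto intro!: holomorphic_intros)
          then show ?thesis by (simp add: o_def)
        qed
        then show ?thesis
          unfolding iterate_Suc matrix_mult_nth by (intro holomorphic_intros G.holo)
      qed
      show "iterate \<alpha> F (Suc n) (z + 1) = iterate \<alpha> F (Suc n) z" if "\<bar>Im z\<bar> < \<delta>" for z
      proof -
        have "F (z + 1 + ?t) = F ((z + ?t) + 1)" by (simp add: algebra_simps)
        also have "\<dots> = F (z + ?t)" using that by (intro F.per) simp
        finally show ?thesis using G.per[OF that] by (simp add: iterate_Suc)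
      qed
      show "det (iterate \<alpha> F (Suc n) z) = 1" if "\<bar>Im z\<bar> < \<delta>" for z
        using F.det1[of "z + ?t"] G.det1[OF that] that by (simp add: iterate_Suc det_mul)
      show "unitary (iterate \<alpha> F (Suc n) (complex_of_real x))" for x
        using F.unit[of "x + real n * \<alpha>"] G.unit[of x] by (simp add: iterate_Suc unitary_mult)
    qed (rule F.\<delta>_pos)
  qed
qed

text \<open>The cocycle identity and \<open>ext_norm_mult\<close> give a pointwise inequality with a
  shifted argument; the circle average absorbs the shift.\<close>

lemma avg_iterate_subadditive:
  fixes F :: "complex \<Rightarrow> complex^'s^'s"
  assumes F: "strip_matrix F \<delta>" and y: "\<bar>y\<bar> < \<delta>"
  shows "strip_matrix.avg (iterate \<alpha> F (m + n)) K y \<le> strip_matrix.avg (iterate \<alpha> F m) K y + strip_matrix.avg (iterate \<alpha> F n) K y"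
proof -
  interpret A: strip_matrix "iterate \<alpha> F (m + n)" \<delta> by (rule strip_matrix_iterate[OF F])
  interpret B: strip_matrix "iterate \<alpha> F m" \<delta> by (rule strip_matrix_iterate[OF F])
  interpret C: strip_matrix "iterate \<alpha> F n" \<delta> by (rule strip_matrix_iterate[OF F])
  let ?t = "real n * \<alpha>"
  have pt: "A.lnorm K (Complex x y) \<le> B.lnorm K (Complex (x + ?t) y) + C.lnorm K (Complex x y)" for x
  proof -
    have eq: "Complex x y + of_real ?t = Complex (x + ?t) y" by (simp add: complex_eq_iff)
    obtain NA NB NC where N: "iterate \<alpha> F (m + n) (Complex x y) ** NA = mat 1"
        "iterate \<alpha> F m (Complex (x + ?t) y) ** NB = mat 1" "iterate \<alpha> F n (Complex x y) ** NC = mat 1"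
      using A.right_inverse[of "Complex x y"] B.right_inverse[of "Complex (x + ?t) y"] C.right_inverse[of "Complex x y"] y
      by (metis complex.sel(2))
    have "ln (ext_norm K (iterate \<alpha> F (m + n) (Complex x y)))
        \<le> ln (ext_norm K (iterate \<alpha> F m (Complex (x + ?t) y)) * ext_norm K (iterate \<alpha> F n (Complex x y)))"
      using ext_norm_pos[OF N(1), of K] ext_norm_mult[of K "iterate \<alpha> F m (Complex (x + ?t) y)" "iterate \<alpha> F n (Complex x y)"]
      unfolding iterate_add eq by (intro ln_mono) auto
    then show ?thesis
      using ext_norm_pos[OF N(2), of K] ext_norm_pos[OF N(3), of K]
      by (simp add: A.lnorm_def B.lnorm_def C.lnorm_def ln_mult)
  qed
  have iA: "((\<lambda>x. A.lnorm K (Complex x y)) has_integral A.avg K y) {0..1}"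
    using integrable_integral[OF A.lnorm_integrable[OF y, of K 0]] by (simp add: A.avg_def)
  have iC: "((\<lambda>x. C.lnorm K (Complex x y)) has_integral C.avg K y) {0..1}"
    using integrable_integral[OF C.lnorm_integrable[OF y, of K 0]] by (simp add: C.avg_def)
  have iB: "((\<lambda>x. B.lnorm K (Complex (x + ?t) y)) has_integral B.avg K y) {0..1}"
    using integrable_integral[OF B.lnorm_integrable[OF y, of K ?t]] unfolding B.avg_shift[OF y] .
  show ?thesis
    by (rule has_integral_le[OF iA has_integral_add[OF iB iC]]) (use pt in auto)
qed

subsection \<open>The right derivative of the exponents\<close>

abbreviation growth :: "real \<Rightarrow> (complex \<Rightarrow> complex^'s^'s) \<Rightarrow> nat \<Rightarrow> real \<Rightarrow> nat \<Rightarrow> real" where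
  "growth \<alpha> F k e n \<equiv> strip_matrix.avg (iterate \<alpha> F n) (leading k) e / real n"

lemma exponent_sum_right_derivative:
  fixes F :: "complex \<Rightarrow> complex^'s^'s"
  assumes F: "strip_matrix F \<delta>"
    and lim: "(\<lambda>n. integral {0..1} (\<lambda>x. ky_fan (leading k) (strip_matrix.herm (iterate \<alpha> F n) x)) / real n) \<longlonglongrightarrow> \<kappa>"
  shows "\<exists>L. (\<forall>e. 0 < e \<longrightarrow> e < \<delta> \<longrightarrow> (\<lambda>n. growth \<alpha> F k e n) \<longlonglongrightarrow> L e) \<and>
     ((\<lambda>e. L e / e) \<longlongrightarrow> \<kappa>) (at_right 0)"
proof -
  define a where "a n e = strip_matrix.avg (iterate \<alpha> F n) (leading k) e" for n e
  define I where "I n = integral {0..1} (\<lambda>x. ky_fan (leading k) (strip_matrix.herm (iterate \<alpha> F n) x))" for n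
  have G: "strip_matrix (iterate \<alpha> F n) \<delta>" for n by (rule strip_matrix_iterate[OF F])
  have \<delta>: "0 < \<delta>" using F by (rule strip_matrix.\<delta>_pos)
  have ge: "e * I n \<le> a n e" if "0 < e" "e < \<delta>" for n e
    unfolding a_def I_def by (rule strip_matrix.avg_ge[OF G that])
  have lim': "(\<lambda>n. I n / real n) \<longlonglongrightarrow> \<kappa>" using lim by (simp add: I_def)
  \<comment> \<open>The slopes \<open>I n / real n\<close> converge and are therefore bounded;
    through \<open>ge\<close> this gives the lower bound that Fekete's lemma requires.\<close>
  obtain b where b: "\<And>n. norm (I n / real n) \<le> b"
    using BseqE[OF convergent_imp_Bseq[OF convergentI[OF lim']]] by blast
  define c where "c = - b"
  have c: "c \<le> I n / real n" for n
    using b[of n] by (simp only: c_def real_norm_def abs_le_iff) linarith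
  have "\<exists>L. (\<lambda>n. a n e / real n) \<longlonglongrightarrow> L \<and> (\<forall>n\<ge>1. L \<le> a n e / real n)" if e: "0 < e" "e < \<delta>" for e
  proof (rule fekete)
    show "a (m + n) e \<le> a m e + a n e" for m n
      unfolding a_def by (rule avg_iterate_subadditive[OF F]) (use e in auto)
    show "e * c \<le> a n e / real n" if "1 \<le> n" for n
    proof -
      have "e * c \<le> e * (I n / real n)" using c[of n] e by (intro mult_left_mono) auto
      also have "\<dots> \<le> a n e / real n" using ge[OF e, of n] that by (simp add: divide_right_mono)
      finally show ?thesis .
    qed
  qed
  then obtain L where L: "\<And>e. 0 < e \<Longrightarrow> e < \<delta> \<Longrightarrow> (\<lambda>n. a n e / real n) \<longlonglongrightarrow> L e"
    and L_le: "\<And>e n. 0 < e \<Longrightarrow> e < \<delta> \<Longrightarrow> 1 \<le> n \<Longrightarrow> L e \<le> a n e / real n"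
    by metis
  have L_ge: "\<kappa> \<le> L e / e" if e: "0 < e" "e < \<delta>" for e
  proof -
    have "e * \<kappa> \<le> L e"
    proof (rule LIMSEQ_le)
      show "(\<lambda>n. e * (I n / real n)) \<longlonglongrightarrow> e * \<kappa>" by (intro tendsto_intros lim')
      show "(\<lambda>n. a n e / real n) \<longlonglongrightarrow> L e" by (rule L[OF e])
      show "\<exists>N. \<forall>n\<ge>N. e * (I n / real n) \<le> a n e / real n"
        using ge[OF e] by (auto simp: divide_right_mono)
    qed
    then show ?thesis using e by (simp add: field_simps)
  qed
  have "((\<lambda>e. L e / e) \<longlongrightarrow> \<kappa>) (at_right 0)"
  proof (rule order_tendstoI)
    fix b assume b: "b < \<kappa>"
    have "eventually (\<lambda>e. 0 < e \<and> e < \<delta>) (at_right 0)"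
      using \<delta> eventually_at_right_field by auto
    then show "eventually (\<lambda>e. b < L e / e) (at_right 0)"
      by eventually_elim (use L_ge b in fastforce)
  next
    fix b assume b: "\<kappa> < b"
    then have "eventually (\<lambda>n. I n / real n < b) sequentially"
      using lim' by (simp add: order_tendstoD)
    then obtain N where N: "\<And>n. N \<le> n \<Longrightarrow> I n / real n < b"
      unfolding eventually_sequentially by blast
    define n where "n = Suc N"
    have n: "1 \<le> n" "I n / real n < b" using N[of n] by (auto simp: n_def)
    obtain C e0 where C: "0 < e0" "\<And>e. 0 < e \<Longrightarrow> e < e0 \<Longrightarrow> \<bar>a n e - e * I n\<bar> \<le> C * e\<^sup>2"
      using strip_matrix.avg_expansion[OF G, of n k] unfolding a_def I_def by blast
    \<comment> \<open>With n now fixed, \<open>C\<close> is a constant, and below \<open>e1\<close>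
      the quadratic error no longer fills the gap between \<open>I n / real n\<close> and b.\<close>
    define e1 where "e1 = min (min e0 \<delta>) ((b - I n / real n) / (\<bar>C\<bar> + 1))"
    have "0 < (b - I n / real n) / (\<bar>C\<bar> + 1)" using n(2) by (intro divide_pos_pos) auto
    then have e1: "0 < e1" using C(1) \<delta> by (simp add: e1_def)
    have up: "L e / e < b" if e: "0 < e" "e < e1" for e
    proof -
      have e': "e < e0" "e < \<delta>" "e < (b - I n / real n) / (\<bar>C\<bar> + 1)" using e(2) by (auto simp: e1_def)
      have "L e / e \<le> a n e / real n / e"
        by (rule divide_right_mono[OF L_le[OF e(1) e'(2) n(1)] less_imp_le[OF e(1)]])
      also have "a n e \<le> e * I n + C * e\<^sup>2"
        using C(2)[OF e(1) e'(1)] by (simp add: abs_le_iff)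
      then have "a n e / real n / e \<le> (e * I n + C * e\<^sup>2) / real n / e"
        using e(1) by (intro divide_right_mono) auto
      also have "\<dots> = I n / real n + C * e / real n"
        using e(1) n(1) by (simp add: field_simps power2_eq_square)
      also have "C * e / real n \<le> \<bar>C\<bar> * e"
      proof -
        have "C * e / real n \<le> \<bar>C\<bar> * e / real n"
          using e(1) by (intro divide_right_mono mult_right_mono) auto
        also have "\<dots> \<le> \<bar>C\<bar> * e / 1"
          using e(1) n(1) by (intro divide_left_mono) auto
        finally show ?thesis by simp
      qed
      also have "\<bar>C\<bar> * e \<le> (\<bar>C\<bar> + 1) * e" using e(1) by simp
      also have "(\<bar>C\<bar> + 1) * e < b - I n / real n" using e'(3) by (simp add: field_simps)
      finally show ?thesis by simp
    qed
    show "eventually (\<lambda>e. L e / e < b) (at_right 0)"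
      unfolding eventually_at_right_field using e1 up by auto
  qed
  with L show ?thesis unfolding a_def by blast
qed

section \<open>Lyapunov sums as limits of circle averages\<close>

lemma integral_circle_measure:
  fixes f :: "real \<Rightarrow> real"
  assumes "continuous_on {0..1} f"
  shows "integrable circle_measure f" "(LINT x|circle_measure. f x) = integral {0..1} f"
  using continuous_imp_integrable_real[OF assms] lebesgue_integral_eq_integral[of "{0..1}" f] by auto

text \<open>Each exponent is a \<open>lim\<close> for a single singular value. It equals the
  difference of two consecutive growth rates, whose convergence is assumed, and the sum of these
  differences telescopes from \<open>L 0 = 0\<close>.\<close>

lemma lyapunov_sum_eq_lim:
  fixes B :: "real \<Rightarrow> complex^'s^'s" and F :: "complex \<Rightarrow> complex^'s^'s"
  assumes F: "strip_matrix F \<delta>" and y: "\<bar>y\<bar> < \<delta>" and B: "\<And>x. B x = F (Complex x y)"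
    and lim: "\<And>j. j \<le> CARD('s) \<Longrightarrow> (\<lambda>n. growth \<alpha> F j y n) \<longlonglongrightarrow> L j"
    and k: "k \<le> CARD('s)"
  shows "lyapunov_sum \<alpha> B k = L k"
proof -
  have G: "strip_matrix (iterate \<alpha> F n) \<delta>" for n by (rule strip_matrix_iterate[OF F])
  have it: "cocycle_iterate \<alpha> B n x = iterate \<alpha> F n (Complex x y)" for n x
  proof -
    have "B = (\<lambda>x. F (Complex x y))" using B by auto
    then show ?thesis by (simp add: iterate_def)
  qed
  have L0: "L 0 = 0"
  proof -
    have "strip_matrix.avg (iterate \<alpha> F n) (leading 0) y = 0" for n
      by (simp add: strip_matrix.avg_def[OF G] strip_matrix.lnorm_def[OF G])
    then have "(\<lambda>n. 0) \<longlonglongrightarrow> L 0" using lim[of 0] by simp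
    then show ?thesis by (simp add: LIMSEQ_const_iff)
  qed
  have exponent: "lyapunov_exponent \<alpha> B j = L j - L (j - 1)" if j: "1 \<le> j" "j \<le> CARD('s)" for j
  proof -
    have "1 / real n * (LINT x|circle_measure. ln (singular_value j (cocycle_iterate \<alpha> B n x)))
        = growth \<alpha> F j y n - growth \<alpha> F (j - 1) y n" for n
    proof -
      interpret G: strip_matrix "iterate \<alpha> F n" \<delta> by (rule G)
      have "ln (singular_value j (cocycle_iterate \<alpha> B n x)) = G.lnorm (leading j) (Complex x y) - G.lnorm (leading (j - 1)) (Complex x y)" for x
        unfolding it G.lnorm_def using G.right_inverse[of "Complex x y"] y ln_singular_value[OF _ j]
        by (metis complex.sel(2))
      moreover have "continuous_on {0..1} (\<lambda>x. G.lnorm K (Complex x y))" for K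
        by (rule G.continuous_on_lnorm_line[OF y])
      ultimately have "(LINT x|circle_measure. ln (singular_value j (cocycle_iterate \<alpha> B n x)))
          = G.avg (leading j) y - G.avg (leading (j - 1)) y"
        by (simp add: Bochner_Integration.integral_diff integral_circle_measure G.avg_def)
      then show ?thesis by (simp add: diff_divide_distrib)
    qed
    moreover have "(\<lambda>n. growth \<alpha> F j y n - growth \<alpha> F (j - 1) y n)
        \<longlonglongrightarrow> L j - L (j - 1)"
      by (intro tendsto_diff lim) (use j in auto)
    ultimately show ?thesis
      unfolding lyapunov_exponent_def by (simp add: limI)
  qed
  have "k \<le> CARD('s) \<Longrightarrow> lyapunov_sum \<alpha> B k = L k"
    by (induction k) (auto simp: lyapunov_sum_def L0 exponent)
  then show ?thesis using k .
qed

subsection \<open>The dynamical degree\<close>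

lemma matrix_inv_eqI:
  fixes A B :: "'a::semiring_1^'n^'n"
  assumes "A ** B = mat 1" "B ** A = mat 1"
  shows "matrix_inv A = B"
proof -
  have "A ** matrix_inv A = mat 1 \<and> matrix_inv A ** A = mat 1"
    unfolding matrix_inv_def by (rule someI[of _ B]) (use assms in simp)
  then show ?thesis
    by (metis assms(2) matrix_mul_assoc matrix_mul_lid matrix_mul_rid)
qed

lemma matrix_inv_orthogonal: "orthogonal_matrix A \<Longrightarrow> matrix_inv A = transpose A"
  by (rule matrix_inv_eqI) (auto simp: orthogonal_matrix_def)

lemma matrix_inv_unitary: "unitary P \<Longrightarrow> matrix_inv P = adj P"
  by (rule matrix_inv_eqI) (auto simp: unitary_left unitary_right)

lemma has_vector_derivative_matrixI:
  fixes f :: "real \<Rightarrow> real^'s^'s"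
  assumes "\<And>i j. ((\<lambda>x. f x $ i $ j) has_vector_derivative D $ i $ j) (at x)"
  shows "(f has_vector_derivative D) (at x)"
  unfolding has_vector_derivative_def
proof (subst has_derivative_componentwise_within, intro ballI)
  fix b :: "real^'s^'s" assume "b \<in> Basis"
  then obtain i j where b: "b = axis i (axis j 1)"
    by (auto simp: Basis_vec_def)
  show "((\<lambda>x. f x \<bullet> b) has_derivative (\<lambda>h. (h *\<^sub>R D) \<bullet> b)) (at x)"
    using assms[of i j] by (simp add: b inner_axis has_vector_derivative_def)
qed

definition imag_matrix :: "real^'s^'s \<Rightarrow> complex^'s^'s" where
  "imag_matrix X = (\<chi> i j. \<i> * complex_of_real (X $ i $ j))"

lemma norm_imag_matrix: "norm (imag_matrix X) = norm X"
  by (simp add: norm_vec_def imag_matrix_def norm_mult)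

lemma ky_fan_scaleR:
  assumes "0 < c"
  shows "ky_fan K (c *\<^sub>R H) = c * ky_fan K H"
proof -
  have le: "ky_fan K (c *\<^sub>R H) \<le> c * ky_fan K H" if "0 < c" for c H
  proof (rule ky_fan_least)
    fix P :: "complex^'a^'a" assume P: "unitary P"
    have "(\<Sum>i\<in>K. Re ((adj P ** (c *\<^sub>R H) ** P) $ i $ i)) = c * (\<Sum>i\<in>K. Re ((adj P ** H ** P) $ i $ i))"
      by (simp add: scaleR_matrix_mult sum_distrib_left)
    also have "\<dots> \<le> c * ky_fan K H"
      using ky_fan_upper[OF P, of H K] that by (intro mult_left_mono) auto
    finally show "(\<Sum>i\<in>K. Re ((adj P ** (c *\<^sub>R H) ** P) $ i $ i)) \<le> c * ky_fan K H" .
  qed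
  have "ky_fan K H \<le> (1 / c) * ky_fan K (c *\<^sub>R H)"
    using le[of "1 / c" "c *\<^sub>R H"] assms by simp
  then show ?thesis
    using le[OF assms, of H] assms by (simp add: field_simps)
qed

text \<open>Entrywise conjugation permutes the unitary matrices and keeps the real parts of diagonal
  entries, so it only relabels the competitors.\<close>

lemma ky_fan_cnj: "ky_fan K (map_matrix cnj H) = ky_fan K H"
proof -
  have le: "ky_fan K (map_matrix cnj H) \<le> ky_fan K H" for H :: "complex^'a^'a"
  proof (rule ky_fan_least)
    fix P :: "complex^'a^'a" assume P: "unitary P"
    have mult: "map_matrix cnj (A ** B) = map_matrix cnj A ** map_matrix cnj B" for A B :: "complex^'a^'a"
      by (simp add: vec_eq_iff matrix_mult_nth)
    have adj: "map_matrix cnj (adj A) = adj (map_matrix cnj A)" for A :: "complex^'a^'a"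
      by (simp add: vec_eq_iff)
    have cc: "map_matrix cnj (map_matrix cnj A) = A" for A :: "complex^'a^'a"
      by (simp add: vec_eq_iff)
    have "map_matrix cnj (adj P ** P) = mat 1"
      unfolding unitary_left[OF P] by (simp add: vec_eq_iff mat_def)
    then have P': "unitary (map_matrix cnj P)"
      by (simp add: unitary_def mult adj)
    have "adj P ** map_matrix cnj H ** P
        = map_matrix cnj (adj (map_matrix cnj P) ** H ** map_matrix cnj P)"
      by (simp add: mult adj cc)
    then have "Re ((adj P ** map_matrix cnj H ** P) $ i $ i)
        = Re ((adj (map_matrix cnj P) ** H ** map_matrix cnj P) $ i $ i)" for i
      by simp
    then show "(\<Sum>i\<in>K. Re ((adj P ** map_matrix cnj H ** P) $ i $ i)) \<le> ky_fan K H"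
      using ky_fan_upper[OF P', of H K] by simp
  qed
  have "map_matrix cnj (map_matrix cnj H) = H" by (simp add: vec_eq_iff)
  then show ?thesis using le[of H] le[of "map_matrix cnj H"] by simp
qed

text \<open>
  The eigenvalues of \<open>i D\<close> are the numbers \<open>- 2 \<pi> d\<^sub>j\<close>; since \<open>D\<close> is real, complex conjugation
  turns \<open>i D\<close> into \<open>- i D\<close>, so they agree with the numbers \<open>2 \<pi> d\<^sub>j\<close> up to order.
\<close>

lemma ky_fan_degree:
  fixes D0 :: "real^'s^'s"
  assumes d: "\<And>j k. 1 \<le> j \<Longrightarrow> j \<le> k \<Longrightarrow> k \<le> CARD('s) \<Longrightarrow> d k \<le> d j"
    and Q: "special_unitary Q"
    and D0: "of_real_matrix D0 = Q ** diag_matrix (\<lambda>k. 2 * complex_of_real pi * \<i> * complex_of_real (d k)) ** matrix_inv Q"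
    and P: "rotation_matrix P" and D: "D = P ** D0 ** matrix_inv P" and k: "k \<le> CARD('s)"
  shows "ky_fan (leading k) (imag_matrix D) = 2 * pi * (\<Sum>j = 1..k. d j)"
proof -
  let ?T = "diag_matrix (\<lambda>k. 2 * complex_of_real pi * \<i> * complex_of_real (d k))"
  have Qu: "unitary Q" using Q by (simp add: special_unitary_def unitary_def)
  have Po: "orthogonal_matrix P" using P by (simp add: rotation_matrix_def)
  define W where "W = of_real_matrix P ** Q"
  have W: "unitary W" unfolding W_def by (intro unitary_mult Qu unitary_of_real_matrix Po)
  define l where "l i = 2 * pi * d (coord_number i)" for i :: 's
  have l: "decreasing l"
    unfolding decreasing_def l_def
    using d coord_number_bounds[where 's = 's] by (auto intro!: mult_left_mono)
  have "adj (of_real_matrix P) = of_real_matrix (transpose P)"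
    by (simp add: vec_eq_iff transpose_def)
  then have "of_real_matrix D = W ** ?T ** adj W"
    unfolding D matrix_inv_orthogonal[OF Po] of_real_matrix_mult D0 matrix_inv_unitary[OF Qu] W_def adj_mult
    by (simp add: matrix_mul_assoc)
  also have "?T = diag (\<lambda>i. \<i> * complex_of_real (l i))"
    by (auto simp: vec_eq_iff diag_matrix_def diag_nth l_def)
  finally have D': "of_real_matrix D = W ** diag (\<lambda>i. \<i> * complex_of_real (l i)) ** adj W" .
  have "map_matrix cnj (imag_matrix D) = W ** real_diag l ** adj W"
  proof -
    have "map_matrix cnj (imag_matrix D) $ i $ j = (W ** real_diag l ** adj W) $ i $ j" for i j
    proof -
      have "map_matrix cnj (imag_matrix D) $ i $ j = - \<i> * of_real_matrix D $ i $ j"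
        by (simp add: imag_matrix_def)
      also have "\<dots> = (\<Sum>m\<in>UNIV. - \<i> * (W $ i $ m * (\<i> * complex_of_real (l m)) * adj W $ m $ j))"
        unfolding D' matrix_mult_nth[of "W ** _"] mult_diag_nth by (simp only: sum_distrib_left)
      also have "\<dots> = (\<Sum>m\<in>UNIV. W $ i $ m * complex_of_real (l m) * adj W $ m $ j)"
      proof -
        have "- \<i> * (w * (\<i> * c) * b) = w * c * b" for w c b :: complex
          by (simp add: complex_eq_iff algebra_simps)
        then show ?thesis by (intro sum.cong refl)
      qed
      also have "\<dots> = (W ** real_diag l ** adj W) $ i $ j"
        unfolding matrix_mult_nth[of "W ** _"] mult_diag_nth ..
      finally show ?thesis .
    qed
    then show ?thesis unfolding vec_eq_iff by blast
  qed
  then have "ky_fan (leading k) (imag_matrix D) = (\<Sum>i\<in>leading k. l i)"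
    using ky_fan_cnj[of "leading k" "imag_matrix D"] ky_fan_diagonal[OF W l, of k] by simp
  also have "\<dots> = 2 * pi * (\<Sum>i\<in>(leading k :: 's set). d (coord_number i))"
    by (simp add: l_def sum_distrib_left)
  also have "(\<Sum>i\<in>(leading k :: 's set). d (coord_number i)) = (\<Sum>j = 1..k. d j)"
    by (rule sum.reindex_bij_betw[OF bij_betw_leading[OF k]])
  finally show ?thesis .
qed

lemma cocycle_iterate_of_real:
  "cocycle_iterate \<alpha> (\<lambda>x. of_real_matrix (A x)) n x = of_real_matrix (cocycle_iterate \<alpha> A n x)"
proof (induction n)
  case 0
  show ?case by (simp add: vec_eq_iff mat_def)
qed (simp add: of_real_matrix_mult)

text \<open>Links the complex analysis to the matrices in \<open>degree_field\<close>. On the real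
  axis the entries are real, so their complex derivatives are real and equal the derivatives of the
  real iterate; the adjoint of an orthogonal matrix is its inverse.\<close>

lemma herm_iterate:
  fixes A :: "real \<Rightarrow> real^'s^'s"
  assumes A: "A \<in> analytic_circle_SO" and F: "strip_matrix F \<delta>" and FA: "\<And>x. F (of_real x) = of_real_matrix (A x)"
  shows "strip_matrix.herm (iterate \<alpha> F n) x
    = imag_matrix (matrix_inv (cocycle_iterate \<alpha> A n x) ** vector_derivative (cocycle_iterate \<alpha> A n) (at x))"
proof -
  interpret G: strip_matrix "iterate \<alpha> F n" \<delta> by (rule strip_matrix_iterate[OF F])
  let ?B = "cocycle_iterate \<alpha> A n"
  have GB: "iterate \<alpha> F n (complex_of_real t) = of_real_matrix (?B t)" for t
  proof -
    have "(\<lambda>x. F (Complex x 0)) = (\<lambda>x. of_real_matrix (A x))"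
      using FA by (simp add: complex_of_real_def)
    then show ?thesis by (simp add: iterate_def cocycle_iterate_of_real)
  qed
  have orth: "orthogonal_matrix (?B t)" for t
  proof (induction n)
    case (Suc m)
    have "orthogonal_matrix (A s)" for s using A by (simp add: analytic_circle_SO_def rotation_matrix_def)
    then show ?case using Suc by (simp add: orthogonal_matrix_mul)
  qed (simp add: orthogonal_matrix_id)
  let ?D = "G.dmat (complex_of_real x)"
  have ent: "((\<lambda>t. complex_of_real (?B t $ i $ j)) has_vector_derivative ?D $ i $ j) (at x)" for i j
    using G.entry_vector_deriv[of i j x] by (simp add: GB)
  have re: "((\<lambda>t. ?B t $ i $ j) has_vector_derivative Re (?D $ i $ j)) (at x)" for i j
    using bounded_linear.has_vector_derivative[OF bounded_linear_Re ent[of i j]] by simp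
  have im: "Im (?D $ i $ j) = 0" for i j
    using bounded_linear.has_vector_derivative[OF bounded_linear_Im ent[of i j]]
      vector_derivative_unique_at[OF _ has_vector_derivative_const] by fastforce
  define X where "X = (\<chi> i j. Re (?D $ i $ j))"
  have "(?B has_vector_derivative X) (at x)"
    by (rule has_vector_derivative_matrixI) (simp add: X_def re)
  then have X: "vector_derivative ?B (at x) = X" by (rule vector_derivative_at)
  have DX: "?D = of_real_matrix X"
    using im by (simp add: vec_eq_iff X_def complex_eq_iff)
  have "adj (of_real_matrix (?B x)) = of_real_matrix (transpose (?B x))"
    by (simp add: vec_eq_iff transpose_def)
  then have "G.logd x = of_real_matrix (transpose (?B x) ** X)"
    unfolding G.logd_def GB DX of_real_matrix_mult by simp
  then show ?thesis
    unfolding X matrix_inv_orthogonal[OF orth] by (simp add: G.herm_def imag_matrix_def)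
qed

text \<open>The Lipschitz bound reduces the claim to convergence in L^1, which follows from L^2
  convergence on a space of measure 1.\<close>

lemma integral_ky_fan_tendsto:
  fixes X :: "nat \<Rightarrow> real \<Rightarrow> real^'s^'s" and D :: "real \<Rightarrow> real^'s^'s"
  assumes Xc: "\<And>n. continuous_on {0..1} (X n)"
    and Dm: "D \<in> borel_measurable circle_measure" and D2: "integrable circle_measure (\<lambda>x. (norm (D x))\<^sup>2)"
    and lim: "(\<lambda>n. LINT x|circle_measure. (norm ((1 / real n) *\<^sub>R X n x - D x))\<^sup>2) \<longlonglongrightarrow> 0"
    and ae: "AE x in circle_measure. ky_fan K (imag_matrix (D x)) = \<kappa>"
  shows "(\<lambda>n. integral {0..1} (\<lambda>x. ky_fan K (imag_matrix (X n x))) / real n) \<longlonglongrightarrow> \<kappa>"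
proof -
  define N where "N n x = norm ((1 / real n) *\<^sub>R X n x - D x)" for n x
  define E where "E n = (LINT x|circle_measure. (N n x)\<^sup>2)" for n
  have E_lim: "E \<longlonglongrightarrow> 0" using lim by (simp add: E_def[abs_def] N_def)
  let ?s = "real CARD('s)"
  have Xm: "X n \<in> borel_measurable circle_measure" for n
    by (rule continuous_imp_measurable_on_sets_lebesgue[OF Xc]) simp
  \<comment> \<open>The Bochner integral of a non-integrable function is 0, so the assumed limit
    carries information only together with this fact.\<close>
  have N2: "integrable circle_measure (\<lambda>x. (N n x)\<^sup>2)" for n
  proof (rule Bochner_Integration.integrable_bound)
    have "continuous_on {0..1} (\<lambda>x. (norm ((1 / real n) *\<^sub>R X n x))\<^sup>2)" by (intro continuous_intros Xc)
    then show "integrable circle_measure (\<lambda>x. 2 * (norm ((1 / real n) *\<^sub>R X n x))\<^sup>2 + 2 * (norm (D x))\<^sup>2)"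
      by (intro Bochner_Integration.integrable_add integrable_mult_right D2 integral_circle_measure(1))
    show "(\<lambda>x. (N n x)\<^sup>2) \<in> borel_measurable circle_measure"
      unfolding N_def using Xm Dm by measurable
    have bound: "(norm (a - b))\<^sup>2 \<le> 2 * (norm a)\<^sup>2 + 2 * (norm b)\<^sup>2" for a b :: "real^'s^'s"
    proof -
      have "(norm (a - b))\<^sup>2 \<le> (norm a + norm b)\<^sup>2"
        by (intro power_mono norm_triangle_ineq4) simp
      also have "\<dots> \<le> 2 * (norm a)\<^sup>2 + 2 * (norm b)\<^sup>2"
        using sum_squares_bound[of "norm a" "norm b"] by (simp add: power2_sum)
      finally show ?thesis .
    qed
    show "AE x in circle_measure. norm ((N n x)\<^sup>2) \<le> norm (2 * (norm ((1 / real n) *\<^sub>R X n x))\<^sup>2 + 2 * (norm (D x))\<^sup>2)"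
      unfolding N_def real_norm_def abs_power2
      by (intro AE_I2 order.trans[OF bound] abs_ge_self)
  qed
  have kc: "continuous_on {0..1} (\<lambda>x. ky_fan K (imag_matrix (Y x)))" if Y: "continuous_on {0..1} Y" for Y :: "real \<Rightarrow> real^'s^'s"
  proof -
    have z: "((\<lambda>t. ky_fan K (imag_matrix (Y t)) - ky_fan K (imag_matrix (Y x))) \<longlongrightarrow> 0) (at x within {0..1})" if "x \<in> {0..1}" for x
    proof (rule Lim_null_comparison)
      have "imag_matrix (Y t) - imag_matrix (Y x) = imag_matrix (Y t - Y x)" for t
        by (simp add: vec_eq_iff imag_matrix_def right_diff_distrib)
      then show "eventually (\<lambda>t. norm (ky_fan K (imag_matrix (Y t)) - ky_fan K (imag_matrix (Y x))) \<le> ?s * norm (Y t - Y x)) (at x within {0..1})"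
        using ky_fan_lipschitz[of K "imag_matrix (Y _)" "imag_matrix (Y x)"] by (simp add: norm_imag_matrix)
      have "((\<lambda>t. ?s * norm (Y t - Y x)) \<longlongrightarrow> ?s * norm (Y x - Y x)) (at x within {0..1})"
        using Y that unfolding continuous_on_def by (intro tendsto_intros) blast
      then show "((\<lambda>t. ?s * norm (Y t - Y x)) \<longlongrightarrow> 0) (at x within {0..1})" by simp
    qed
    show ?thesis
      unfolding continuous_on_def
    proof
      fix x :: real assume "x \<in> {0..1}"
      from z[OF this] show "((\<lambda>x. ky_fan K (imag_matrix (Y x))) \<longlongrightarrow> ky_fan K (imag_matrix (Y x))) (at x within {0..1})"
        by (rule LIM_zero_cancel)
    qed
  qed
  have est: "\<bar>integral {0..1} (\<lambda>x. ky_fan K (imag_matrix (X n x))) / real n - \<kappa>\<bar> \<le> ?s * (\<eta> / 2 + E n / (2 * \<eta>))"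
    if n: "1 \<le> n" and \<eta>: "0 < \<eta>" for n \<eta>
  proof -
    let ?f = "\<lambda>x. ky_fan K (imag_matrix ((1 / real n) *\<^sub>R X n x))"
    have sc: "?f x = ky_fan K (imag_matrix (X n x)) / real n" for x
    proof -
      have "imag_matrix ((1 / real n) *\<^sub>R X n x) = (1 / real n) *\<^sub>R imag_matrix (X n x)"
        by (simp add: vec_eq_iff imag_matrix_def) (simp add: scaleR_conv_of_real)
      then show ?thesis using ky_fan_scaleR[of "1 / real n" K "imag_matrix (X n x)"] n by simp
    qed
    have fi: "integrable circle_measure ?f" "(LINT x|circle_measure. ?f x) = integral {0..1} ?f"
      by (intro integral_circle_measure kc continuous_intros Xc)+
    have c1: "integrable circle_measure (\<lambda>x. c :: real)" "(LINT x|circle_measure. c) = c" for c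
      using integral_circle_measure[of "\<lambda>_. c"] by simp_all
    have "integral {0..1} (\<lambda>x. ky_fan K (imag_matrix (X n x))) / real n - \<kappa> = (LINT x|circle_measure. ?f x - \<kappa>)"
    proof -
      have "(LINT x|circle_measure. ?f x - \<kappa>) = integral {0..1} ?f - \<kappa>"
        unfolding Bochner_Integration.integral_diff[OF fi(1) c1(1)] fi(2) c1(2) ..
      then show ?thesis by (simp add: sc)
    qed
    also have "\<bar>\<dots>\<bar> \<le> (LINT x|circle_measure. \<bar>?f x - \<kappa>\<bar>)"
      using integral_norm_bound[of circle_measure "\<lambda>x. ?f x - \<kappa>"] by simp
    also have "\<dots> \<le> (LINT x|circle_measure. ?s * (\<eta> / 2 + (N n x)\<^sup>2 / (2 * \<eta>)))"
    proof (rule integral_mono_AE)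
      show "integrable circle_measure (\<lambda>x. \<bar>?f x - \<kappa>\<bar>)"
        by (intro integrable_abs Bochner_Integration.integrable_diff fi c1)
      show "integrable circle_measure (\<lambda>x. ?s * (\<eta> / 2 + (N n x)\<^sup>2 / (2 * \<eta>)))"
        by (intro integrable_mult_right Bochner_Integration.integrable_add c1 integrable_divide N2)
      show "AE x in circle_measure. \<bar>?f x - \<kappa>\<bar> \<le> ?s * (\<eta> / 2 + (N n x)\<^sup>2 / (2 * \<eta>))"
        using ae
      proof eventually_elim
        case (elim x)
        have "imag_matrix ((1 / real n) *\<^sub>R X n x) - imag_matrix (D x) = imag_matrix ((1 / real n) *\<^sub>R X n x - D x)"
          by (simp add: vec_eq_iff imag_matrix_def right_diff_distrib)
        then have "\<bar>?f x - \<kappa>\<bar> \<le> ?s * N n x"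
          using ky_fan_lipschitz[of K "imag_matrix ((1 / real n) *\<^sub>R X n x)" "imag_matrix (D x)"] elim
          by (simp add: norm_imag_matrix N_def)
        \<comment> \<open>Arithmetic-geometric mean with a free parameter \<eta>, in place of
          Cauchy-Schwarz for integrals: \<eta> is fixed first, then n makes the second term
          small.\<close>
        also have "N n x \<le> \<eta> / 2 + (N n x)\<^sup>2 / (2 * \<eta>)"
        proof -
          have "0 \<le> (N n x - \<eta>)\<^sup>2" by simp
          then have "2 * \<eta> * N n x \<le> \<eta>\<^sup>2 + (N n x)\<^sup>2" by (simp add: power2_diff algebra_simps)
          then show ?thesis using \<eta> by (simp add: field_simps power2_eq_square)
        qed
        finally show ?case by (simp add: mult_left_mono)
      qed
    qed
    also have "\<dots> = ?s * (LINT x|circle_measure. \<eta> / 2 + (N n x)\<^sup>2 / (2 * \<eta>))"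
      by (rule integral_mult_right_zero)
    also have "(LINT x|circle_measure. \<eta> / 2 + (N n x)\<^sup>2 / (2 * \<eta>)) = \<eta> / 2 + E n / (2 * \<eta>)"
      unfolding Bochner_Integration.integral_add[OF c1(1) integrable_divide[OF N2]] c1(2) integral_divide_zero E_def ..
    finally show ?thesis .
  qed
  show ?thesis
  proof (rule LIMSEQ_I)
    fix r :: real assume r: "0 < r"
    \<comment> \<open>Once \<open>E n\<close> is below \<eta>^2, both terms of \<open>est\<close>
      are at most \<eta> / 2 and the total is at most \<open>?s * \<eta>\<close>, which is r /
      2.\<close>
    define \<eta> where "\<eta> = r / (2 * ?s)"
    have \<eta>: "0 < \<eta>" using r by (simp add: \<eta>_def)
    obtain M where M: "\<And>n. M \<le> n \<Longrightarrow> \<bar>E n\<bar> < \<eta>\<^sup>2"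
      using LIMSEQ_D[OF E_lim, of "\<eta>\<^sup>2"] \<eta> by auto
    show "\<exists>no. \<forall>n\<ge>no. norm (integral {0..1} (\<lambda>x. ky_fan K (imag_matrix (X n x))) / real n - \<kappa>) < r"
    proof (intro exI allI impI)
      fix n assume n: "max 1 M \<le> n"
      have "E n / (2 * \<eta>) \<le> \<eta>\<^sup>2 / (2 * \<eta>)"
        using M[of n] n \<eta> by (intro divide_right_mono) auto
      also have "\<dots> = \<eta> / 2" using \<eta> by (simp add: power2_eq_square)
      finally have "?s * (\<eta> / 2 + E n / (2 * \<eta>)) \<le> ?s * \<eta>" by (intro mult_left_mono) auto
      also have "\<dots> < r" using r by (simp add: \<eta>_def)
      finally show "norm (integral {0..1} (\<lambda>x. ky_fan K (imag_matrix (X n x))) / real n - \<kappa>) < r"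
        using est[of n \<eta>] n \<eta> by simp
    qed
  qed
qed

theorem theorem2:
  fixes \<alpha> :: real and A :: "real \<Rightarrow> real^'s^'s" and d :: "nat \<Rightarrow> real"
  assumes "CARD('s) \<ge> 3"
    and "\<alpha> \<notin> \<rat>"
    and "A \<in> analytic_circle_SO"
    and "dynamical_degree_vector \<alpha> A d"
  shows "\<forall>k \<in> {1..CARD('s)}. acceleration \<alpha> A k = d k"
proof -
  define F where "F = complexification A"
  \<comment> \<open>Existence of one extension makes the choice in \<open>complexification\<close>
    meaningful; the width obtained here serves all iterates.\<close>
  have "\<exists>\<delta>>0. strip_extension A \<delta> F"
    unfolding F_def complexification_def by (rule someI_ex[OF exists_strip_extension[OF assms(3)]])
  then obtain \<delta> where \<delta>: "0 < \<delta>" "strip_extension A \<delta> F" by blast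
  have F: "strip_matrix F \<delta>" by (rule strip_matrix_extension[OF assms(3) \<delta>])
  have FA: "F (of_real x) = of_real_matrix (A x)" for x
    using \<delta>(2) by (simp add: strip_extension_def)
  obtain D0 Q D where dd: "\<And>j k. 1 \<le> j \<Longrightarrow> j \<le> k \<Longrightarrow> k \<le> CARD('s) \<Longrightarrow> d k \<le> d j"
    and Q: "special_unitary Q" "of_real_matrix D0 =
       Q ** diag_matrix (\<lambda>k. 2 * complex_of_real pi * \<i> * complex_of_real (d k)) ** matrix_inv Q"
    and D: "degree_field \<alpha> A D"
    and conj: "AE x in circle_measure. \<exists>P. rotation_matrix P \<and> D x = P ** D0 ** matrix_inv P"
    using assms(4) unfolding dynamical_degree_vector_def dynamical_degree_def by blast
  define X where "X n x = matrix_inv (cocycle_iterate \<alpha> A n x) ** vector_derivative (cocycle_iterate \<alpha> A n) (at x)" for n x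
  have herm: "strip_matrix.herm (iterate \<alpha> F n) x = imag_matrix (X n x)" for n x
    unfolding X_def by (rule herm_iterate[OF assms(3) F FA])
  \<comment> \<open>The real entries of \<open>X n\<close> are the imaginary parts of the entries of
    \<open>herm\<close>, whose continuity is known.\<close>
  have Xc: "continuous_on {0..1} (X n)" for n
  proof (rule continuous_on_matrixI)
    fix i j
    have "continuous_on {0..1} (\<lambda>x. Im (strip_matrix.herm (iterate \<alpha> F n) x $ i $ j))"
      by (intro continuous_intros strip_matrix.continuous_on_herm[OF strip_matrix_iterate[OF F]])
    then show "continuous_on {0..1} (\<lambda>x. X n x $ i $ j)"
      by (simp add: herm imag_matrix_def)
  qed
  define S where "S k = (\<Sum>j = 1..k. d j)" for k
  have lim: "(\<lambda>n. integral {0..1} (\<lambda>x. ky_fan (leading k) (strip_matrix.herm (iterate \<alpha> F n) x)) / real n) \<longlonglongrightarrow> 2 * pi * S k"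
    if k: "k \<le> CARD('s)" for k
    unfolding herm
  proof (rule integral_ky_fan_tendsto[OF Xc])
    show "D \<in> borel_measurable circle_measure" "integrable circle_measure (\<lambda>x. (norm (D x))\<^sup>2)"
      "(\<lambda>n. LINT x|circle_measure. (norm ((1 / real n) *\<^sub>R X n x - D x))\<^sup>2) \<longlonglongrightarrow> 0"
      using D unfolding degree_field_def X_def by auto
    show "AE x in circle_measure. ky_fan (leading k) (imag_matrix (D x)) = 2 * pi * S k"
      using conj
    proof eventually_elim
      case (elim x)
      then show ?case
        unfolding S_def using ky_fan_degree[OF dd Q _ _ k] by blast
    qed
  qed
  have "\<forall>k. \<exists>L. k \<le> CARD('s) \<longrightarrow> (\<forall>e. 0 < e \<longrightarrow> e < \<delta> \<longrightarrow> (\<lambda>n. growth \<alpha> F k e n) \<longlonglongrightarrow> L e) \<and>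
     ((\<lambda>e. L e / e) \<longlongrightarrow> 2 * pi * S k) (at_right 0)"
    using exponent_sum_right_derivative[OF F lim] by blast
  from choice[OF this] obtain L where
      L_all: "\<forall>k. k \<le> CARD('s) \<longrightarrow> (\<forall>e. 0 < e \<longrightarrow> e < \<delta> \<longrightarrow> (\<lambda>n. growth \<alpha> F k e n) \<longlonglongrightarrow> L k e) \<and>
        ((\<lambda>e. L k e / e) \<longlongrightarrow> 2 * pi * S k) (at_right 0)" ..
  then have L: "(\<lambda>n. growth \<alpha> F k e n) \<longlonglongrightarrow> L k e"
    if "k \<le> CARD('s)" "0 < e" "e < \<delta>" for k e
    using that by simp
  have L_lim: "((\<lambda>e. L k e / e) \<longlongrightarrow> 2 * pi * S k) (at_right 0)" if "k \<le> CARD('s)" for k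
    using L_all that by simp
  have sum_e: "lyapunov_sum \<alpha> (shifted A e) k = L k e" if k: "k \<le> CARD('s)" and e: "0 < e" "e < \<delta>" for k e
    by (rule lyapunov_sum_eq_lim[OF F _ _ L[OF _ e] k]) (use e in \<open>auto simp: shifted_def F_def\<close>)
  have sum_0: "lyapunov_sum \<alpha> (\<lambda>x. of_real_matrix (A x)) k = 0" if k: "k \<le> CARD('s)" for k
  proof (rule lyapunov_sum_eq_lim[OF F _ _ _ k])
    show "of_real_matrix (A x) = F (Complex x 0)" for x
      using FA[of x] by (simp add: complex_of_real_def)
    show "(\<lambda>n. growth \<alpha> F j 0 n) \<longlonglongrightarrow> 0" for j
      by (simp add: strip_matrix.avg_0[OF strip_matrix_iterate[OF F]])
  qed (use \<delta> in simp)
  have acc: "acceleration_sum \<alpha> A k = S k" if k: "k \<le> CARD('s)" for k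
    unfolding acceleration_sum_def
  proof (rule tendsto_Lim)
    have "((\<lambda>e. 1 / (2 * pi) * (L k e / e)) \<longlongrightarrow> 1 / (2 * pi) * (2 * pi * S k)) (at_right 0)"
      by (intro tendsto_mult tendsto_const L_lim k)
    \<comment> \<open>The two quotients agree for 0 < e < \<delta>, which suffices for a limit from
      the right; at height 0 the Lyapunov sums vanish.\<close>
    moreover have "eventually (\<lambda>e. 1 / (2 * pi * e) * (lyapunov_sum \<alpha> (shifted A e) k - lyapunov_sum \<alpha> (\<lambda>x. of_real_matrix (A x)) k)
        = 1 / (2 * pi) * (L k e / e)) (at_right 0)"
      unfolding eventually_at_right_field using \<delta>(1) sum_e[OF k] sum_0[OF k] by (intro exI[of _ \<delta>]) auto
    ultimately show "((\<lambda>e. 1 / (2 * pi * e) * (lyapunov_sum \<alpha> (shifted A e) k - lyapunov_sum \<alpha> (\<lambda>x. of_real_matrix (A x)) k)) \<longlongrightarrow> S k) (at_right 0)"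
      by (subst tendsto_cong) auto
  qed simp
  show ?thesis
  proof
    fix k assume k: "k \<in> {1..CARD('s)}"
    \<comment> \<open>Here m may be 0; \<open>acc\<close> then gives the value \<open>S 0\<close>,
      an empty sum.\<close>
    then obtain m where m: "k = Suc m" by (cases k) auto
    show "acceleration \<alpha> A k = d k"
      using k acc[of k] acc[of m] by (simp add: acceleration_def m S_def)
  qed
qed

end
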